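(* Let $0<\lambda<1$ and consider any one of the three fluid models (High Memory with parameter $\mu>0$; High Message; Constrained with parameters $\mu>0$ and integer $c\ge 1$). A fluid solution exists and is unique for any initial condition $s^0\in\mathcal{S}^1$. Furthermore, the fluid model has a unique equilibrium $s^*$, given by $$s_i^*=\lambda\,(\lambda P_0^* )^{i-1},\qquad \forall\, i\ge 1,$$ (with $s^*_0=1$), where $P_0^*=P_0(s^* )$ is given, for the three regimes considered, by: (i) High Memory: $P_0^*=\left[1-\frac{\mu(1-\lambda)}{\lambda}\right]^+$; (ii) High Message: $P_0^*=0$; (iii) Constrained: $P_0^*=\left[\sum_{k=0}^{c}\left(\frac{\mu(1-\lambda)}{\lambda}\right)^k\right]^{-1}$. This equilibrium is globally asymptotically stable, i.e., $\lim_{t\to\infty}\|s(t)-s^*\|_w=0$ for any initial condition $s^0\in\mathcal{S}^1$, where $s(\cdot)$ is the fluid solution with initial condition $s^0$.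
   Context: Notation: $[x]^+=\max\{x,0\}$. $\mathcal{S}=\{s\in[0,1]^{\mathbb{Z}_+}: s_0=1,\ s_i\ge s_{i+1}\ \forall i\ge 0\}$ and $\mathcal{S}^1=\{s\in\mathcal{S}:\sum_{i=0}^\infty s_i<\infty\}$. Weighted norm: $\|x\|_w^2=\sum_{i=0}^\infty |x_i|^2/2^i$. Fluid model: given an initial condition $s^0\in\mathcal{S}^1$, a function $s:[0,\infty)\to\mathcal{S}^1$, continuous (with respect to $\|\cdot\|_w$), is said to be a solution to the fluid model (or fluid solution) if: (1) $s(0)=s^0$; (2) $s_0(t)=1$ for all $t\ge0$; (3) for all $t\ge 0$ outside of a set of Lebesgue measure zero, and for every $i\ge1$, $s_i(t)$ is differentiable and satisfies $$\frac{ds_1}{dt}(t)=\lambda(1-P_0(s(t)))+\lambda(1-s_1(t))P_0(s(t))-(s_1(t)-s_2(t)),$$ $$\frac{ds_i}{dt}(t)=\lambda(s_{i-1}(t)-s_i(t))P_0(s(t))-(s_i(t)-s_{i+1}(t)),\quad \forall\, i\ge2,$$ where $P_0(s)$ is given, for the three regimes considered, by: (i) High Memory: $P_0(s)=\left[1-\frac{\mu(1-s_1)}{\lambda}\right]^+$, with a constant $\mu>0$; (ii) High Message: $P_0(s)=\left[1-\frac{1-s_2}{\lambda}\right]^+\mathbf{1}_{\{s_1=1\}}$; (iii) Constrained: $P_0(s)=\left[\sum_{k=0}^{c}\left(\frac{\mu(1-s_1)}{\lambda}\right)^k\right]^{-1}$, with constants $\mu>0$ and integer $c\ge1$, and with the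 convention $0^0=1$, so that $s_1=1$ yields $P_0(s)=1$. An equilibrium is a point $s^*\in\mathcal{S}^1$ at which the right-hand sides of all the differential equations above vanish.
   Formalization: A fluid solution is additionally required to have each coordinate s_i(t) absolutely continuous on every bounded interval [0,T]; with mere continuity and the equations holding almost everywhere, adding a small multiple of a Cantor function to s_1 breaks uniqueness and stability. *)

theory Defs
  imports "HOL-Analysis.Analysis"
begin

definition S :: "(nat \<Rightarrow> real) set" where
  "S = {s. (\<forall>i. s i \<in> {0..1}) \<and> s 0 = 1 \<and> (\<forall>i. s i \<ge> s (Suc i))}"

definition S1 :: "(nat \<Rightarrow> real) set" where
  "S1 = {s \<in> S. summable s}"

definition wnorm :: "(nat \<Rightarrow> real) \<Rightarrow> real" where
  "wnorm x = sqrt (\<Sum>i. \<bar>x i\<bar>\<^sup>2 / 2 ^ i)"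

text \<open>The arguments are \<open>\<mu>\<close> for high memory, and \<open>\<mu>\<close> and \<open>c\<close> for the constrained regime.\<close>

datatype regime = High_Memory real | High_Message | Constrained real nat

primrec admissible :: "regime \<Rightarrow> bool" where
  "admissible (High_Memory \<mu>) \<longleftrightarrow> \<mu> > 0"
| "admissible High_Message \<longleftrightarrow> True"
| "admissible (Constrained \<mu> c) \<longleftrightarrow> \<mu> > 0 \<and> c \<ge> 1"

primrec P0 :: "regime \<Rightarrow> real \<Rightarrow> (nat \<Rightarrow> real) \<Rightarrow> real" where
  "P0 (High_Memory \<mu>) lam s = max (1 - \<mu> * (1 - s 1) / lam) 0"
| "P0 High_Message lam s = max (1 - (1 - s 2) / lam) 0 * (if s 1 = 1 then 1 else 0)"
| "P0 (Constrained \<mu> c) lam s = inverse (\<Sum>k\<le>c. (\<mu> * (1 - s 1) / lam) ^ k)"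

text \<open>Right-hand side of the equation for \<open>s\<^sub>i\<close>; only meant for \<open>i \<ge> 1\<close>.\<close>

definition drift :: "regime \<Rightarrow> real \<Rightarrow> (nat \<Rightarrow> real) \<Rightarrow> nat \<Rightarrow> real" where
  "drift r lam s i =
     (if i = 1
      then lam * (1 - P0 r lam s) + lam * (1 - s 1) * P0 r lam s - (s 1 - s 2)
      else lam * (s (i - 1) - s i) * P0 r lam s - (s i - s (i + 1)))"

text \<open>
  Absolute continuity on a compact interval: \<open>D\<close> ranges over the finite families of
  non-overlapping closed subintervals.
\<close>

definition abs_continuous_on :: "real set \<Rightarrow> (real \<Rightarrow> real) \<Rightarrow> bool" where
  "abs_continuous_on I f \<longleftrightarrow>
     (\<forall>\<epsilon>>0. \<exists>\<delta>>0. \<forall>D. D division_of \<Union>D \<and> \<Union>D \<subseteq> I \<and> (\<Sum>K\<in>D. Sup K - Inf K) < \<delta> \<longrightarrow>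
        (\<Sum>K\<in>D. \<bar>f (Sup K) - f (Inf K)\<bar>) < \<epsilon>)"

text \<open>
  The differential equations hold almost everywhere, and solutions are understood in the sense of
  Caratheodory, i.e. with (locally) absolutely continuous coordinates. Without that clause a
  multiple of the Cantor function could be added to \<open>s\<^sub>1\<close>, and solutions would not be unique.
  Only the restriction of \<open>s\<close> to \<open>{0..}\<close> matters; at time \<open>0\<close> the derivative would be one-sided.
\<close>

definition fluid_solution ::
    "regime \<Rightarrow> real \<Rightarrow> (nat \<Rightarrow> real) \<Rightarrow> (real \<Rightarrow> nat \<Rightarrow> real) \<Rightarrow> bool" where
  "fluid_solution r lam s0 s \<longleftrightarrow>
     (\<forall>t\<ge>0. s t \<in> S1) \<and>
     (\<forall>t\<ge>0. ((\<lambda>u. wnorm (\<lambda>i. s u i - s t i)) \<longlongrightarrow> 0) (at t within {0..})) \<and>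
     (\<forall>i. \<forall>T\<ge>0. abs_continuous_on {0..T} (\<lambda>t. s t i)) \<and>
     s 0 = s0 \<and>
     (\<forall>t\<ge>0. s t 0 = 1) \<and>
     (\<exists>N\<in>null_sets lebesgue. \<forall>t\<in>{0..} - N. \<forall>i\<ge>1.
        ((\<lambda>u. s u i) has_real_derivative drift r lam (s t) i) (at t within {0..}))"

definition equilibrium :: "regime \<Rightarrow> real \<Rightarrow> (nat \<Rightarrow> real) \<Rightarrow> bool" where
  "equilibrium r lam s \<longleftrightarrow> s \<in> S1 \<and> (\<forall>i\<ge>1. drift r lam s i = 0)"

primrec P0_star :: "regime \<Rightarrow> real \<Rightarrow> real" where
  "P0_star (High_Memory \<mu>) lam = max (1 - \<mu> * (1 - lam) / lam) 0"
| "P0_star High_Message lam = 0"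
| "P0_star (Constrained \<mu> c) lam = inverse (\<Sum>k\<le>c. (\<mu> * (1 - lam) / lam) ^ k)"

end

theory Submission
  imports Defs
begin

text \<open>
  Write \<open>g = \<lambda> P\<^sub>0(s)\<close> for the gate: the rate at which arrivals are sent to queues that are
  not known to be idle. For two fluid solutions \<open>s\<close>, \<open>q\<close> with gates \<open>g\<close>, \<open>h\<close> and \<open>x = s - q\<close>, the
  equations give almost everywhere

    \<open>d|x\<^sub>1|/dt \<le> |x\<^sub>2| - |x\<^sub>1| - |g - h| s\<^sub>1 - h |x\<^sub>1|\<close>,

    \<open>d|x\<^sub>j|/dt \<le> |g - h| (s\<^sub>j\<^sub>-\<^sub>1 - s\<^sub>j) + h (|x\<^sub>j\<^sub>-\<^sub>1| - |x\<^sub>j|) - |x\<^sub>j| + |x\<^sub>j\<^sub>+\<^sub>1|\<close> for \<open>j \<ge> 2\<close>.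

  In the first line the term \<open>- |g - h| s\<^sub>1\<close> is a gain because all three gates increase with \<open>s\<^sub>1\<close>,
  so that \<open>g - h\<close> has the sign of \<open>x\<^sub>1\<close>. If \<open>x\<^sub>1 = 0\<close> and the gates still differ, the regime is High
  Message and \<open>s\<^sub>1 = q\<^sub>1 = 1\<close>; both first coordinates are then at their maximum, hence have derivative
  zero, and this forces \<open>g - h = x\<^sub>2\<close>, which is what the inequality needs
  (\<open>slope_le_abs_difference\<close>). Summed over \<open>j\<close> everything telescopes: the \<open>\<ell>\<^sup>1\<close> distance of two
  solutions does not increase, and it dissipates at rate \<open>|x\<^sub>1|\<close> (\<open>fluid_l1_contraction\<close>).

  Uniqueness is immediate. For stability take \<open>q\<close> to be the equilibrium. Then \<open>|x\<^sub>1|\<close> is integrable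
  over \<open>[0,\<infinity>)\<close>, and so is \<open>|g - h|\<close>, because \<open>P\<^sub>0\<close> is Lipschitz in \<open>s\<^sub>1\<close> at the equilibrium. The same
  telescoping sum over \<open>j \<ge> i\<close> bounds the time integral of \<open>|x\<^sub>i|\<close> by that of \<open>|x\<^sub>i\<^sub>-\<^sub>1|\<close>, so that all
  coordinates are integrable in time; as they are Lipschitz, they tend to zero
  (\<open>fluid_solution_converges\<close>).

  Existence is a Picard iteration, run in a form that keeps the iterates decreasing in \<open>i\<close> and
  bounded (\<open>picard_iteration.solution_exists\<close>). It applies directly when \<open>P\<^sub>0\<close> is a Lipschitz function
  of \<open>s\<^sub>1\<close>. In the High Message regime \<open>P\<^sub>0\<close> jumps, but a solution passes through at most three phases,
  each driven by a Lipschitz field: gate closed while \<open>s\<^sub>1 < 1\<close>; saturation \<open>s\<^sub>1 = 1\<close> with gate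
  \<open>\<lambda> - 1 + s\<^sub>2\<close> while \<open>s\<^sub>2 \<ge> 1 - \<lambda>\<close>; and, once \<open>s\<^sub>2\<close> has dropped to \<open>1 - \<lambda>\<close>, gate closed for ever,
  because with a closed gate \<open>s\<^sub>2\<close> cannot grow back (\<open>fluid_solution_exists_High_Message\<close>).
\<close>

section \<open>Absolutely continuous functions with one-sided slope bounds\<close>

text \<open>
  The bound concerns increments over intervals that contain \<open>t\<close>. Such bounds add up, they follow from
  a derivative, and they still make sense for \<open>|x|\<close> at a zero of \<open>x\<close>, where there may be no derivative.
\<close>

definition slope_le :: "(real \<Rightarrow> real) \<Rightarrow> real \<Rightarrow> real \<Rightarrow> bool" where
  "slope_le f t c \<longleftrightarrow>
     (\<forall>e>0. \<exists>d>0. \<forall>u v. 0 \<le> u \<and> u \<le> t \<and> t \<le> v \<and> v - u < d \<longrightarrow> f v - f u \<le> (c + e) * (v - u))"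

lemma slope_leE:
  assumes "slope_le f t c" "e > 0"
  obtains d where "d > 0"
    "\<And>u v. 0 \<le> u \<Longrightarrow> u \<le> t \<Longrightarrow> t \<le> v \<Longrightarrow> v - u < d \<Longrightarrow> f v - f u \<le> (c + e) * (v - u)"
  using assms unfolding slope_le_def by metis

lemma slope_le_add:
  assumes "slope_le f t a" "slope_le g t b"
  shows "slope_le (\<lambda>u. f u + g u) t (a + b)"
  unfolding slope_le_def
proof (intro allI impI)
  fix e :: real assume "e > 0"
  then have e2: "e / 2 > 0" by simp
  obtain d1 where d1: "d1 > 0"
    "\<And>u v. 0 \<le> u \<Longrightarrow> u \<le> t \<Longrightarrow> t \<le> v \<Longrightarrow> v - u < d1 \<Longrightarrow> f v - f u \<le> (a + e/2) * (v - u)"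
    using slope_leE[OF assms(1) e2] by blast
  obtain d2 where d2: "d2 > 0"
    "\<And>u v. 0 \<le> u \<Longrightarrow> u \<le> t \<Longrightarrow> t \<le> v \<Longrightarrow> v - u < d2 \<Longrightarrow> g v - g u \<le> (b + e/2) * (v - u)"
    using slope_leE[OF assms(2) e2] by blast
  show "\<exists>d>0. \<forall>u v. 0 \<le> u \<and> u \<le> t \<and> t \<le> v \<and> v - u < d \<longrightarrow>
          f v + g v - (f u + g u) \<le> (a + b + e) * (v - u)"
  proof (intro exI[of _ "min d1 d2"] conjI allI impI)
    fix u v assume *: "0 \<le> u \<and> u \<le> t \<and> t \<le> v \<and> v - u < min d1 d2"
    have "f v - f u + (g v - g u) \<le> (a + e/2) * (v - u) + (b + e/2) * (v - u)"
      using d1(2)[of u v] d2(2)[of u v] * by linarith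
    also have "\<dots> = (a + b + e) * (v - u)" by (simp add: algebra_simps)
    finally show "f v + g v - (f u + g u) \<le> (a + b + e) * (v - u)" by simp
  qed (use d1 d2 in auto)
qed

lemma slope_le_mono:
  assumes "slope_le f t a" "a \<le> b"
  shows "slope_le f t b"
  unfolding slope_le_def
proof (intro allI impI)
  fix e :: real assume "e > 0"
  obtain d where d: "d > 0"
    "\<And>u v. 0 \<le> u \<Longrightarrow> u \<le> t \<Longrightarrow> t \<le> v \<Longrightarrow> v - u < d \<Longrightarrow> f v - f u \<le> (a + e) * (v - u)"
    using slope_leE[OF assms(1) \<open>e > 0\<close>] by blast
  have "(a + e) * (v - u) \<le> (b + e) * (v - u)" if "u \<le> v" for u v
    using that assms(2) by (intro mult_right_mono) auto
  then show "\<exists>d>0. \<forall>u v. 0 \<le> u \<and> u \<le> t \<and> t \<le> v \<and> v - u < d \<longrightarrow> f v - f u \<le> (b + e) * (v - u)"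
    using d by (meson order_trans)
qed

lemma slope_le_sum:
  assumes "finite J" "\<And>j. j \<in> J \<Longrightarrow> slope_le (f j) t (c j)"
  shows "slope_le (\<lambda>u. \<Sum>j\<in>J. f j u) t (\<Sum>j\<in>J. c j)"
  using assms
proof (induction J rule: finite_induct)
  case empty
  show ?case unfolding slope_le_def by (auto intro: exI[of _ 1])
next
  case (insert j J)
  then show ?case by (simp add: slope_le_add)
qed

lemma derivative_straddle:
  assumes "(f has_real_derivative c) (at t within {0..})" "t \<ge> 0" "e > 0"
  obtains d where "d > 0"
    "\<And>u v. 0 \<le> u \<Longrightarrow> u \<le> t \<Longrightarrow> t \<le> v \<Longrightarrow> v - u < d \<Longrightarrow> \<bar>f v - f u - c * (v - u)\<bar> \<le> e * (v - u)"
proof -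
  have "(f has_derivative (\<lambda>x. c * x)) (at t within {0..})"
    using assms(1) by (simp add: has_field_derivative_def)
  then obtain d where d: "d > 0"
    "\<And>y. y \<in> {0..} \<Longrightarrow> \<bar>y - t\<bar> < d \<Longrightarrow> \<bar>f y - f t - c * (y - t)\<bar> \<le> e * \<bar>y - t\<bar>"
    using \<open>e > 0\<close> unfolding has_derivative_within_alt by auto
  show ?thesis
  proof (rule that[OF d(1)])
    fix u v assume *: "0 \<le> u" "u \<le> t" "t \<le> v" "v - u < d"
    have "\<bar>f v - f t - c * (v - t)\<bar> \<le> e * (v - t)" using d(2)[of v] * by auto
    moreover have "\<bar>f u - f t - c * (u - t)\<bar> \<le> e * (t - u)" using d(2)[of u] * by auto
    ultimately show "\<bar>f v - f u - c * (v - u)\<bar> \<le> e * (v - u)"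
      by (simp add: algebra_simps)
  qed
qed

lemma slope_le_derivative:
  assumes "(f has_real_derivative c) (at t within {0..})" "t \<ge> 0"
  shows "slope_le f t c"
  unfolding slope_le_def
proof (intro allI impI)
  fix e :: real assume "e > 0"
  obtain d where "d > 0"
    "\<And>u v. 0 \<le> u \<Longrightarrow> u \<le> t \<Longrightarrow> t \<le> v \<Longrightarrow> v - u < d \<Longrightarrow> \<bar>f v - f u - c * (v - u)\<bar> \<le> e * (v - u)"
    using derivative_straddle[OF assms \<open>e > 0\<close>] by blast
  then show "\<exists>d>0. \<forall>u v. 0 \<le> u \<and> u \<le> t \<and> t \<le> v \<and> v - u < d \<longrightarrow> f v - f u \<le> (c + e) * (v - u)"
    by (intro exI[of _ d]) (fastforce simp: algebra_simps)
qed

text \<open>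
  At a zero of \<open>x\<close> the increment of \<open>|x|\<close> over a straddling interval is at most that of \<open>x\<close> in
  absolute value, whence the third hypothesis.
\<close>

lemma slope_le_abs:
  assumes der: "(x has_real_derivative a) (at t within {0..})" and "t \<ge> 0"
    and pos: "x t > 0 \<Longrightarrow> a \<le> c" and neg: "x t < 0 \<Longrightarrow> - a \<le> c" and zero: "x t = 0 \<Longrightarrow> \<bar>a\<bar> \<le> c"
  shows "slope_le (\<lambda>u. \<bar>x u\<bar>) t c"
proof (cases "x t = 0")
  case True
  show ?thesis
    unfolding slope_le_def
  proof (intro allI impI)
    fix e :: real assume "e > 0"
    obtain d where d: "d > 0"
      "\<And>u v. 0 \<le> u \<Longrightarrow> u \<le> t \<Longrightarrow> t \<le> v \<Longrightarrow> v - u < d \<Longrightarrow> \<bar>x v - x u - a * (v - u)\<bar> \<le> e * (v - u)"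
      using derivative_straddle[OF der \<open>t \<ge> 0\<close> \<open>e > 0\<close>] by blast
    show "\<exists>d>0. \<forall>u v. 0 \<le> u \<and> u \<le> t \<and> t \<le> v \<and> v - u < d \<longrightarrow> \<bar>x v\<bar> - \<bar>x u\<bar> \<le> (c + e) * (v - u)"
    proof (intro exI[of _ d] conjI allI impI)
      fix u v assume *: "0 \<le> u \<and> u \<le> t \<and> t \<le> v \<and> v - u < d"
      have "\<bar>x v\<bar> - \<bar>x u\<bar> \<le> \<bar>a * (v - u)\<bar> + e * (v - u)"
        using d(2)[of u v] * by linarith
      also have "\<bar>a * (v - u)\<bar> = \<bar>a\<bar> * (v - u)" using * by (simp add: abs_mult)
      also have "\<dots> \<le> c * (v - u)" using zero[OF True] * by (intro mult_right_mono) auto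
      finally show "\<bar>x v\<bar> - \<bar>x u\<bar> \<le> (c + e) * (v - u)" by (simp add: algebra_simps)
    qed (use d in auto)
  qed
next
  case False
  have "continuous (at t within {0..}) x"
    using der by (rule DERIV_continuous)
  then obtain r where r: "r > 0" "\<And>u. u \<ge> 0 \<Longrightarrow> \<bar>u - t\<bar> < r \<Longrightarrow> \<bar>x u - x t\<bar> < \<bar>x t\<bar>"
    using False unfolding continuous_within_eps_delta dist_real_def
    by (metis atLeast_iff zero_less_abs_iff)
  have "((\<lambda>u. sgn (x t) * x u) has_real_derivative sgn (x t) * a) (at t within {0..})"
    by (intro DERIV_cmult der)
  then have "((\<lambda>u. \<bar>x u\<bar>) has_real_derivative sgn (x t) * a) (at t within {0..})"
  proof (rule has_field_derivative_transform_within[OF _ r(1)])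
    fix u assume "u \<in> {0..}" "dist u t < r"
    then have "\<bar>x u - x t\<bar> < \<bar>x t\<bar>" using r(2)[of u] by (auto simp: dist_real_def)
    then show "sgn (x t) * x u = \<bar>x u\<bar>" by (auto simp: sgn_if abs_if split: if_splits)
  qed (use \<open>t \<ge> 0\<close> in auto)
  moreover have "sgn (x t) * a \<le> c" using False pos neg by (auto simp: sgn_if)
  ultimately show ?thesis using slope_le_derivative[OF _ \<open>t \<ge> 0\<close>] slope_le_mono by blast
qed

lemma abs_continuous_on_subset:
  "abs_continuous_on I f \<Longrightarrow> J \<subseteq> I \<Longrightarrow> abs_continuous_on J f"
  unfolding abs_continuous_on_def by (meson order_trans)

lemma abs_continuous_on_dominated:
  assumes "abs_continuous_on I f" "abs_continuous_on I g"
    and dom: "\<And>u v. \<bar>h v - h u\<bar> \<le> \<bar>f v - f u\<bar> + \<bar>g v - g u\<bar>"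
  shows "abs_continuous_on I h"
  unfolding abs_continuous_on_def
proof (intro allI impI)
  fix e :: real assume "e > 0"
  then have "e / 2 > 0" by simp
  obtain d1 where d1: "d1 > 0"
    "\<And>D. D division_of \<Union>D \<Longrightarrow> \<Union>D \<subseteq> I \<Longrightarrow> (\<Sum>K\<in>D. Sup K - Inf K) < d1 \<Longrightarrow>
        (\<Sum>K\<in>D. \<bar>f (Sup K) - f (Inf K)\<bar>) < e / 2"
    using assms(1) \<open>e / 2 > 0\<close> unfolding abs_continuous_on_def by meson
  obtain d2 where d2: "d2 > 0"
    "\<And>D. D division_of \<Union>D \<Longrightarrow> \<Union>D \<subseteq> I \<Longrightarrow> (\<Sum>K\<in>D. Sup K - Inf K) < d2 \<Longrightarrow>
        (\<Sum>K\<in>D. \<bar>g (Sup K) - g (Inf K)\<bar>) < e / 2"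
    using assms(2) \<open>e / 2 > 0\<close> unfolding abs_continuous_on_def by meson
  show "\<exists>\<delta>>0. \<forall>D. D division_of \<Union>D \<and> \<Union>D \<subseteq> I \<and> (\<Sum>K\<in>D. Sup K - Inf K) < \<delta> \<longrightarrow>
        (\<Sum>K\<in>D. \<bar>h (Sup K) - h (Inf K)\<bar>) < e"
  proof (intro exI[of _ "min d1 d2"] conjI allI impI)
    fix D assume D: "D division_of \<Union>D \<and> \<Union>D \<subseteq> I \<and> (\<Sum>K\<in>D. Sup K - Inf K) < min d1 d2"
    have "(\<Sum>K\<in>D. \<bar>h (Sup K) - h (Inf K)\<bar>)
        \<le> (\<Sum>K\<in>D. \<bar>f (Sup K) - f (Inf K)\<bar> + \<bar>g (Sup K) - g (Inf K)\<bar>)"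
      by (intro sum_mono dom)
    also have "\<dots> < e" using d1(2)[of D] d2(2)[of D] D by (simp add: sum.distrib)
    finally show "(\<Sum>K\<in>D. \<bar>h (Sup K) - h (Inf K)\<bar>) < e" .
  qed (use d1 d2 in auto)
qed

lemma division_interval_real:
  fixes K :: "real set"
  assumes "D division_of A" "K \<in> D"
  obtains a b where "K = {a..b}" "a \<le> b" "a \<in> A" "b \<in> A" "Sup K = b" "Inf K = a"
proof -
  obtain a b where "K = cbox a b" using division_ofD(4)[OF assms] by blast
  moreover have "K \<noteq> {}" "K \<subseteq> A" using division_ofD(2,3)[OF assms] by auto
  ultimately show ?thesis using that[of a b] by (auto simp: subset_iff)
qed

lemma lipschitz_imp_abs_continuous_on:
  assumes lip: "\<And>u v. u \<in> I \<Longrightarrow> v \<in> I \<Longrightarrow> u \<le> v \<Longrightarrow> \<bar>f v - f u\<bar> \<le> C * (v - u)"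
  shows "abs_continuous_on I f"
  unfolding abs_continuous_on_def
proof (intro allI impI)
  fix e :: real assume "e > 0"
  show "\<exists>\<delta>>0. \<forall>D. D division_of \<Union>D \<and> \<Union>D \<subseteq> I \<and> (\<Sum>K\<in>D. Sup K - Inf K) < \<delta> \<longrightarrow>
        (\<Sum>K\<in>D. \<bar>f (Sup K) - f (Inf K)\<bar>) < e"
  proof (intro exI[of _ "e / (\<bar>C\<bar> + 1)"] conjI allI impI)
    fix D assume D: "D division_of \<Union>D \<and> \<Union>D \<subseteq> I \<and> (\<Sum>K\<in>D. Sup K - Inf K) < e / (\<bar>C\<bar> + 1)"
    have bound: "\<bar>f (Sup K) - f (Inf K)\<bar> \<le> (\<bar>C\<bar> + 1) * (Sup K - Inf K)" if K: "K \<in> D" for K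
    proof -
      obtain a b where ab: "a \<le> b" "a \<in> \<Union>D" "b \<in> \<Union>D" "Sup K = b" "Inf K = a"
        by (rule division_interval_real[OF conjunct1[OF D] K]) blast
      have "\<bar>f b - f a\<bar> \<le> C * (b - a)" using lip[of a b] ab D by auto
      also have "\<dots> \<le> (\<bar>C\<bar> + 1) * (b - a)" using ab by (intro mult_right_mono) auto
      finally show ?thesis using ab by simp
    qed
    have "(\<Sum>K\<in>D. \<bar>f (Sup K) - f (Inf K)\<bar>) \<le> (\<Sum>K\<in>D. (\<bar>C\<bar> + 1) * (Sup K - Inf K))"
      by (intro sum_mono bound)
    also have "\<dots> = (\<bar>C\<bar> + 1) * (\<Sum>K\<in>D. Sup K - Inf K)" by (simp add: sum_distrib_left)
    also have "\<dots> < (\<bar>C\<bar> + 1) * (e / (\<bar>C\<bar> + 1))"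
      by (rule mult_strict_left_mono) (use D in auto)
    also have "\<dots> = e"
      by (simp add: field_simps add_nonneg_eq_0_iff)
    finally show "(\<Sum>K\<in>D. \<bar>f (Sup K) - f (Inf K)\<bar>) < e" .
  qed (use \<open>e > 0\<close> in \<open>auto intro!: divide_pos_pos add_nonneg_pos\<close>)
qed

lemma division_length_le_measure:
  fixes D :: "real set set"
  assumes D: "D division_of \<Union>D" "\<Union>D \<subseteq> U" and U: "U \<in> lmeasurable"
  shows "(\<Sum>K\<in>D. Sup K - Inf K) \<le> measure lebesgue U"
proof -
  have len: "((\<lambda>x. 1::real) has_integral (Sup K - Inf K)) K" if K: "K \<in> D" for K
  proof -
    obtain a b where "K = {a..b}" "a \<le> b" "Sup K = b" "Inf K = a"
      by (rule division_interval_real[OF D(1) K]) blast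
    then show ?thesis using has_integral_const_real[of "1::real" a b] by simp
  qed
  have "((\<lambda>x. 1) has_integral (\<Sum>K\<in>D. Sup K - Inf K)) (\<Union>D)"
    by (rule has_integral_combine_division[OF D(1)]) (use len in auto)
  moreover have "((\<lambda>x. 1) has_integral (measure lebesgue U)) U"
    using U by (metis has_integral_integral lmeasurable_iff_integrable_on lmeasure_integral)
  ultimately show ?thesis
    using has_integral_subset_le[OF D(2)] by (meson zero_le_one)
qed

text \<open>
  By Cousin's lemma there is a tagged division fine for a gauge of two kinds: near a tag outside the
  null set \<open>N\<close> the slope bound applies, and around the tags in \<open>N\<close> the intervals stay inside an open
  superset of \<open>N\<close> of small measure, so that absolute continuity makes their joint contribution small.
\<close>

lemma abs_continuous_on_nonincreasing:
  assumes ac: "abs_continuous_on {a..b} f" and "0 \<le> a" "a \<le> b"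
    and N: "N \<in> null_sets lebesgue"
    and slope: "\<And>t. t \<in> {a..b} - N \<Longrightarrow> slope_le f t 0"
  shows "f b \<le> f a"
proof (rule field_le_epsilon)
  fix e :: real assume "e > 0"
  define e' where "e' = e / (2 * (b - a + 1))"
  have "e' > 0" using \<open>e > 0\<close> \<open>a \<le> b\<close> by (simp add: e'_def)
  have e'_b: "e' * (b - a) \<le> e / 2"
    using \<open>e > 0\<close> \<open>a \<le> b\<close> by (simp add: e'_def field_simps)
  obtain \<delta> where \<delta>: "\<delta> > 0" "\<And>D. D division_of \<Union>D \<Longrightarrow> \<Union>D \<subseteq> {a..b} \<Longrightarrow> (\<Sum>K\<in>D. Sup K - Inf K) < \<delta> \<Longrightarrow>
        (\<Sum>K\<in>D. \<bar>f (Sup K) - f (Inf K)\<bar>) < e / 2"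
    using ac half_gt_zero[OF \<open>e > 0\<close>] unfolding abs_continuous_on_def by meson
  obtain U where U: "open U" "N \<subseteq> U" "emeasure lebesgue (U - N) < ennreal \<delta>"
    using sets_lebesgue_outer_open[of N \<delta>] N \<delta>(1) by (metis null_setsD2)
  have U_sets: "U \<in> sets lebesgue" using U(1) by (simp add: borel_open)
  have "emeasure lebesgue U \<le> emeasure lebesgue (U - N) + emeasure lebesgue N"
    using U(2) U_sets N by (metis Diff_partition Un_commute emeasure_subadditive null_setsD2 sets.Diff)
  then have eU: "emeasure lebesgue U < ennreal \<delta>"
    using N U(3) by (simp add: null_setsD1)
  then have lmU: "U \<in> lmeasurable"
    using U_sets by (intro fmeasurableI) (auto simp: order_less_le_trans)
  have mU: "measure lebesgue U < \<delta>"
    using eU \<delta>(1) lmU by (metis emeasure_eq_measure2 ennreal_less_iff measure_nonneg)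
  have "\<exists>r>0. \<forall>u v. 0 \<le> u \<and> u \<le> t \<and> t \<le> v \<and> v - u < r \<longrightarrow> f v - f u \<le> e' * (v - u)"
    if "t \<in> {a..b} - N" for t
    using slope_leE[OF slope[OF that] \<open>e' > 0\<close>] by (metis add_0)
  then obtain \<rho> where \<rho>: "\<And>t. t \<in> {a..b} - N \<Longrightarrow> \<rho> t > 0"
    "\<And>t u v. t \<in> {a..b} - N \<Longrightarrow> 0 \<le> u \<Longrightarrow> u \<le> t \<Longrightarrow> t \<le> v \<Longrightarrow> v - u < \<rho> t \<Longrightarrow> f v - f u \<le> e' * (v - u)"
    by metis
  define \<gamma> where "\<gamma> t = (if t \<in> N then U else if t \<in> {a..b} then ball t (\<rho> t / 2) else ball t 1)" for t
  have "gauge \<gamma>"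
    unfolding gauge_def \<gamma>_def using U \<rho>(1) by auto
  then obtain p where p: "p tagged_division_of {a..b}" "\<gamma> fine p"
    using fine_division_exists_real by metis
  define p1 where "p1 = p \<inter> {(x, K). x \<in> N}"
  define p2 where "p2 = p - p1"
  have fin: "finite p" using p(1) by blast
  have p1_part: "p1 tagged_partial_division_of {a..b}"
    using tagged_partial_division_subset[of p "{a..b}" p1] p(1)
    unfolding tagged_division_of_def p1_def by blast
  define D where "D = snd ` p1"
  have D: "D division_of \<Union>D"
    unfolding D_def by (rule partial_division_of_tagged_division[OF p1_part])
  have D_ab: "\<Union>D \<subseteq> {a..b}"
    unfolding D_def using tagged_partial_division_ofD(3)[OF p1_part] by (fastforce simp del: atLeastAtMost_iff)
  have D_U: "\<Union>D \<subseteq> U"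
  proof -
    have "K \<subseteq> U" if "(x, K) \<in> p" "x \<in> N" for x K
      using fineD[OF p(2) that(1)] that(2) by (simp add: \<gamma>_def)
    then show ?thesis unfolding D_def p1_def by fastforce
  qed
  have "(\<Sum>K\<in>D. Sup K - Inf K) < \<delta>"
    using division_length_le_measure[OF D D_U lmU] mU by linarith
  then have small: "(\<Sum>K\<in>D. \<bar>f (Sup K) - f (Inf K)\<bar>) < e / 2"
    by (rule \<delta>(2)[OF D D_ab])
  \<comment> \<open>Two tags can share an interval only if it is degenerate, where \<open>d\<close> is zero. The case distinction covers empty boxes, for which \<open>Sup\<close> and \<open>Inf\<close> are unspecified.\<close>
  define d where "d K = (if K = {} then 0 else \<bar>f (Sup K) - f (Inf K)\<bar>)" for K
  have degenerate: "d (cbox u v) = 0" if "box u v = {}" for u v :: real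
    using that by (cases "u = v") (auto simp: d_def)
  have "(\<Sum>(x,K)\<in>p1. f (Sup K) - f (Inf K)) \<le> (\<Sum>(x,K)\<in>p1. d K)"
  proof (intro sum_mono, clarify)
    fix x K assume "(x, K) \<in> p1"
    then have "x \<in> K" using tagged_partial_division_ofD(2)[OF p1_part] by blast
    then show "f (Sup K) - f (Inf K) \<le> d K" by (auto simp: d_def)
  qed
  also have "\<dots> = (\<Sum>K\<in>D. d K)"
    unfolding D_def
    using sum.over_tagged_division_lemma[OF tagged_partial_division_of_Union_self[OF p1_part], of d] degenerate
    by blast
  also have "\<dots> \<le> (\<Sum>K\<in>D. \<bar>f (Sup K) - f (Inf K)\<bar>)"
    by (intro sum_mono) (auto simp: d_def)
  finally have part1: "(\<Sum>(x,K)\<in>p1. f (Sup K) - f (Inf K)) \<le> e / 2" using small by linarith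
  have tag: "a \<le> Inf K \<and> Inf K \<le> x \<and> x \<le> Sup K \<and> Sup K \<le> b \<and> Inf K \<in> K \<and> Sup K \<in> K"
    if xK: "(x, K) \<in> p" for x K
  proof -
    obtain u v where "K = cbox u v" using tagged_division_ofD(4)[OF p(1) xK] by blast
    moreover have "x \<in> K" "K \<subseteq> {a..b}" using tagged_division_ofD(2,3)[OF p(1) xK] by auto
    ultimately show ?thesis by auto
  qed
  have "(\<Sum>(x,K)\<in>p2. f (Sup K) - f (Inf K)) \<le> (\<Sum>(x,K)\<in>p2. e' * (Sup K - Inf K))"
  proof (intro sum_mono, clarify)
    fix x K assume xK: "(x, K) \<in> p2"
    then have xKp: "(x, K) \<in> p" and "x \<notin> N" by (auto simp: p2_def p1_def)
    note T = tag[OF xKp]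
    have x: "x \<in> {a..b} - N" using T \<open>x \<notin> N\<close> by auto
    have "K \<subseteq> ball x (\<rho> x / 2)" using fineD[OF p(2) xKp] x by (simp add: \<gamma>_def)
    then have "Inf K \<in> ball x (\<rho> x / 2)" "Sup K \<in> ball x (\<rho> x / 2)" using T by blast+
    then have "Sup K - Inf K < \<rho> x" unfolding mem_ball dist_real_def by linarith
    then show "f (Sup K) - f (Inf K) \<le> e' * (Sup K - Inf K)"
      using \<rho>(2)[OF x, of "Inf K" "Sup K"] T \<open>0 \<le> a\<close> by auto
  qed
  also have "\<dots> \<le> (\<Sum>(x,K)\<in>p. e' * (Sup K - Inf K))"
  proof (rule sum_mono2[OF fin])
    fix z assume "z \<in> p - p2"
    then obtain x K where "z = (x, K)" "(x, K) \<in> p" by (cases z) auto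
    then show "0 \<le> (case z of (x, K) \<Rightarrow> e' * (Sup K - Inf K))" using tag[of x K] \<open>e' > 0\<close> by simp
  qed (simp add: p2_def)
  also have "\<dots> = e' * b - e' * a"
    using additive_tagged_division_1[OF \<open>a \<le> b\<close> p(1), of "\<lambda>x. e' * x"]
    by (simp add: algebra_simps)
  finally have part2: "(\<Sum>(x,K)\<in>p2. f (Sup K) - f (Inf K)) \<le> e / 2"
    using e'_b by (simp add: algebra_simps)
  have "f b - f a = (\<Sum>(x,K)\<in>p. f (Sup K) - f (Inf K))"
    using additive_tagged_division_1[OF \<open>a \<le> b\<close> p(1), of f] by simp
  also have "\<dots> = (\<Sum>(x,K)\<in>p2. f (Sup K) - f (Inf K)) + (\<Sum>(x,K)\<in>p1. f (Sup K) - f (Inf K))"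
    unfolding p2_def by (rule sum.subset_diff) (use fin in \<open>auto simp: p1_def\<close>)
  finally show "f b \<le> f a + e" using part1 part2 by linarith
qed

lemma integral_has_real_derivative_halfline:
  assumes "continuous_on {0..} c" "t \<ge> (0::real)"
  shows "((\<lambda>x. integral {0..x} c) has_real_derivative c t) (at t within {0..})"
proof -
  have "((\<lambda>x. integral {0..x} c) has_real_derivative c t) (at t within {0..t+1})"
    using assms by (intro integral_has_real_derivative continuous_on_subset[OF assms(1)]) auto
  moreover have "at t within {0..t+1} = at t within {0..}"
    by (rule at_within_nhd[of _ "{..<t+1}"]) (use assms in auto)
  ultimately show ?thesis by simp
qed

lemma abs_continuous_on_integral:
  assumes "continuous_on {0..} c"
  shows "abs_continuous_on {0..T} (\<lambda>x. integral {0..x} (c :: real \<Rightarrow> real))"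
proof -
  have int: "c integrable_on {a..b}" if "0 \<le> a" for a b
    using that by (intro integrable_continuous_real continuous_on_subset[OF assms]) auto
  have "compact (c ` {0..T})"
    by (intro compact_continuous_image continuous_on_subset[OF assms]) auto
  then obtain M where M: "\<And>x. x \<in> {0..T} \<Longrightarrow> \<bar>c x\<bar> \<le> M"
    using compact_imp_bounded bounded_iff by (metis image_eqI real_norm_def)
  show ?thesis
  proof (rule lipschitz_imp_abs_continuous_on[where C = M])
    fix u v assume uv: "u \<in> {0..T}" "v \<in> {0..T}" "u \<le> v"
    have "integral {0..u} c + integral {u..v} c = integral {0..v} c"
      by (rule Henstock_Kurzweil_Integration.integral_combine) (use uv int in auto)
    moreover have "norm (integral {u..v} c) \<le> M * (v - u)"
      by (rule integral_bound) (use uv M in \<open>auto intro!: continuous_on_subset[OF assms]\<close>)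
    ultimately show "\<bar>integral {0..v} c - integral {0..u} c\<bar> \<le> M * (v - u)" by auto
  qed
qed

text \<open>Subtracting the indefinite integral of \<open>c\<close> reduces this to a function whose slope is at most zero.\<close>

lemma slope_le_imp_increment_le_integral:
  assumes ac: "abs_continuous_on {0..T} f" and "0 \<le> T"
    and N: "N \<in> null_sets lebesgue"
    and c: "continuous_on {0..} c"
    and slope: "\<And>t. t \<in> {0..T} - N \<Longrightarrow> slope_le f t (c t)"
  shows "f T - f 0 \<le> integral {0..T} c"
proof -
  define h where "h t = f t + - integral {0..t} c" for t
  have "h T \<le> h 0"
  proof (rule abs_continuous_on_nonincreasing[OF _ _ \<open>0 \<le> T\<close> N])
    show "abs_continuous_on {0..T} h"
      by (rule abs_continuous_on_dominated[OF ac abs_continuous_on_integral[OF c]]) (auto simp: h_def)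
    fix t assume t: "t \<in> {0..T} - N"
    have "slope_le (\<lambda>t. - integral {0..t} c) t (- c t)"
      using t by (intro slope_le_derivative DERIV_minus integral_has_real_derivative_halfline c) auto
    from slope_le_add[OF slope[OF t] this] show "slope_le h t 0" by (simp add: h_def[abs_def])
  qed auto
  then show ?thesis by (simp add: h_def)
qed

section \<open>The gate and the drift\<close>

lemma S_D:
  assumes "s \<in> S"
  shows "0 \<le> s i" "s i \<le> 1" "s 0 = 1" "s (Suc i) \<le> s i"
  using assms by (auto simp: S_def)

lemma S1_D:
  assumes "s \<in> S1"
  shows "s \<in> S" "summable s" "s \<longlonglongrightarrow> 0"
  using assms by (auto simp: S1_def intro: summable_LIMSEQ_zero)

lemma one_le_geometric_sum:
  assumes "(x::real) \<ge> 0"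
  shows "1 \<le> (\<Sum>k\<le>c. x ^ k)"
proof -
  have "(\<Sum>k\<in>{0}. x ^ k) \<le> (\<Sum>k\<le>c. x ^ k)"
    by (rule sum_mono2) (use assms in auto)
  then show ?thesis by simp
qed

lemma P0_bounds:
  assumes "s \<in> S" "lam > 0" "admissible r"
  shows "0 \<le> P0 r lam s" "P0 r lam s \<le> 1"
proof -
  have "0 \<le> s 1" "s 1 \<le> 1" "0 \<le> s 2" "s 2 \<le> 1" using assms(1) S_D by blast+
  then have "0 \<le> P0 r lam s \<and> P0 r lam s \<le> 1"
  proof (cases r)
    case (Constrained \<mu> c)
    have "0 \<le> \<mu> * (1 - s 1) / lam" using assms Constrained \<open>s 1 \<le> 1\<close> by simp
    note one_le_geometric_sum[OF this, of c]
    then show ?thesis using Constrained by (simp add: inverse_le_1_iff)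
  qed (use assms in \<open>auto simp: max_def mult_le_one\<close>)
  then show "0 \<le> P0 r lam s" "P0 r lam s \<le> 1" by auto
qed

text \<open>
  In the High Message regime \<open>P\<^sub>0\<close> also depends on \<open>s\<^sub>2\<close>, but the strict inequality puts the smaller
  first coordinate below saturation, where the gate is closed.
\<close>

lemma P0_mono:
  assumes s: "s \<in> S" and q: "q \<in> S" and "s 1 < q 1" "lam > 0" "admissible r"
  shows "P0 r lam s \<le> P0 r lam q"
proof (cases r)
  case (High_Memory \<mu>)
  then have "\<mu> * (1 - q 1) / lam \<le> \<mu> * (1 - s 1) / lam"
    using assms by (intro divide_right_mono mult_left_mono) auto
  then show ?thesis using High_Memory by auto
next
  case High_Message
  then show ?thesis using S_D(2)[OF q, of 1] \<open>s 1 < q 1\<close> by (simp add: max_def)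
next
  case (Constrained \<mu> c)
  have "0 \<le> \<mu> * (1 - q 1) / lam" using assms Constrained S_D(2)[OF q, of 1] by simp
  moreover have "\<mu> * (1 - q 1) / lam \<le> \<mu> * (1 - s 1) / lam"
    using assms Constrained by (intro divide_right_mono mult_left_mono) auto
  ultimately have "(\<Sum>k\<le>c. (\<mu> * (1 - q 1) / lam) ^ k) \<le> (\<Sum>k\<le>c. (\<mu> * (1 - s 1) / lam) ^ k)"
    by (intro sum_mono power_mono)
  moreover have "1 \<le> (\<Sum>k\<le>c. (\<mu> * (1 - q 1) / lam) ^ k)"
    by (rule one_le_geometric_sum) fact
  ultimately show ?thesis using Constrained by (simp add: le_imp_inverse_le)
qed

lemma power_lipschitz_on_interval:
  fixes B :: real assumes "B \<ge> 0"
  shows "\<exists>C\<ge>0. \<forall>x\<in>{0..B}. \<forall>y\<in>{0..B}. \<bar>x ^ k - y ^ k\<bar> \<le> C * \<bar>x - y\<bar>"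
proof (induction k)
  case (Suc k)
  then obtain C where C: "C \<ge> 0" "\<And>x y. x \<in> {0..B} \<Longrightarrow> y \<in> {0..B} \<Longrightarrow> \<bar>x ^ k - y ^ k\<bar> \<le> C * \<bar>x - y\<bar>"
    by auto
  have "\<bar>x ^ Suc k - y ^ Suc k\<bar> \<le> (B * C + B ^ k) * \<bar>x - y\<bar>" if x: "x \<in> {0..B}" and y: "y \<in> {0..B}" for x y
  proof -
    have "x ^ Suc k - y ^ Suc k = x * (x ^ k - y ^ k) + y ^ k * (x - y)" by (simp add: algebra_simps)
    then have "\<bar>x ^ Suc k - y ^ Suc k\<bar> \<le> \<bar>x\<bar> * \<bar>x ^ k - y ^ k\<bar> + \<bar>y ^ k\<bar> * \<bar>x - y\<bar>"
      by (metis abs_mult abs_triangle_ineq)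
    also have "\<dots> \<le> B * (C * \<bar>x - y\<bar>) + B ^ k * \<bar>x - y\<bar>"
      using x y C(2)[OF x y] \<open>C \<ge> 0\<close> by (intro add_mono mult_mono) (auto simp: power_mono)
    finally show ?thesis by (simp add: algebra_simps)
  qed
  moreover have "B * C + B ^ k \<ge> 0" using assms C by simp
  ultimately show ?case by blast
qed (auto intro: exI[of _ 0])

lemma geometric_sum_lipschitz_on_interval:
  fixes B :: real assumes "B \<ge> 0"
  shows "\<exists>C\<ge>0. \<forall>x\<in>{0..B}. \<forall>y\<in>{0..B}. \<bar>(\<Sum>k\<le>c. x ^ k) - (\<Sum>k\<le>c. y ^ k)\<bar> \<le> C * \<bar>x - y\<bar>"
proof -
  have "\<forall>k. \<exists>C\<ge>0. \<forall>x\<in>{0..B}. \<forall>y\<in>{0..B}. \<bar>x ^ k - y ^ k\<bar> \<le> C * \<bar>x - y\<bar>"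
    using power_lipschitz_on_interval[OF assms] by blast
  then obtain C where C: "\<And>k. C k \<ge> 0" "\<And>k x y. x \<in> {0..B} \<Longrightarrow> y \<in> {0..B} \<Longrightarrow> \<bar>x ^ k - y ^ k\<bar> \<le> C k * \<bar>x - y\<bar>"
    by metis
  have "\<bar>(\<Sum>k\<le>c. x ^ k) - (\<Sum>k\<le>c. y ^ k)\<bar> \<le> (\<Sum>k\<le>c. C k) * \<bar>x - y\<bar>"
    if x: "x \<in> {0..B}" and y: "y \<in> {0..B}" for x y
  proof -
    have "\<bar>(\<Sum>k\<le>c. x ^ k) - (\<Sum>k\<le>c. y ^ k)\<bar> \<le> (\<Sum>k\<le>c. \<bar>x ^ k - y ^ k\<bar>)"
      by (simp add: sum_subtractf[symmetric])
    also have "\<dots> \<le> (\<Sum>k\<le>c. C k * \<bar>x - y\<bar>)"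
      using C(2)[OF x y] by (rule sum_mono)
    finally show ?thesis by (simp add: sum_distrib_right)
  qed
  then show ?thesis using C(1) by (intro exI[of _ "\<Sum>k\<le>c. C k"]) (auto intro: sum_nonneg)
qed

text \<open>
  In the Constrained regime \<open>P\<^sub>0\<close> is the reciprocal of a polynomial that is at least 1 on the relevant
  interval, since its constant term is 1.
\<close>

lemma P0_lipschitz:
  assumes "lam > 0" "admissible r" "r \<noteq> High_Message"
  obtains L where "L \<ge> 0" "\<And>s q. s \<in> S \<Longrightarrow> q \<in> S \<Longrightarrow> \<bar>P0 r lam s - P0 r lam q\<bar> \<le> L * \<bar>s 1 - q 1\<bar>"
proof (cases r)
  case (High_Memory \<mu>)
  then have "\<mu> > 0" using assms by simp
  have "\<bar>P0 r lam s - P0 r lam q\<bar> \<le> (\<mu> / lam) * \<bar>s 1 - q 1\<bar>" for s q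
  proof -
    have "\<bar>P0 r lam s - P0 r lam q\<bar> \<le> \<bar>\<mu> * (1 - s 1) / lam - \<mu> * (1 - q 1) / lam\<bar>"
      using High_Memory by (simp add: max_def abs_minus_commute)
    also have "\<mu> * (1 - s 1) / lam - \<mu> * (1 - q 1) / lam = (\<mu> / lam) * (q 1 - s 1)"
      using \<open>lam > 0\<close> by (simp add: field_simps)
    also have "\<bar>(\<mu> / lam) * (q 1 - s 1)\<bar> = (\<mu> / lam) * \<bar>s 1 - q 1\<bar>"
      using \<open>\<mu> > 0\<close> \<open>lam > 0\<close> by (simp add: abs_mult abs_minus_commute)
    finally show ?thesis .
  qed
  then show ?thesis using that[of "\<mu> / lam"] \<open>\<mu> > 0\<close> \<open>lam > 0\<close> by simp
next
  case (Constrained \<mu> c)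
  then have "\<mu> > 0" using assms by simp
  then have "0 \<le> \<mu> / lam" using \<open>lam > 0\<close> by simp
  from geometric_sum_lipschitz_on_interval[OF this, of c]
  obtain C where C: "C \<ge> 0" "\<And>x y. x \<in> {0..\<mu>/lam} \<Longrightarrow> y \<in> {0..\<mu>/lam} \<Longrightarrow>
      \<bar>(\<Sum>k\<le>c. x ^ k) - (\<Sum>k\<le>c. y ^ k)\<bar> \<le> C * \<bar>x - y\<bar>"
    by auto
  have "\<bar>P0 r lam s - P0 r lam q\<bar> \<le> (C * (\<mu> / lam)) * \<bar>s 1 - q 1\<bar>" if s: "s \<in> S" and q: "q \<in> S" for s q
  proof -
    define x where "x = \<mu> * (1 - s 1) / lam"
    define y where "y = \<mu> * (1 - q 1) / lam"
    define X where "X = (\<Sum>k\<le>c. x ^ k)"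
    define Y where "Y = (\<Sum>k\<le>c. y ^ k)"
    have "\<mu> * (1 - u) / lam \<in> {0..\<mu>/lam}" if "0 \<le> u" "u \<le> 1" for u
      using that \<open>\<mu> > 0\<close> \<open>lam > 0\<close> by (auto simp: divide_right_mono mult_left_le)
    then have xy: "x \<in> {0..\<mu>/lam}" "y \<in> {0..\<mu>/lam}"
      unfolding x_def y_def using S_D[OF s] S_D[OF q] by blast+
    then have "X \<ge> 1" "Y \<ge> 1" using one_le_geometric_sum unfolding X_def Y_def by auto
    have "inverse X - inverse Y = (Y - X) * (inverse X * inverse Y)"
      using \<open>X \<ge> 1\<close> \<open>Y \<ge> 1\<close> by (simp add: field_simps)
    then have "\<bar>inverse X - inverse Y\<bar> = \<bar>Y - X\<bar> * (inverse X * inverse Y)"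
      using \<open>X \<ge> 1\<close> \<open>Y \<ge> 1\<close> by (simp add: abs_mult)
    also have "\<dots> \<le> \<bar>Y - X\<bar> * 1"
      using \<open>X \<ge> 1\<close> \<open>Y \<ge> 1\<close> by (intro mult_left_mono mult_le_one) (auto simp: inverse_le_1_iff)
    also have "\<dots> \<le> C * \<bar>x - y\<bar>"
      using C(2)[OF xy] unfolding X_def Y_def by (simp add: abs_minus_commute)
    also have "x - y = (\<mu> / lam) * (q 1 - s 1)"
      using \<open>lam > 0\<close> by (simp add: x_def y_def field_simps)
    also have "C * \<bar>(\<mu> / lam) * (q 1 - s 1)\<bar> = (C * (\<mu> / lam)) * \<bar>s 1 - q 1\<bar>"
      using \<open>\<mu> > 0\<close> \<open>lam > 0\<close> by (simp add: abs_mult abs_minus_commute)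
    finally show ?thesis using Constrained by (simp add: X_def Y_def x_def y_def)
  qed
  then show ?thesis using that[of "C * (\<mu> / lam)"] C(1) \<open>\<mu> > 0\<close> \<open>lam > 0\<close> by simp
qed (use assms in auto)

lemma drift_one: "drift r lam s 1 = lam - lam * P0 r lam s * s 1 - s 1 + s 2"
  by (simp add: drift_def algebra_simps)

lemma drift_ge_two:
  "j \<ge> 2 \<Longrightarrow> drift r lam s j = lam * P0 r lam s * (s (j - 1) - s j) - (s j - s (j + 1))"
  by (simp add: drift_def algebra_simps)

text \<open>
  The right-hand side of the fluid equations with \<open>\<lambda> P\<^sub>0(s)\<close> replaced by a free parameter \<open>g\<close>; the
  coordinate \<open>i = 0\<close> is kept constant.
\<close>

definition gated_drift :: "real \<Rightarrow> real \<Rightarrow> (nat \<Rightarrow> real) \<Rightarrow> nat \<Rightarrow> real" where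
  "gated_drift lam g s i =
     (if i = 0 then 0
      else if i = 1 then lam - g * s 1 - s 1 + s 2
      else g * (s (i - 1) - s i) - (s i - s (i + 1)))"

lemma drift_eq_gated_drift:
  "i \<ge> 1 \<Longrightarrow> drift r lam s i = gated_drift lam (lam * P0 r lam s) s i"
  using drift_one[of r lam s] drift_ge_two[of i r lam s] by (cases "i = 1") (auto simp: gated_drift_def)

lemma gated_drift_bound:
  assumes s: "s \<in> S" and g: "0 \<le> g" "g \<le> lam" and lam: "0 < lam" "lam < 1"
  shows "\<bar>gated_drift lam g s i\<bar> \<le> 2"
proof -
  have dec: "s (j + 1) \<le> s j" for j using S_D(4)[OF s] by simp
  consider "i = 0" | "i = 1" | "i \<ge> 2" by linarith
  then show ?thesis
  proof cases
    case 1
    then show ?thesis by (simp add: gated_drift_def)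
  next
    case 2
    have "0 \<le> g * s 1" "g * s 1 \<le> 1"
      using g lam S_D(1,2)[OF s, of 1] by (auto intro: mult_le_one simp del: One_nat_def)
    moreover have "gated_drift lam g s i = lam - g * s 1 - s 1 + s 2"
      using 2 by (simp add: gated_drift_def)
    ultimately show ?thesis
      using dec[of 1] lam S_D(1,2)[OF s, of 1] S_D(1)[OF s, of 2]
      unfolding abs_le_iff one_add_one by linarith
  next
    case 3
    have "s i \<le> s (i - 1)" using dec[of "i - 1"] 3 by simp
    then have "0 \<le> s (i - 1) - s i" "s (i - 1) - s i \<le> 1"
      using S_D(2)[OF s, of "i - 1"] S_D(1)[OF s, of i] by linarith+
    then have "0 \<le> g * (s (i - 1) - s i)" "g * (s (i - 1) - s i) \<le> 1"
      using g lam by (auto intro: mult_le_one)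
    then show ?thesis
      using 3 dec[of i] S_D(1,2)[OF s, of i] S_D(1,2)[OF s, of "i+1"]
      by (simp add: gated_drift_def abs_le_iff)
  qed
qed

lemma drift_bound:
  assumes s: "s \<in> S" and r: "0 < lam" "lam < 1" "admissible r" and "i \<ge> 1"
  shows "\<bar>drift r lam s i\<bar> \<le> 2"
  unfolding drift_eq_gated_drift[OF \<open>i \<ge> 1\<close>]
  using P0_bounds[OF s r(1,3)] r by (intro gated_drift_bound s) (auto simp: mult_left_le)

section \<open>Contraction in the \<open>\<ell>\<^sup>1\<close> distance\<close>

lemma fluid_solutionD:
  assumes "fluid_solution r lam s0 s"
  shows "t \<ge> 0 \<Longrightarrow> s t \<in> S1" "t \<ge> 0 \<Longrightarrow> s t \<in> S" "s 0 = s0" "t \<ge> 0 \<Longrightarrow> s t 0 = 1"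
    "T \<ge> 0 \<Longrightarrow> abs_continuous_on {0..T} (\<lambda>t. s t i)"
  using assms unfolding fluid_solution_def S1_def by auto

lemma fluid_solution_null_set:
  assumes "fluid_solution r lam s0 s"
  obtains N where "N \<in> null_sets lebesgue"
    "\<And>t i. t \<ge> 0 \<Longrightarrow> t \<notin> N \<Longrightarrow> i \<ge> 1 \<Longrightarrow>
        ((\<lambda>u. s u i) has_real_derivative drift r lam (s t) i) (at t within {0..})"
  using assms unfolding fluid_solution_def by (metis DiffI atLeast_iff)

text \<open>
  The drift is bounded by 2, and absolute continuity turns this almost-everywhere bound on the
  derivative into a Lipschitz bound.
\<close>

lemma fluid_solution_lipschitz:
  assumes sol: "fluid_solution r lam s0 s" and r: "0 < lam" "lam < 1" "admissible r"
    and uv: "0 \<le> u" "u \<le> v"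
  shows "\<bar>s v i - s u i\<bar> \<le> 2 * (v - u)"
proof (cases "i = 0")
  case True
  then show ?thesis using fluid_solutionD(4)[OF sol] uv by simp
next
  case False
  then have i: "i \<ge> 1" by simp
  obtain N where N: "N \<in> null_sets lebesgue"
    "\<And>t i. t \<ge> 0 \<Longrightarrow> t \<notin> N \<Longrightarrow> i \<ge> 1 \<Longrightarrow>
        ((\<lambda>u. s u i) has_real_derivative drift r lam (s t) i) (at t within {0..})"
    using fluid_solution_null_set[OF sol] by blast
  have ac: "abs_continuous_on {u..v} (\<lambda>t. s t i)"
    using fluid_solutionD(5)[OF sol, of v i] uv by (auto intro: abs_continuous_on_subset)
  have lin: "abs_continuous_on {u..v} (\<lambda>t. 2 * t)"
    by (rule lipschitz_imp_abs_continuous_on[where C = 2]) auto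
  have bound: "\<bar>drift r lam (s t) i\<bar> \<le> 2" if "t \<in> {u..v}" for t
    using that uv fluid_solutionD(2)[OF sol, of t] drift_bound[OF _ r i] by simp
  have "s v i + - (2 * v) \<le> s u i + - (2 * u)"
  proof (rule abs_continuous_on_nonincreasing[OF _ uv N(1)])
    show "abs_continuous_on {u..v} (\<lambda>t. s t i + - (2 * t))"
      by (rule abs_continuous_on_dominated[OF ac lin]) auto
    fix t assume t: "t \<in> {u..v} - N"
    then have "((\<lambda>t. s t i + - (2 * t)) has_real_derivative (drift r lam (s t) i - 2)) (at t within {0..})"
      using uv N(2)[of t i] i by (auto intro!: derivative_eq_intros)
    from slope_le_derivative[OF this] show "slope_le (\<lambda>t. s t i + - (2 * t)) t 0"
      by (rule slope_le_mono) (use t uv bound[of t] in auto)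
  qed
  moreover have "- s v i + - (2 * v) \<le> - s u i + - (2 * u)"
  proof (rule abs_continuous_on_nonincreasing[OF _ uv N(1)])
    show "abs_continuous_on {u..v} (\<lambda>t. - s t i + - (2 * t))"
      by (rule abs_continuous_on_dominated[OF ac lin]) auto
    fix t assume t: "t \<in> {u..v} - N"
    then have "((\<lambda>t. - s t i + - (2 * t)) has_real_derivative (- drift r lam (s t) i - 2)) (at t within {0..})"
      using uv N(2)[of t i] i by (auto intro!: derivative_eq_intros)
    from slope_le_derivative[OF this] show "slope_le (\<lambda>t. - s t i + - (2 * t)) t 0"
      by (rule slope_le_mono) (use t uv bound[of t] in auto)
  qed
  ultimately show ?thesis by auto
qed

lemma lipschitz_imp_continuous_on_halfline:
  fixes f :: "real \<Rightarrow> real"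
  assumes "\<And>u v. 0 \<le> u \<Longrightarrow> u \<le> v \<Longrightarrow> \<bar>f v - f u\<bar> \<le> C * (v - u)"
  shows "continuous_on {0..} f"
proof -
  have "C \<ge> 0" using assms[of 0 1] by auto
  then have "C-lipschitz_on {0..} f"
  proof (rule lipschitz_onI[rotated])
    fix x y :: real assume xy: "x \<in> {0..}" "y \<in> {0..}"
    show "dist (f x) (f y) \<le> C * dist x y"
      using assms[of x y] assms[of y x] xy by (cases "x \<le> y") (auto simp: dist_real_def)
  qed
  then show ?thesis by (rule lipschitz_on_continuous_on)
qed

lemma fluid_solution_continuous_on:
  assumes "fluid_solution r lam s0 s" "0 < lam" "lam < 1" "admissible r"
  shows "continuous_on {0..} (\<lambda>t. s t i)"
  by (rule lipschitz_imp_continuous_on_halfline[where C = 2]) (rule fluid_solution_lipschitz[OF assms])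

text \<open>
  Subtracting the equations gives
  \<open>x\<^sub>1' = x\<^sub>2 - x\<^sub>1 - (g - h) s\<^sub>1 - h x\<^sub>1\<close> and
  \<open>x\<^sub>j' = (g - h) (s\<^sub>j\<^sub>-\<^sub>1 - s\<^sub>j) + h (x\<^sub>j\<^sub>-\<^sub>1 - x\<^sub>j) - x\<^sub>j + x\<^sub>j\<^sub>+\<^sub>1\<close>.
  The second bound is the triangle inequality. The first needs that \<open>g - h\<close> has the sign of \<open>x\<^sub>1\<close>, and
  a separate argument when \<open>x\<^sub>1 = 0\<close>.
\<close>

lemma slope_le_abs_difference:
  assumes s: "fluid_solution r lam s0 s" and q: "fluid_solution r lam q0 q"
    and r: "0 < lam" "lam < 1" "admissible r" and "t > 0"
    and ds: "\<And>i. i \<ge> 1 \<Longrightarrow> ((\<lambda>u. s u i) has_real_derivative drift r lam (s t) i) (at t within {0..})"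
    and dq: "\<And>i. i \<ge> 1 \<Longrightarrow> ((\<lambda>u. q u i) has_real_derivative drift r lam (q t) i) (at t within {0..})"
  defines "g \<equiv> lam * P0 r lam (s t)" and "h \<equiv> lam * P0 r lam (q t)"
  shows "slope_le (\<lambda>u. \<bar>s u 1 - q u 1\<bar>) t
           (\<bar>s t 2 - q t 2\<bar> - \<bar>s t 1 - q t 1\<bar> - \<bar>g - h\<bar> * s t 1 - h * \<bar>s t 1 - q t 1\<bar>)" (is ?one)
    and "j \<ge> 2 \<Longrightarrow> slope_le (\<lambda>u. \<bar>s u j - q u j\<bar>) t
           (\<bar>g - h\<bar> * (s t (j - 1) - s t j) + h * (\<bar>s t (j - 1) - q t (j - 1)\<bar> - \<bar>s t j - q t j\<bar>)
             - \<bar>s t j - q t j\<bar> + \<bar>s t (j + 1) - q t (j + 1)\<bar>)" (is "_ \<Longrightarrow> ?two")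
proof -
  have t0: "t \<ge> 0" using \<open>t > 0\<close> by simp
  have st: "s t \<in> S" and qt: "q t \<in> S" using fluid_solutionD(2)[OF s t0] fluid_solutionD(2)[OF q t0] by auto
  have g0: "g \<ge> 0" "h \<ge> 0" using P0_bounds(1)[OF st] P0_bounds(1)[OF qt] r by (auto simp: g_def h_def)
  have at_max: "drift r lam (p t) 1 = 0"
    if p: "fluid_solution r lam p0 p" "p t 1 = 1"
      "((\<lambda>u. p u 1) has_real_derivative drift r lam (p t) 1) (at t within {0..})" for p p0
  proof -
    have "at t within {0..} = at t"
      using \<open>t > 0\<close> by (intro at_within_interior) (simp add: interior_real_atLeast)
    then have "((\<lambda>u. p u 1) has_real_derivative drift r lam (p t) 1) (at t)" using p(3) by simp
    then show ?thesis
    proof (rule DERIV_local_max[OF _ \<open>t > 0\<close>], intro allI impI)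
      fix y assume "\<bar>t - y\<bar> < t"
      then have "y \<ge> 0" by linarith
      then show "p y 1 \<le> p t 1" using S_D(2)[OF fluid_solutionD(2)[OF p(1)]] p(2) by simp
    qed
  qed
  have dx: "((\<lambda>u. s u i - q u i) has_real_derivative drift r lam (s t) i - drift r lam (q t) i) (at t within {0..})"
    if "i \<ge> 1" for i
    using that by (intro DERIV_diff ds dq)
  have s1: "0 \<le> s t 1" using S_D(1)[OF st] .
  show ?one
  proof (rule slope_le_abs[OF dx t0])
    have a: "drift r lam (s t) 1 - drift r lam (q t) 1
       = (s t 2 - q t 2) - (s t 1 - q t 1) - (g - h) * s t 1 - h * (s t 1 - q t 1)"
      unfolding drift_one g_def h_def by (simp add: algebra_simps)
    {
      assume "s t 1 - q t 1 > 0"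
      then have "g \<ge> h" using P0_mono[OF qt st _ r(1,3)] r(1) by (simp add: g_def h_def)
      then show "drift r lam (s t) 1 - drift r lam (q t) 1
        \<le> \<bar>s t 2 - q t 2\<bar> - \<bar>s t 1 - q t 1\<bar> - \<bar>g - h\<bar> * s t 1 - h * \<bar>s t 1 - q t 1\<bar>"
        unfolding a using \<open>s t 1 - q t 1 > 0\<close> by auto
    }
    {
      assume "s t 1 - q t 1 < 0"
      then have "h \<ge> g" using P0_mono[OF st qt _ r(1,3)] r(1) by (simp add: g_def h_def)
      then have "\<bar>g - h\<bar> = h - g" by simp
      then show "- (drift r lam (s t) 1 - drift r lam (q t) 1)
        \<le> \<bar>s t 2 - q t 2\<bar> - \<bar>s t 1 - q t 1\<bar> - \<bar>g - h\<bar> * s t 1 - h * \<bar>s t 1 - q t 1\<bar>"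
        unfolding a using \<open>s t 1 - q t 1 < 0\<close> by (simp add: algebra_simps)
    }
    {
      assume eq: "s t 1 - q t 1 = 0"
      have "\<bar>drift r lam (s t) 1 - drift r lam (q t) 1\<bar> \<le> \<bar>s t 2 - q t 2\<bar> - \<bar>g - h\<bar> * s t 1"
      \<comment> \<open>The gates can differ here only if both solutions are saturated; then both derivatives vanish, so that \<open>g - h = x\<^sub>2\<close>.\<close>
      proof (cases "r = High_Message \<and> s t 1 = 1")
        case True
        then have "drift r lam (s t) 1 = 0" "drift r lam (q t) 1 = 0"
          using at_max[OF s _ ds] at_max[OF q _ dq] eq by auto
        then show ?thesis using a eq True by auto
      next
        case False
        have "g = h"
        proof (cases "r = High_Message")
          case True
          then show ?thesis using False eq by (simp add: g_def h_def)
        next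
          case False
          then obtain L where "\<bar>P0 r lam (s t) - P0 r lam (q t)\<bar> \<le> L * \<bar>s t 1 - q t 1\<bar>"
            using P0_lipschitz[OF r(1,3)] st qt by metis
          then show ?thesis using eq by (simp add: g_def h_def)
        qed
        then show ?thesis using a eq by simp
      qed
      then show "\<bar>drift r lam (s t) 1 - drift r lam (q t) 1\<bar>
        \<le> \<bar>s t 2 - q t 2\<bar> - \<bar>s t 1 - q t 1\<bar> - \<bar>g - h\<bar> * s t 1 - h * \<bar>s t 1 - q t 1\<bar>"
        using eq by simp
    }
  qed simp
  assume j: "j \<ge> 2"
  define A B X C where "A = (g - h) * (s t (j - 1) - s t j)"
    and "B = h * (s t (j - 1) - q t (j - 1))" and "X = s t j - q t j"
    and "C = s t (j + 1) - q t (j + 1)"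
  have "s t (j - 1) \<ge> s t j" using S_D(4)[OF st, of "j - 1"] j by simp
  then have bound: "\<bar>g - h\<bar> * (s t (j - 1) - s t j) + h * (\<bar>s t (j - 1) - q t (j - 1)\<bar> - \<bar>s t j - q t j\<bar>)
             - \<bar>s t j - q t j\<bar> + \<bar>s t (j + 1) - q t (j + 1)\<bar>
         = \<bar>A\<bar> + \<bar>B\<bar> - h * \<bar>X\<bar> - \<bar>X\<bar> + \<bar>C\<bar>"
    using g0 by (simp add: A_def B_def X_def C_def abs_mult right_diff_distrib[of h "\<bar>_\<bar>"])
  have "drift r lam (s t) j - drift r lam (q t) j = A + B - h * X - X + C"
    unfolding drift_ge_two[OF j] g_def h_def A_def B_def X_def C_def by (simp add: algebra_simps)
  then have "((\<lambda>u. s u j - q u j) has_real_derivative A + B - h * X - X + C) (at t within {0..})"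
    using dx[of j] j by simp
  then have "slope_le (\<lambda>u. \<bar>s u j - q u j\<bar>) t (\<bar>A\<bar> + \<bar>B\<bar> - h * \<bar>X\<bar> - \<bar>X\<bar> + \<bar>C\<bar>)"
    by (rule slope_le_abs[OF _ t0]) (auto simp: X_def[symmetric])
  then show ?two unfolding bound .
qed

text \<open>
  Both sums telescope. The terms left over at the upper end, \<open>- |g - h| s\<^sub>n - h |x\<^sub>n|\<close>, have the
  favourable sign. At the lower end, for \<open>i = 1\<close> the influx \<open>|g - h| s\<^sub>1 + h |x\<^sub>1|\<close> from the coordinates
  \<open>j \<ge> 2\<close> cancels exactly against the losses of \<open>|x\<^sub>1|\<close>; for \<open>i \<ge> 2\<close> it is estimated by bounding
  \<open>\<lambda>\<close>, \<open>s\<^sub>i\<^sub>-\<^sub>1\<close> and \<open>h\<close> by 1.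
\<close>

lemma slope_le_sum_abs_difference:
  assumes s: "fluid_solution r lam s0 s" and q: "fluid_solution r lam q0 q"
    and r: "0 < lam" "lam < 1" "admissible r" and "t > 0"
    and ds: "\<And>i. i \<ge> 1 \<Longrightarrow> ((\<lambda>u. s u i) has_real_derivative drift r lam (s t) i) (at t within {0..})"
    and dq: "\<And>i. i \<ge> 1 \<Longrightarrow> ((\<lambda>u. q u i) has_real_derivative drift r lam (q t) i) (at t within {0..})"
  shows "n \<ge> 1 \<Longrightarrow> slope_le (\<lambda>u. \<Sum>j=1..n. \<bar>s u j - q u j\<bar>) t
           (\<bar>s t (n + 1) - q t (n + 1)\<bar> - \<bar>s t 1 - q t 1\<bar>)"
    and "2 \<le> i \<Longrightarrow> i \<le> n + 1 \<Longrightarrow> slope_le (\<lambda>u. \<Sum>j=i..n. \<bar>s u j - q u j\<bar>) t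
           (\<bar>P0 r lam (s t) - P0 r lam (q t)\<bar> + \<bar>s t (i - 1) - q t (i - 1)\<bar>
             - \<bar>s t i - q t i\<bar> + \<bar>s t (n + 1) - q t (n + 1)\<bar>)"
proof -
  define g where "g = lam * P0 r lam (s t)"
  define h where "h = lam * P0 r lam (q t)"
  define x where "x j = \<bar>s t j - q t j\<bar>" for j
  have t0: "t \<ge> 0" using \<open>t > 0\<close> by simp
  have st: "s t \<in> S" and qt: "q t \<in> S" using fluid_solutionD(2)[OF s t0] fluid_solutionD(2)[OF q t0] by auto
  have h: "0 \<le> h" "h \<le> 1"
    using P0_bounds[OF qt, of lam r] r by (auto simp: h_def intro: mult_le_one)
  have s01: "0 \<le> s t j" "s t j \<le> 1" for j using S_D(1,2)[OF st] by auto
  have x0: "0 \<le> x j" for j by (simp add: x_def)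
  define c where "c j = (if j = 1 then x 2 - x 1 - \<bar>g - h\<bar> * s t 1 - h * x 1
    else \<bar>g - h\<bar> * (s t (j - 1) - s t j) + h * (x (j - 1) - x j) - x j + x (j + 1))" for j
  have slope: "slope_le (\<lambda>u. \<bar>s u j - q u j\<bar>) t (c j)" if "j \<ge> 1" for j
  proof (cases "j = 1")
    case True
    then show ?thesis
      using slope_le_abs_difference(1)[OF s q r \<open>t > 0\<close> ds dq] unfolding c_def x_def g_def h_def by simp
  next
    case False
    then have "j \<ge> 2" using that by simp
    from slope_le_abs_difference(2)[OF s q r \<open>t > 0\<close> ds dq this] False
    show ?thesis unfolding c_def x_def g_def h_def by simp
  qed
  have slope_sum: "slope_le (\<lambda>u. \<Sum>j=i..n. \<bar>s u j - q u j\<bar>) t (\<Sum>j=i..n. c j)" if "i \<ge> 1" for i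
    using that by (intro slope_le_sum slope) auto
  have tele1: "(\<Sum>j=1..n. c j) = x (n + 1) - x 1 - \<bar>g - h\<bar> * s t n - h * x n" if "n \<ge> 1" for n
    using that by (induction n rule: dec_induct) (auto simp: c_def algebra_simps numeral_2_eq_2)
  have tele2: "(\<Sum>j=i..n. c j) = \<bar>g - h\<bar> * (s t (i - 1) - s t n) + h * (x (i - 1) - x n) - x i + x (n + 1)"
    if "2 \<le> i" "i \<le> n + 1" for n
  proof -
    define k where "k = i - 1"
    have k: "i = Suc k" "k \<ge> 1" using that(1) by (auto simp: k_def)
    then have "k \<le> n" using that by simp
    then have "(\<Sum>j=Suc k..n. c j) = \<bar>g - h\<bar> * (s t k - s t n) + h * (x k - x n) - x (Suc k) + x (n + 1)"
      using k(2) by (induction n rule: dec_induct) (auto simp: c_def algebra_simps)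
    then show ?thesis using k by simp
  qed
  show "slope_le (\<lambda>u. \<Sum>j=1..n. \<bar>s u j - q u j\<bar>) t
           (\<bar>s t (n + 1) - q t (n + 1)\<bar> - \<bar>s t 1 - q t 1\<bar>)" if "n \<ge> 1"
  proof (rule slope_le_mono[OF slope_sum])
    have "0 \<le> \<bar>g - h\<bar> * s t n" "0 \<le> h * x n" using h s01 x0 by auto
    then show "(\<Sum>j=1..n. c j) \<le> \<bar>s t (n + 1) - q t (n + 1)\<bar> - \<bar>s t 1 - q t 1\<bar>"
      unfolding tele1[OF that] by (simp add: x_def)
  qed simp
  show "slope_le (\<lambda>u. \<Sum>j=i..n. \<bar>s u j - q u j\<bar>) t
           (\<bar>P0 r lam (s t) - P0 r lam (q t)\<bar> + \<bar>s t (i - 1) - q t (i - 1)\<bar>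
             - \<bar>s t i - q t i\<bar> + \<bar>s t (n + 1) - q t (n + 1)\<bar>)" if "2 \<le> i" "i \<le> n + 1"
  proof (rule slope_le_mono[OF slope_sum])
    have "s t (i - 1) - s t n \<le> 1" using s01(1)[of n] s01(2)[of "i - 1"] by linarith
    then have "\<bar>g - h\<bar> * (s t (i - 1) - s t n) \<le> \<bar>g - h\<bar> * 1" by (intro mult_left_mono) auto
    also have "\<bar>g - h\<bar> * 1 = lam * \<bar>P0 r lam (s t) - P0 r lam (q t)\<bar>"
      using r by (simp add: g_def h_def right_diff_distrib[symmetric] abs_mult)
    also have "\<dots> \<le> 1 * \<bar>P0 r lam (s t) - P0 r lam (q t)\<bar>" using r by (intro mult_right_mono) auto
    finally have 1: "\<bar>g - h\<bar> * (s t (i - 1) - s t n) \<le> \<bar>P0 r lam (s t) - P0 r lam (q t)\<bar>" by simp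
    have "h * (x (i - 1) - x n) \<le> h * x (i - 1)" using h x0[of n] by (intro mult_left_mono) auto
    also have "\<dots> \<le> 1 * x (i - 1)" using h x0 by (intro mult_right_mono) auto
    finally have 2: "h * (x (i - 1) - x n) \<le> x (i - 1)" by simp
    show "(\<Sum>j=i..n. c j) \<le> \<bar>P0 r lam (s t) - P0 r lam (q t)\<bar> + \<bar>s t (i - 1) - q t (i - 1)\<bar>
             - \<bar>s t i - q t i\<bar> + \<bar>s t (n + 1) - q t (n + 1)\<bar>"
      unfolding tele2[OF that] using 1 2 by (simp add: x_def)
  qed (use that in simp)
qed

lemma fluid_solutions_common_null_set:
  assumes s: "fluid_solution r lam s0 s" and q: "fluid_solution r lam q0 q"
  obtains N where "N \<in> null_sets lebesgue"
    "\<And>t i. t \<ge> 0 \<Longrightarrow> t \<notin> N \<Longrightarrow> t > 0 \<and> (i \<ge> 1 \<longrightarrow>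
        ((\<lambda>u. s u i) has_real_derivative drift r lam (s t) i) (at t within {0..}) \<and>
        ((\<lambda>u. q u i) has_real_derivative drift r lam (q t) i) (at t within {0..}))"
proof -
  obtain N1 where N1: "N1 \<in> null_sets lebesgue"
    "\<And>t i. t \<ge> 0 \<Longrightarrow> t \<notin> N1 \<Longrightarrow> i \<ge> 1 \<Longrightarrow>
        ((\<lambda>u. s u i) has_real_derivative drift r lam (s t) i) (at t within {0..})"
    using fluid_solution_null_set[OF s] by blast
  obtain N2 where N2: "N2 \<in> null_sets lebesgue"
    "\<And>t i. t \<ge> 0 \<Longrightarrow> t \<notin> N2 \<Longrightarrow> i \<ge> 1 \<Longrightarrow>
        ((\<lambda>u. q u i) has_real_derivative drift r lam (q t) i) (at t within {0..})"
    using fluid_solution_null_set[OF q] by blast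
  have "{0::real} \<in> null_sets lebesgue" by (simp add: negligible_iff_null_sets[symmetric])
  then have "{0} \<union> N1 \<union> N2 \<in> null_sets lebesgue" using N1(1) N2(1) by (intro null_sets.Un)
  then show ?thesis by (rule that) (use N1(2) N2(2) in auto)
qed

lemma abs_continuous_on_sum_abs_difference:
  assumes "finite J" "\<And>j. j \<in> J \<Longrightarrow> abs_continuous_on I (\<lambda>t. s t j)"
    "\<And>j. j \<in> J \<Longrightarrow> abs_continuous_on I (\<lambda>t. q t j)"
  shows "abs_continuous_on I (\<lambda>t. \<Sum>j\<in>J. \<bar>s t j - q t j\<bar>)"
  using assms
proof (induction J rule: finite_induct)
  case empty
  show ?case by (rule lipschitz_imp_abs_continuous_on[where C = 0]) auto
next
  case (insert j J)
  have "abs_continuous_on I (\<lambda>t. \<bar>s t j - q t j\<bar>)"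
    by (rule abs_continuous_on_dominated[OF insert.prems(1)[of j] insert.prems(2)[of j]]) auto
  then have "abs_continuous_on I (\<lambda>t. \<bar>s t j - q t j\<bar> + (\<Sum>j\<in>J. \<bar>s t j - q t j\<bar>))"
    by (rule abs_continuous_on_dominated[OF _ insert.IH]) (use insert.prems in auto)
  then show ?case using insert.hyps by simp
qed

lemma tail_integral_tendsto_0:
  assumes s: "fluid_solution r lam s0 s" and q: "fluid_solution r lam q0 q"
    and r: "0 < lam" "lam < 1" "admissible r"
  shows "(\<lambda>n. integral {0..T} (\<lambda>t. \<bar>s t (n + 1) - q t (n + 1)\<bar>)) \<longlonglongrightarrow> 0"
proof -
  have "(\<lambda>n. integral {0..T} (\<lambda>t. \<bar>s t (n + 1) - q t (n + 1)\<bar>)) \<longlonglongrightarrow> integral {0..T} (\<lambda>t. 0)"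
  proof (rule dominated_convergence(2)[where h = "\<lambda>_. 1"])
    show "(\<lambda>t. \<bar>s t (n + 1) - q t (n + 1)\<bar>) integrable_on {0..T}" for n
      by (intro integrable_continuous_real continuous_intros
          continuous_on_subset[OF fluid_solution_continuous_on[OF s r]]
          continuous_on_subset[OF fluid_solution_continuous_on[OF q r]]) auto
    fix t assume "t \<in> {0..T}"
    then have t: "t \<ge> 0" by simp
    show "norm \<bar>s t (n + 1) - q t (n + 1)\<bar> \<le> 1" for n
      using S_D(1,2)[OF fluid_solutionD(2)[OF s t], of "n+1"]
        S_D(1,2)[OF fluid_solutionD(2)[OF q t], of "n+1"] by (simp add: abs_le_iff)
    have "(\<lambda>n. s t (n + 1)) \<longlonglongrightarrow> 0" "(\<lambda>n. q t (n + 1)) \<longlonglongrightarrow> 0"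
      using S1_D(3)[OF fluid_solutionD(1)[OF s t]] S1_D(3)[OF fluid_solutionD(1)[OF q t]]
      by (simp_all add: LIMSEQ_Suc)
    then show "(\<lambda>n. \<bar>s t (n + 1) - q t (n + 1)\<bar>) \<longlonglongrightarrow> 0"
      using tendsto_rabs[OF tendsto_diff] by fastforce
  qed auto
  then show ?thesis by simp
qed

text \<open>
  The sum is truncated so that it can be differentiated term by term; the
  price is the flux \<open>|x\<^sub>n\<^sub>+\<^sub>1|\<close> through the cut, which vanishes as \<open>n\<close> grows by
  \<open>tail_integral_tendsto_0\<close>.
\<close>

lemma fluid_l1_contraction:
  assumes s: "fluid_solution r lam s0 s" and q: "fluid_solution r lam q0 q"
    and r: "0 < lam" "lam < 1" "admissible r" and T: "T \<ge> 0" and n: "n \<ge> 1"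
  shows "(\<Sum>j=1..n. \<bar>s T j - q T j\<bar>) + integral {0..T} (\<lambda>t. \<bar>s t 1 - q t 1\<bar>)
     \<le> (\<Sum>j=1..n. \<bar>s0 j - q0 j\<bar>) + integral {0..T} (\<lambda>t. \<bar>s t (n + 1) - q t (n + 1)\<bar>)"
proof -
  obtain N where N: "N \<in> null_sets lebesgue"
    "\<And>t i. t \<ge> 0 \<Longrightarrow> t \<notin> N \<Longrightarrow> t > 0 \<and> (i \<ge> 1 \<longrightarrow>
        ((\<lambda>u. s u i) has_real_derivative drift r lam (s t) i) (at t within {0..}) \<and>
        ((\<lambda>u. q u i) has_real_derivative drift r lam (q t) i) (at t within {0..}))"
    using fluid_solutions_common_null_set[OF s q] by blast
  have cont: "continuous_on {0..} (\<lambda>t. \<bar>s t j - q t j\<bar>)" for j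
    by (intro continuous_intros fluid_solution_continuous_on[OF s r] fluid_solution_continuous_on[OF q r])
  have int: "(\<lambda>t. \<bar>s t j - q t j\<bar>) integrable_on {0..T}" for j
    by (intro integrable_continuous_real continuous_on_subset[OF cont]) auto
  have "(\<Sum>j=1..n. \<bar>s T j - q T j\<bar>) - (\<Sum>j=1..n. \<bar>s 0 j - q 0 j\<bar>)
     \<le> integral {0..T} (\<lambda>t. \<bar>s t (n + 1) - q t (n + 1)\<bar> - \<bar>s t 1 - q t 1\<bar>)"
  proof (rule slope_le_imp_increment_le_integral[OF _ T N(1)])
    show "abs_continuous_on {0..T} (\<lambda>t. \<Sum>j=1..n. \<bar>s t j - q t j\<bar>)"
      by (intro abs_continuous_on_sum_abs_difference fluid_solutionD(5)[OF s T] fluid_solutionD(5)[OF q T]) auto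
    show "continuous_on {0..} (\<lambda>t. \<bar>s t (n + 1) - q t (n + 1)\<bar> - \<bar>s t 1 - q t 1\<bar>)"
      by (intro continuous_on_diff cont)
    fix t assume "t \<in> {0..T} - N"
    then have t: "t \<ge> 0" "t \<notin> N" by auto
    show "slope_le (\<lambda>u. \<Sum>j=1..n. \<bar>s u j - q u j\<bar>) t (\<bar>s t (n + 1) - q t (n + 1)\<bar> - \<bar>s t 1 - q t 1\<bar>)"
      by (rule slope_le_sum_abs_difference(1)[OF s q r _ _ _ n]) (use N(2)[OF t] in auto)
  qed
  also have "\<dots> = integral {0..T} (\<lambda>t. \<bar>s t (n + 1) - q t (n + 1)\<bar>) - integral {0..T} (\<lambda>t. \<bar>s t 1 - q t 1\<bar>)"
    by (rule Henstock_Kurzweil_Integration.integral_diff[OF int int])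
  finally show ?thesis
    using fluid_solutionD(3)[OF s] fluid_solutionD(3)[OF q] by simp
qed

lemma fluid_tail_estimate:
  assumes s: "fluid_solution r lam s0 s" and q: "fluid_solution r lam q0 q"
    and r: "0 < lam" "lam < 1" "admissible r" and T: "T \<ge> 0" and i: "2 \<le> i" "i \<le> n + 1"
    and L: "\<And>t. t \<ge> 0 \<Longrightarrow> \<bar>P0 r lam (s t) - P0 r lam (q t)\<bar> \<le> L * \<bar>s t 1 - q t 1\<bar>"
  shows "integral {0..T} (\<lambda>t. \<bar>s t i - q t i\<bar>)
     \<le> (\<Sum>j=i..n. \<bar>s0 j - q0 j\<bar>) + L * integral {0..T} (\<lambda>t. \<bar>s t 1 - q t 1\<bar>)
       + integral {0..T} (\<lambda>t. \<bar>s t (i - 1) - q t (i - 1)\<bar>)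
       + integral {0..T} (\<lambda>t. \<bar>s t (n + 1) - q t (n + 1)\<bar>)"
proof -
  define x where "x j t = \<bar>s t j - q t j\<bar>" for j t
  obtain N where N: "N \<in> null_sets lebesgue"
    "\<And>t i. t \<ge> 0 \<Longrightarrow> t \<notin> N \<Longrightarrow> t > 0 \<and> (i \<ge> 1 \<longrightarrow>
        ((\<lambda>u. s u i) has_real_derivative drift r lam (s t) i) (at t within {0..}) \<and>
        ((\<lambda>u. q u i) has_real_derivative drift r lam (q t) i) (at t within {0..}))"
    using fluid_solutions_common_null_set[OF s q] by blast
  have cont: "continuous_on {0..} (x j)" for j
    unfolding x_def
    by (intro continuous_intros fluid_solution_continuous_on[OF s r] fluid_solution_continuous_on[OF q r])
  have int: "x j integrable_on {0..T}" for j
    by (intro integrable_continuous_real continuous_on_subset[OF cont]) auto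
  define c where "c t = L * x 1 t + x (i - 1) t + x (n + 1) t - x i t" for t
  have "(\<Sum>j=i..n. \<bar>s T j - q T j\<bar>) - (\<Sum>j=i..n. \<bar>s 0 j - q 0 j\<bar>) \<le> integral {0..T} c"
  proof (rule slope_le_imp_increment_le_integral[OF _ T N(1)])
    show "abs_continuous_on {0..T} (\<lambda>t. \<Sum>j=i..n. \<bar>s t j - q t j\<bar>)"
      by (intro abs_continuous_on_sum_abs_difference fluid_solutionD(5)[OF s T] fluid_solutionD(5)[OF q T]) auto
    show "continuous_on {0..} c"
      unfolding c_def by (intro continuous_intros cont)
    fix t assume "t \<in> {0..T} - N"
    then have t: "t \<ge> 0" "t \<notin> N" by auto
    show "slope_le (\<lambda>u. \<Sum>j=i..n. \<bar>s u j - q u j\<bar>) t (c t)"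
      by (rule slope_le_mono[OF slope_le_sum_abs_difference(2)[OF s q r _ _ _ i]])
        (use N(2)[OF t] L[OF t(1)] in \<open>auto simp: c_def x_def\<close>)
  qed
  moreover have "integral {0..T} c = L * integral {0..T} (x 1) + integral {0..T} (x (i - 1))
      + integral {0..T} (x (n + 1)) - integral {0..T} (x i)"
    unfolding c_def
    by (simp add: integral_diff integral_add integrable_add int integrable_on_mult_right
        del: One_nat_def)
  moreover have "0 \<le> (\<Sum>j=i..n. \<bar>s T j - q T j\<bar>)" by (intro sum_nonneg) auto
  ultimately show ?thesis
    unfolding x_def fluid_solutionD(3)[OF s] fluid_solutionD(3)[OF q] by linarith
qed

text \<open>With equal initial states the contraction bounds every coordinate of the difference by the vanishing tail flux.\<close>

theorem fluid_solution_unique: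
  assumes s: "fluid_solution r lam s0 s" and q: "fluid_solution r lam s0 q"
    and r: "0 < lam" "lam < 1" "admissible r" and T: "T \<ge> 0"
  shows "q T = s T"
proof
  fix j
  show "q T j = s T j"
  proof (cases "j = 0")
    case True
    then show ?thesis using fluid_solutionD(4)[OF s T] fluid_solutionD(4)[OF q T] by simp
  next
    case False
    have "\<bar>s T j - q T j\<bar> \<le> integral {0..T} (\<lambda>t. \<bar>s t (n + 1) - q t (n + 1)\<bar>)" if n: "n \<ge> j" for n
    proof -
      have "\<bar>s T j - q T j\<bar> \<le> (\<Sum>j=1..n. \<bar>s T j - q T j\<bar>)"
        by (rule member_le_sum) (use n False in auto)
      moreover have "0 \<le> integral {0..T} (\<lambda>t. \<bar>s t 1 - q t 1\<bar>)"
        by (rule integral_nonneg)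
          (auto intro!: integrable_continuous_real continuous_intros
            continuous_on_subset[OF fluid_solution_continuous_on[OF s r]]
            continuous_on_subset[OF fluid_solution_continuous_on[OF q r]])
      ultimately show ?thesis
        using fluid_l1_contraction[OF s q r T, of n] n False by simp
    qed
    then have "\<bar>s T j - q T j\<bar> \<le> 0"
      by (intro LIMSEQ_le_const[OF tail_integral_tendsto_0[OF s q r]]) blast
    then show ?thesis by simp
  qed
qed

section \<open>Equilibrium and global stability\<close>

text \<open>Tannery's theorem: the weights \<open>2\<^sup>-\<^sup>i\<close> dominate the series uniformly.\<close>

lemma wnorm_tendsto_0:
  assumes lim: "\<And>i. ((\<lambda>t. x t i) \<longlongrightarrow> 0) F" and bound: "eventually (\<lambda>t. \<forall>i. \<bar>x t i\<bar> \<le> 1) F"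
    and "F \<noteq> bot"
  shows "((\<lambda>t. wnorm (x t)) \<longlongrightarrow> 0) F"
proof -
  have "((\<lambda>t. \<Sum>i. \<bar>x t i\<bar>\<^sup>2 / 2 ^ i) \<longlongrightarrow> (\<Sum>i::nat. 0)) F"
  proof (rule conjunct2[OF conjunct2[OF tannerys_theorem[OF _ _ _ \<open>F \<noteq> bot\<close>]]])
    show "((\<lambda>t. \<bar>x t i\<bar>\<^sup>2 / 2 ^ i) \<longlongrightarrow> 0) F" for i
    proof -
      have "((\<lambda>t. \<bar>x t i\<bar>\<^sup>2 / 2 ^ i) \<longlongrightarrow> \<bar>0\<bar>\<^sup>2 / 2 ^ i) F"
        by (intro tendsto_intros lim) auto
      then show ?thesis by simp
    qed
    have "eventually (\<lambda>t. \<forall>i. norm (\<bar>x t i\<bar>\<^sup>2 / 2 ^ i) \<le> (1/2) ^ i) F"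
      using bound
    proof eventually_elim
      case (elim t)
      then have "\<bar>x t i\<bar>\<^sup>2 \<le> 1" for i by (intro power_le_one) auto
      then have "\<bar>x t i\<bar>\<^sup>2 / 2 ^ i \<le> 1 / 2 ^ i" for i by (intro divide_right_mono) auto
      then show ?case by (simp add: power_one_over)
    qed
    then show "eventually (\<lambda>(i, t). norm (\<bar>x t i\<bar>\<^sup>2 / 2 ^ i) \<le> (1/2) ^ i) (at_top \<times>\<^sub>F F)"
      unfolding eventually_prod_filter
      by (intro exI[of _ "\<lambda>_. True"] exI[of _ "\<lambda>t. \<forall>i. norm (\<bar>x t i\<bar>\<^sup>2 / 2 ^ i) \<le> (1/2) ^ i"]) auto
    show "summable (\<lambda>i. (1/2::real) ^ i)" by (rule summable_geometric) simp
  qed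
  then have "((\<lambda>t. sqrt (\<Sum>i. \<bar>x t i\<bar>\<^sup>2 / 2 ^ i)) \<longlongrightarrow> sqrt 0) F"
    by (intro tendsto_real_sqrt) simp
  then show ?thesis unfolding wnorm_def by simp
qed

text \<open>
  Barbalat's lemma. If \<open>f t\<close> is not small, the Lipschitz bound keeps \<open>f\<close> away from zero on an interval
  of fixed length after \<open>t\<close>, which the Cauchy property of the integrals rules out for large \<open>t\<close>.
\<close>

lemma integrable_lipschitz_tendsto_0:
  fixes f :: "real \<Rightarrow> real"
  assumes lip: "\<And>u v. 0 \<le> u \<Longrightarrow> u \<le> v \<Longrightarrow> \<bar>f v - f u\<bar> \<le> K * (v - u)"
    and nonneg: "\<And>t. t \<ge> 0 \<Longrightarrow> f t \<ge> 0"
    and bound: "\<And>T. T \<ge> 0 \<Longrightarrow> integral {0..T} f \<le> C"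
  shows "(f \<longlongrightarrow> 0) at_top"
proof -
  have "K \<ge> 0" using lip[of 0 1] by auto
  have cont: "continuous_on {0..} f" by (rule lipschitz_imp_continuous_on_halfline[OF lip])
  have int: "f integrable_on {a..b}" if "a \<ge> 0" for a b
    using that by (intro integrable_continuous_real continuous_on_subset[OF cont]) auto
  define J where "J T = integral {0..T} f" for T
  have J_diff: "J b - J a = integral {a..b} f" if "0 \<le> a" "a \<le> b" for a b
    using Henstock_Kurzweil_Integration.integral_combine[OF that int[of 0 b]] by (simp add: J_def)
  have bdd: "bdd_above (J ` {0..})" using bound by (auto simp: J_def bdd_above_def)
  define l where "l = (SUP T\<in>{0..}. J T)"
  show ?thesis
  proof (rule tendstoI)
    fix e :: real assume "e > 0"
    \<comment> \<open>Over a time \<open>h\<close> the function changes by at most \<open>e / 2\<close>; an integral of at most \<open>h e / 4\<close> then forces \<open>f t < e\<close>.\<close>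
    define h where "h = e / (2 * (K + 1))"
    have h: "h > 0" "K * h \<le> e / 2"
    proof -
      show "h > 0" using \<open>e > 0\<close> \<open>K \<ge> 0\<close> by (simp add: h_def)
      have "K * h \<le> (K + 1) * h" using \<open>h > 0\<close> by simp
      also have "\<dots> = e / 2" using \<open>K \<ge> 0\<close> by (simp add: h_def field_simps)
      finally show "K * h \<le> e / 2" .
    qed
    have "l - h * e / 4 < l" using h \<open>e > 0\<close> by simp
    then obtain T0 where T0: "T0 \<ge> 0" "J T0 > l - h * e / 4"
      unfolding l_def using less_cSUP_iff[OF _ bdd] by auto
    have "dist (f t) 0 < e" if t: "t \<ge> T0" for t
    proof -
      have t0: "t \<ge> 0" using t T0 by simp
      have "J T0 \<le> J t" using J_diff[OF T0(1) t] integral_nonneg[OF int[OF T0(1)]] nonneg T0(1)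
        by (metis atLeastAtMost_iff diff_ge_0_iff_ge order_trans)
      moreover have "J (t + h) \<le> l" unfolding l_def by (rule cSUP_upper[OF _ bdd]) (use t0 h in auto)
      ultimately have "integral {t..t+h} f \<le> h * e / 4"
        using J_diff[OF t0, of "t + h"] T0 h by auto
      moreover have "integral {t..t+h} (\<lambda>_. f t - K * h) \<le> integral {t..t+h} f"
      proof (rule integral_le[OF _ int[OF t0]])
        fix u assume u: "u \<in> {t..t+h}"
        have "\<bar>f u - f t\<bar> \<le> K * (u - t)" by (rule lip[OF t0]) (use u in auto)
        also have "\<dots> \<le> K * h" using u \<open>K \<ge> 0\<close> by (intro mult_left_mono) auto
        finally show "f t - K * h \<le> f u" by linarith
      qed auto
      moreover have "integral {t..t+h} (\<lambda>_. f t - K * h) = h * (f t - K * h)" using h by simp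
      ultimately have "h * (f t - K * h) \<le> h * (e / 4)" unfolding times_divide_eq_right by linarith
      then have "f t - K * h \<le> e / 4" using h(1) by (rule mult_left_le_imp_le)
      then show ?thesis using h(2) nonneg[OF t0] \<open>e > 0\<close> by (simp add: dist_real_def)
    qed
    then show "\<forall>\<^sub>F t in at_top. dist (f t) 0 < e"
      unfolding eventually_at_top_linorder by blast
  qed
qed

text \<open>
  Induction on \<open>i\<close>: the dissipation in the contraction estimate settles \<open>i = 1\<close>, and the tail estimate
  passes from \<open>i\<close> to \<open>i + 1\<close>, the gate difference being controlled by \<open>|x\<^sub>1|\<close>.
\<close>

lemma fluid_difference_integrals_bounded:
  assumes s: "fluid_solution r lam s0 s" and q: "fluid_solution r lam q0 q"
    and r: "0 < lam" "lam < 1" "admissible r"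
    and L: "L \<ge> 0" "\<And>t. t \<ge> 0 \<Longrightarrow> \<bar>P0 r lam (s t) - P0 r lam (q t)\<bar> \<le> L * \<bar>s t 1 - q t 1\<bar>"
    and i: "i \<ge> 1"
  shows "\<exists>C. \<forall>T\<ge>0. integral {0..T} (\<lambda>t. \<bar>s t i - q t i\<bar>) \<le> C"
proof -
  have sq0: "s0 \<in> S1" "q0 \<in> S1"
    using fluid_solutionD(1)[OF s, of 0] fluid_solutionD(1)[OF q, of 0] fluid_solutionD(3)[OF s] fluid_solutionD(3)[OF q]
    by auto
  have nonneg: "s0 j \<ge> 0" "q0 j \<ge> 0" for j using sq0 S1_D(1) S_D(1) by blast+
  have "summable (\<lambda>j. \<bar>s0 j - q0 j\<bar>)"
  proof (rule summable_comparison_test[OF _ summable_add[OF S1_D(2)[OF sq0(1)] S1_D(2)[OF sq0(2)]]], intro exI allI impI)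
    fix j :: nat
    show "norm \<bar>s0 j - q0 j\<bar> \<le> s0 j + q0 j" using nonneg[of j] by auto
  qed
  define C0 where "C0 = (\<Sum>j. \<bar>s0 j - q0 j\<bar>)"
  have C0: "(\<Sum>j=i..n. \<bar>s0 j - q0 j\<bar>) \<le> C0" for i n
    unfolding C0_def by (rule sum_le_suminf) (use \<open>summable _\<close> in auto)
  have limit: "a \<le> b" if "\<And>n. n \<ge> m \<Longrightarrow> a \<le> b + integral {0..T} (\<lambda>t. \<bar>s t (n + 1) - q t (n + 1)\<bar>)"
    for a b T :: real and m :: nat
  proof -
    have "(\<lambda>n. b + integral {0..T} (\<lambda>t. \<bar>s t (n + 1) - q t (n + 1)\<bar>)) \<longlonglongrightarrow> b + 0"
      by (intro tendsto_add tendsto_const tail_integral_tendsto_0[OF s q r])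
    then show ?thesis using LIMSEQ_le_const that by fastforce
  qed
  have first: "integral {0..T} (\<lambda>t. \<bar>s t 1 - q t 1\<bar>) \<le> C0" if T: "T \<ge> 0" for T
  proof (rule limit[of 1])
    fix n :: nat assume "n \<ge> 1"
    moreover have "0 \<le> (\<Sum>j=1..n. \<bar>s T j - q T j\<bar>)" by (intro sum_nonneg) auto
    ultimately show "integral {0..T} (\<lambda>t. \<bar>s t 1 - q t 1\<bar>)
        \<le> C0 + integral {0..T} (\<lambda>t. \<bar>s t (n + 1) - q t (n + 1)\<bar>)"
      using fluid_l1_contraction[OF s q r T, of n] C0[where i = 1 and n = n] by linarith
  qed
  show ?thesis
    using i
  proof (induction i rule: dec_induct)
    case base
    show ?case using first by blast
  next
    case (step i)
    obtain C where C: "\<And>T. T \<ge> 0 \<Longrightarrow> integral {0..T} (\<lambda>t. \<bar>s t i - q t i\<bar>) \<le> C"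
      using step.IH by blast
    have "integral {0..T} (\<lambda>t. \<bar>s t (Suc i) - q t (Suc i)\<bar>) \<le> C0 + L * C0 + C" if T: "T \<ge> 0" for T
    proof (rule limit[of "Suc i"])
      fix n assume n: "n \<ge> Suc i"
      have "L * integral {0..T} (\<lambda>t. \<bar>s t 1 - q t 1\<bar>) \<le> L * C0"
        using first[OF T] L(1) by (rule mult_left_mono)
      moreover have "integral {0..T} (\<lambda>t. \<bar>s t (Suc i) - q t (Suc i)\<bar>)
         \<le> (\<Sum>j=Suc i..n. \<bar>s0 j - q0 j\<bar>) + L * integral {0..T} (\<lambda>t. \<bar>s t 1 - q t 1\<bar>)
           + integral {0..T} (\<lambda>t. \<bar>s t (Suc i - 1) - q t (Suc i - 1)\<bar>)
           + integral {0..T} (\<lambda>t. \<bar>s t (n + 1) - q t (n + 1)\<bar>)"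
        by (rule fluid_tail_estimate[OF s q r T _ _ L(2)]) (use step.hyps n in auto)
      ultimately show "integral {0..T} (\<lambda>t. \<bar>s t (Suc i) - q t (Suc i)\<bar>)
        \<le> C0 + L * C0 + C + integral {0..T} (\<lambda>t. \<bar>s t (n + 1) - q t (n + 1)\<bar>)"
        using C[OF T] C0[of "Suc i" n] unfolding diff_Suc_1 by linarith
    qed
    then show ?case by blast
  qed
qed

definition geometric_equilibrium :: "regime \<Rightarrow> real \<Rightarrow> nat \<Rightarrow> real" where
  "geometric_equilibrium r lam i = (if i = 0 then 1 else lam * (lam * P0_star r lam) ^ (i - 1))"

lemma P0_eq_P0_star:
  assumes "lam < 1" "s 1 = lam"
  shows "P0 r lam s = P0_star r lam"
  using assms by (cases r) auto

lemma P0_star_bounds: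
  assumes "0 < lam" "lam < 1" "admissible r"
  shows "0 \<le> P0_star r lam" "P0_star r lam \<le> 1"
proof -
  \<comment> \<open>Any state with \<open>s\<^sub>1 = \<lambda>\<close> attains the value \<open>P0_star\<close>, so the bounds on \<open>P0\<close> carry over.\<close>
  define s :: "nat \<Rightarrow> real" where "s i = (if i = 0 then 1 else if i = 1 then lam else 0)" for i
  have "s \<in> S" using assms by (auto simp: S_def s_def)
  from P0_bounds[OF this assms(1,3)] P0_eq_P0_star[OF assms(2), of s r]
  show "0 \<le> P0_star r lam" "P0_star r lam \<le> 1" by (auto simp: s_def)
qed

lemma equilibrium_geometric:
  assumes r: "0 < lam" "lam < 1" "admissible r"
  shows "equilibrium r lam (geometric_equilibrium r lam)"
proof -
  define \<rho> where "\<rho> = lam * P0_star r lam"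
  have \<rho>: "0 \<le> \<rho>" "\<rho> \<le> lam" "\<rho> < 1"
  proof -
    show "0 \<le> \<rho>" "\<rho> \<le> lam"
      using P0_star_bounds[OF r] r by (auto simp: \<rho>_def mult_left_le)
    then show "\<rho> < 1" using r by linarith
  qed
  define e where "e = geometric_equilibrium r lam"
  have e_Suc: "e (Suc i) = lam * \<rho> ^ i" and e0: "e 0 = 1" for i by (auto simp: e_def geometric_equilibrium_def \<rho>_def)
  have "summable (\<lambda>i. e (Suc i))"
    unfolding e_Suc using \<rho> by (intro summable_mult summable_geometric) auto
  then have sum: "summable e" by (simp add: summable_Suc_iff)
  have pow: "0 \<le> \<rho> ^ i" "\<rho> ^ i \<le> 1" "\<rho> ^ Suc i \<le> \<rho> ^ i" for i
    using \<rho> by (auto intro: power_le_one mult_left_le_one_le)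
  have "0 \<le> e i \<and> e i \<le> 1 \<and> e (Suc i) \<le> e i" for i
  proof (cases i)
    case 0
    then show ?thesis using e_Suc[of 0] e0 r by simp
  next
    case (Suc k)
    then show ?thesis
      using pow[of k] r mult_left_mono[OF pow(3), of lam k] mult_le_one[of lam "\<rho> ^ k"]
      by (simp add: e_Suc)
  qed
  then have "e \<in> S1" using sum e0 by (auto simp: S1_def S_def)
  moreover have P: "lam * P0 r lam e = \<rho>"
    using P0_eq_P0_star[of lam e r] r e_Suc[of 0] by (simp add: \<rho>_def)
  have "drift r lam e i = 0" if "i \<ge> 1" for i
  proof (cases "i = 1")
    case True
    have "drift r lam e 1 = lam - \<rho> * lam - lam + lam * \<rho>"
      unfolding drift_one P using e_Suc[of 0] e_Suc[of 1] by (simp add: numeral_2_eq_2)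
    then show ?thesis using True by simp
  next
    case False
    define k where "k = i - 2"
    have k: "i = Suc (Suc k)" using that False by (simp add: k_def)
    have "drift r lam e i = \<rho> * (e (Suc k) - e (Suc (Suc k))) - (e (Suc (Suc k)) - e (Suc (Suc (Suc k))))"
      using drift_ge_two[of "Suc (Suc k)" r lam e] unfolding P k by simp
    also have "\<dots> = 0" unfolding e_Suc by (simp add: right_diff_distrib mult.assoc mult.left_commute)
    finally show ?thesis .
  qed
  ultimately show ?thesis by (simp add: equilibrium_def e_def)
qed

lemma equilibrium_imp_fluid_solution:
  assumes "equilibrium r lam e"
  shows "fluid_solution r lam e (\<lambda>_. e)"
proof -
  have "e \<in> S1" "\<And>i. i \<ge> 1 \<Longrightarrow> drift r lam e i = 0" using assms by (auto simp: equilibrium_def)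
  moreover have "abs_continuous_on {0..T} (\<lambda>t. e i)" for T i
    by (rule lipschitz_imp_abs_continuous_on[where C = 0]) auto
  moreover have "{} \<in> null_sets lebesgue" by simp
  ultimately show ?thesis
    using S_D(3)[OF S1_D(1)] unfolding fluid_solution_def by (auto simp: wnorm_def)
qed

text \<open>
  In the High Message regime the gate is open only at \<open>s\<^sub>1 = 1\<close>, at distance \<open>1 - \<lambda>\<close> from the
  equilibrium, so that its jump is harmless there.
\<close>

lemma P0_lipschitz_at_equilibrium:
  assumes r: "0 < lam" "lam < 1" "admissible r" and e: "e \<in> S" "e 1 = lam"
  obtains L where "L \<ge> 0" "\<And>s. s \<in> S \<Longrightarrow> \<bar>P0 r lam s - P0 r lam e\<bar> \<le> L * \<bar>s 1 - e 1\<bar>"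
proof (cases "r = High_Message")
  case True
  have "\<bar>P0 r lam s - P0 r lam e\<bar> \<le> 1 / (1 - lam) * \<bar>s 1 - e 1\<bar>" if s: "s \<in> S" for s
  proof (cases "s 1 = 1")
    case s1: True
    have "1 / (1 - lam) * \<bar>s 1 - e 1\<bar> = 1" using r(2) unfolding s1 e(2) by simp
    moreover have "P0 r lam e = 0" using True e r by simp
    ultimately show ?thesis using P0_bounds[OF s r(1,3)] by linarith
  next
    case False
    then have "P0 r lam s = 0" "P0 r lam e = 0" using True e r by auto
    then show ?thesis using r by simp
  qed
  then show ?thesis using that[of "1 / (1 - lam)"] r by simp
next
  case False
  from P0_lipschitz[OF r(1,3) this] that e show ?thesis by metis
qed

theorem fluid_solution_converges:
  assumes sol: "fluid_solution r lam s0 s" and e: "equilibrium r lam e" "e 1 = lam"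
    and r: "0 < lam" "lam < 1" "admissible r"
  shows "((\<lambda>t. wnorm (\<lambda>i. s t i - e i)) \<longlongrightarrow> 0) at_top"
proof (rule wnorm_tendsto_0)
  note const = equilibrium_imp_fluid_solution[OF e(1)]
  have eS: "e \<in> S" using e(1) S1_D(1) by (auto simp: equilibrium_def)
  obtain L where L: "L \<ge> 0" "\<And>s. s \<in> S \<Longrightarrow> \<bar>P0 r lam s - P0 r lam e\<bar> \<le> L * \<bar>s 1 - e 1\<bar>"
    using P0_lipschitz_at_equilibrium[OF r eS e(2)] by blast
  show "((\<lambda>t. s t i - e i) \<longlongrightarrow> 0) at_top" for i
  proof (cases "i = 0")
    case True
    have "eventually (\<lambda>t. s t i - e i = 0) at_top"
      using eventually_ge_at_top[of "0::real"]
      by eventually_elim (use True fluid_solutionD(4)[OF sol] S_D(3)[OF eS] in simp)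
    then show ?thesis by (rule tendsto_eventually)
  next
    case False
    then have "i \<ge> 1" by simp
    from fluid_difference_integrals_bounded[OF sol const r L(1) _ this] L(2) fluid_solutionD(2)[OF sol]
    obtain C where C: "\<And>T. T \<ge> 0 \<Longrightarrow> integral {0..T} (\<lambda>t. \<bar>s t i - e i\<bar>) \<le> C" by auto
    have "((\<lambda>t. \<bar>s t i - e i\<bar>) \<longlongrightarrow> 0) at_top"
    proof (rule integrable_lipschitz_tendsto_0[OF _ _ C])
      fix u v :: real assume uv: "0 \<le> u" "u \<le> v"
      show "\<bar>\<bar>s v i - e i\<bar> - \<bar>s u i - e i\<bar>\<bar> \<le> 2 * (v - u)"
        using fluid_solution_lipschitz[OF sol r uv, of i] by linarith
    qed auto
    then show ?thesis by (simp add: tendsto_rabs_zero_iff)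
  qed
  show "eventually (\<lambda>t. \<forall>i. \<bar>s t i - e i\<bar> \<le> 1) at_top"
    using eventually_ge_at_top[of "0::real"]
  proof eventually_elim
    case (elim t)
    show ?case
    proof
      fix i
      show "\<bar>s t i - e i\<bar> \<le> 1"
        using S_D(1,2)[OF fluid_solutionD(2)[OF sol elim], of i] S_D(1,2)[OF eS, of i] by (simp add: abs_le_iff)
    qed
  qed
qed simp

text \<open>
  At an equilibrium the net flux \<open>g s\<^sub>i - s\<^sub>i\<^sub>+\<^sub>1\<close> across each level \<open>i \<ge> 1\<close> is the same. It tends to zero
  with \<open>s\<^sub>i\<close>, hence vanishes, which leaves a geometric sequence started at \<open>s\<^sub>1 = \<lambda>\<close>.
\<close>

lemma equilibrium_unique:
  assumes e: "equilibrium r lam e" and r: "0 < lam" "lam < 1" "admissible r"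
  shows "e = geometric_equilibrium r lam"
proof -
  have e1: "e \<in> S1" and drift0: "\<And>i. i \<ge> 1 \<Longrightarrow> drift r lam e i = 0" using e by (auto simp: equilibrium_def)
  define g where "g = lam * P0 r lam e"
  define f where "f i = g * e (Suc i) - e (Suc (Suc i))" for i
  have "f (Suc i) = f i" for i
    using drift0[of "Suc (Suc i)"] drift_ge_two[of "Suc (Suc i)" r lam e]
    by (simp add: f_def g_def algebra_simps)
  then have const: "f i = f 0" for i by (induction i) auto
  have "f \<longlonglongrightarrow> g * 0 - 0"
    unfolding f_def using S1_D(3)[OF e1]
    by (intro tendsto_intros LIMSEQ_Suc)
  then have "f 0 = 0" using const by (metis LIMSEQ_unique diff_zero ext mult_zero_right tendsto_const)
  then have rec: "e (Suc (Suc i)) = g * e (Suc i)" for i using const[of i] by (simp add: f_def)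
  have "e 1 = lam" using drift0[of 1] drift_one[of r lam e] rec[of 0] by (simp add: g_def numeral_2_eq_2)
  then have g: "g = lam * P0_star r lam" using P0_eq_P0_star r by (simp add: g_def)
  have "e (Suc i) = lam * g ^ i" for i
    by (induction i) (use \<open>e 1 = lam\<close> rec in auto)
  then show ?thesis
    using S_D(3)[OF S1_D(1)[OF e1]] unfolding geometric_equilibrium_def g[symmetric]
    by (auto simp: fun_eq_iff gr0_conv_Suc)
qed

section \<open>Picard iteration among decreasing sequences\<close>

definition decreasing_between :: "(nat \<Rightarrow> real) \<Rightarrow> (nat \<Rightarrow> real) \<Rightarrow> (nat \<Rightarrow> real) set" where
  "decreasing_between a b = {s. \<forall>i. a i \<le> s i \<and> s i \<le> b i \<and> s (Suc i) \<le> s i}"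

text \<open>
  The equation \<open>s' = F s\<close> is rewritten as \<open>s' = - \<kappa> s + \<kappa> (s + F s / \<kappa>)\<close>. Its integral form expresses
  \<open>s t\<close> as an average of the initial state and of the states \<open>s + F s / \<kappa>\<close> at earlier times, so the
  iteration cannot leave a convex set that is mapped into itself by \<open>s \<mapsto> s + F s / \<kappa>\<close>. The
  Lipschitz condition refers to the supremum distance, for which \<open>e\<close> is an upper bound.
\<close>

locale picard_iteration =
  fixes a b :: "nat \<Rightarrow> real" and F :: "(nat \<Rightarrow> real) \<Rightarrow> nat \<Rightarrow> real" and \<kappa> M L :: real
    and s0 :: "nat \<Rightarrow> real"
  assumes \<kappa>: "\<kappa> > 0"
    and ab: "\<And>i. 0 \<le> a i" "\<And>i. b i \<le> M"
    and inv: "\<And>s. s \<in> decreasing_between a b \<Longrightarrow> (\<lambda>i. s i + F s i / \<kappa>) \<in> decreasing_between a b"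
    and L: "L \<ge> 0"
    and lip: "\<And>s q e i. s \<in> decreasing_between a b \<Longrightarrow> q \<in> decreasing_between a b \<Longrightarrow>
        (\<And>j. \<bar>s j - q j\<bar> \<le> e) \<Longrightarrow> \<bar>F s i - F q i\<bar> \<le> L * e"
    and s0: "s0 \<in> decreasing_between a b"
begin

abbreviation "K \<equiv> decreasing_between a b"

definition H :: "(nat \<Rightarrow> real) \<Rightarrow> nat \<Rightarrow> real" where
  "H s i = \<kappa> * s i + F s i"

text \<open>The Lipschitz bound, uniform in the coordinate, makes \<open>u \<mapsto> F (p u) i\<close> continuous.\<close>

definition K_path :: "(real \<Rightarrow> nat \<Rightarrow> real) \<Rightarrow> bool" where
  "K_path p \<longleftrightarrow> (\<forall>t\<ge>0. p t \<in> K) \<and>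
     (\<forall>i u v. 0 \<le> u \<and> u \<le> v \<longrightarrow> \<bar>p v i - p u i\<bar> \<le> \<kappa> * M * (v - u))"

definition \<Phi> :: "(real \<Rightarrow> nat \<Rightarrow> real) \<Rightarrow> real \<Rightarrow> nat \<Rightarrow> real" where
  "\<Phi> p t i = exp (- \<kappa> * t) * (s0 i + integral {0..t} (\<lambda>u. exp (\<kappa> * u) * H (p u) i))"

lemma K_bounds: "s \<in> K \<Longrightarrow> 0 \<le> s i \<and> s i \<le> M"
  using ab by (auto simp: decreasing_between_def intro: order_trans)

lemma M_nonneg: "0 \<le> M"
  using K_bounds[OF s0, of 0] by linarith

lemma H_bounds:
  assumes "s \<in> K"
  shows "\<kappa> * a i \<le> H s i" "H s i \<le> \<kappa> * b i" "H s (Suc i) \<le> H s i" "0 \<le> H s i" "H s i \<le> \<kappa> * M"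
proof -
  have *: "H s j = \<kappa> * (s j + F s j / \<kappa>)" for j using \<kappa> by (simp add: H_def field_simps)
  have "a j \<le> s j + F s j / \<kappa> \<and> s j + F s j / \<kappa> \<le> b j \<and> s (Suc j) + F s (Suc j) / \<kappa> \<le> s j + F s j / \<kappa>" for j
    using inv[OF assms] by (simp add: decreasing_between_def)
  then show "\<kappa> * a i \<le> H s i" "H s i \<le> \<kappa> * b i" "H s (Suc i) \<le> H s i"
    unfolding * using \<kappa> by (auto intro!: mult_left_mono simp del: mult_le_cancel_left)
  show "0 \<le> H s i" "H s i \<le> \<kappa> * M"
    unfolding * using K_bounds[OF inv[OF assms], of i] \<kappa> by (auto intro!: mult_left_mono mult_nonneg_nonneg simp del: mult_le_cancel_left)
qed

lemma H_lipschitz: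
  assumes "s \<in> K" "q \<in> K" "\<And>j. \<bar>s j - q j\<bar> \<le> e"
  shows "\<bar>H s i - H q i\<bar> \<le> (\<kappa> + L) * e"
proof -
  have "\<bar>H s i - H q i\<bar> \<le> \<bar>\<kappa> * (s i - q i)\<bar> + \<bar>F s i - F q i\<bar>"
    by (simp add: H_def algebra_simps)
  also have "\<bar>\<kappa> * (s i - q i)\<bar> = \<kappa> * \<bar>s i - q i\<bar>" using \<kappa> by (simp add: abs_mult)
  also have "\<kappa> * \<bar>s i - q i\<bar> \<le> \<kappa> * e" using assms(3)[of i] \<kappa> by simp
  finally show ?thesis using lip[OF assms, of i] by (simp add: algebra_simps)
qed

lemma K_pathD:
  assumes "K_path p"
  shows "t \<ge> 0 \<Longrightarrow> p t \<in> K" "0 \<le> u \<Longrightarrow> u \<le> v \<Longrightarrow> \<bar>p v i - p u i\<bar> \<le> \<kappa> * M * (v - u)"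
  using assms by (auto simp: K_path_def)

lemma continuous_on_integrand:
  assumes p: "K_path p"
  shows "continuous_on {0..} (\<lambda>u. exp (\<kappa> * u) * H (p u) i)"
proof -
  have "continuous_on {0..} (\<lambda>u. H (p u) i)"
  proof (rule lipschitz_imp_continuous_on_halfline)
    fix u v :: real assume uv: "0 \<le> u" "u \<le> v"
    have "\<bar>H (p v) i - H (p u) i\<bar> \<le> (\<kappa> + L) * (\<kappa> * M * (v - u))"
      by (rule H_lipschitz) (use uv K_pathD[OF p] in auto)
    then show "\<bar>H (p v) i - H (p u) i\<bar> \<le> (\<kappa> + L) * \<kappa> * M * (v - u)" by (simp add: mult.assoc)
  qed
  then show ?thesis by (intro continuous_intros)
qed

lemma integrable_integrand:
  assumes p: "K_path p"
  shows "(\<lambda>u. exp (\<kappa> * u) * H (p u) i) integrable_on {0..t}"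
  by (intro integrable_continuous_real continuous_on_subset[OF continuous_on_integrand[OF p]]) auto

lemma has_integral_exp:
  assumes "c > 0" "t \<ge> (0::real)"
  shows "((\<lambda>u. exp (c * u) * (c * d)) has_integral (exp (c * t) * d - d)) {0..t}"
proof -
  have "((\<lambda>u. exp (c * u) * (c * d)) has_integral (exp (c * t) * d - exp (c * 0) * d)) {0..t}"
    by (rule fundamental_theorem_of_calculus[OF assms(2)])
      (auto intro!: derivative_eq_intros simp flip: has_real_derivative_iff_has_vector_derivative)
  then show ?thesis by simp
qed

lemma \<Phi>_derivative:
  assumes p: "K_path p" and t: "t \<ge> 0"
  shows "((\<lambda>u. \<Phi> p u i) has_real_derivative H (p t) i - \<kappa> * \<Phi> p t i) (at t within {0..})"
proof -
  note d = integral_has_real_derivative_halfline[OF continuous_on_integrand[OF p, of i] t]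
  have deriv: "((\<lambda>u. \<Phi> p u i) has_real_derivative
      (- \<kappa> * exp (- \<kappa> * t)) * (s0 i + integral {0..t} (\<lambda>u. exp (\<kappa> * u) * H (p u) i))
       + exp (- \<kappa> * t) * (exp (\<kappa> * t) * H (p t) i)) (at t within {0..})"
    unfolding \<Phi>_def by (rule derivative_eq_intros d refl | simp)+
  have "exp (- \<kappa> * t) * (exp (\<kappa> * t) * H (p t) i) = H (p t) i"
    by (simp add: mult.assoc[symmetric] exp_add[symmetric])
  moreover have "(- \<kappa> * exp (- \<kappa> * t)) * (s0 i + integral {0..t} (\<lambda>u. exp (\<kappa> * u) * H (p u) i))
      = - (\<kappa> * \<Phi> p t i)"
    unfolding \<Phi>_def by simp
  ultimately have "(- \<kappa> * exp (- \<kappa> * t)) * (s0 i + integral {0..t} (\<lambda>u. exp (\<kappa> * u) * H (p u) i))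
       + exp (- \<kappa> * t) * (exp (\<kappa> * t) * H (p t) i) = H (p t) i - \<kappa> * \<Phi> p t i"
    by linarith
  with deriv show ?thesis by (simp only:)
qed

lemma \<Phi>_in_K:
  assumes p: "K_path p" and t: "t \<ge> 0"
  shows "\<Phi> p t \<in> K"
  unfolding decreasing_between_def mem_Collect_eq
proof (intro allI)
  fix i
  define I where "I j = integral {0..t} (\<lambda>u. exp (\<kappa> * u) * H (p u) j)" for j
  note int = integrable_integrand[OF p]
  have pK: "p u \<in> K" if "u \<in> {0..t}" for u using that K_pathD(1)[OF p] by simp
  have s0': "a i \<le> s0 i" "s0 i \<le> b i" "s0 (Suc i) \<le> s0 i"
    using s0 by (auto simp: decreasing_between_def)
  have const: "integral {0..t} (\<lambda>u. exp (\<kappa> * u) * (\<kappa> * d)) = exp (\<kappa> * t) * d - d"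
    "(\<lambda>u. exp (\<kappa> * u) * (\<kappa> * d)) integrable_on {0..t}" for d
    by (rule integral_unique[OF has_integral_exp[OF \<kappa> t]])
      (rule has_integral_integrable[OF has_integral_exp[OF \<kappa> t]])
  have "integral {0..t} (\<lambda>u. exp (\<kappa> * u) * (\<kappa> * a i)) \<le> I i"
    unfolding I_def by (rule integral_le[OF const(2) int]) (auto intro!: mult_left_mono H_bounds pK)
  then have 1: "exp (\<kappa> * t) * a i \<le> s0 i + I i" using const(1) s0' by simp
  have "I i \<le> integral {0..t} (\<lambda>u. exp (\<kappa> * u) * (\<kappa> * b i))"
    unfolding I_def by (rule integral_le[OF int const(2)]) (auto intro!: mult_left_mono H_bounds pK)
  then have 2: "s0 i + I i \<le> exp (\<kappa> * t) * b i" using const(1) s0' by simp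
  have "I (Suc i) \<le> I i"
    unfolding I_def by (rule integral_le[OF int int]) (auto intro!: mult_left_mono H_bounds pK)
  then have 3: "s0 (Suc i) + I (Suc i) \<le> s0 i + I i" using s0' by simp
  have ee: "exp (- \<kappa> * t) * (exp (\<kappa> * t) * d) = d" for d
    by (simp add: mult.assoc[symmetric] exp_add[symmetric])
  show "a i \<le> \<Phi> p t i \<and> \<Phi> p t i \<le> b i \<and> \<Phi> p t (Suc i) \<le> \<Phi> p t i"
    using mult_left_mono[OF 1, of "exp (- \<kappa> * t)"] mult_left_mono[OF 2, of "exp (- \<kappa> * t)"]
      mult_left_mono[OF 3, of "exp (- \<kappa> * t)"]
    unfolding ee \<Phi>_def I_def by simp
qed

lemma K_path_\<Phi>:
  assumes p: "K_path p"
  shows "K_path (\<Phi> p)"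
  unfolding K_path_def
proof (intro conjI allI impI)
  show "\<Phi> p t \<in> K" if "t \<ge> 0" for t by (rule \<Phi>_in_K[OF p that])
  fix i and u v :: real assume uv: "0 \<le> u \<and> u \<le> v"
  have "norm (\<Phi> p v i - \<Phi> p u i) \<le> \<kappa> * M * norm (v - u)"
  proof (rule field_differentiable_bound[of "{0..}" "\<lambda>u. \<Phi> p u i" "\<lambda>t. H (p t) i - \<kappa> * \<Phi> p t i"])
    fix t :: real assume "t \<in> {0..}"
    then have t: "t \<ge> 0" by simp
    show "((\<lambda>u. \<Phi> p u i) has_field_derivative H (p t) i - \<kappa> * \<Phi> p t i) (at t within {0..})"
      by (rule \<Phi>_derivative[OF p t])
    have "0 \<le> \<kappa> * \<Phi> p t i" "\<kappa> * \<Phi> p t i \<le> \<kappa> * M"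
      using K_bounds[OF \<Phi>_in_K[OF p t], of i] \<kappa> by auto
    then show "norm (H (p t) i - \<kappa> * \<Phi> p t i) \<le> \<kappa> * M"
      using H_bounds(4,5)[OF K_pathD(1)[OF p t], of i] by (simp add: abs_le_iff)
  qed (use uv in auto)
  then show "\<bar>\<Phi> p v i - \<Phi> p u i\<bar> \<le> \<kappa> * M * (v - u)" using uv by simp
qed

text \<open>
  Measured with the weight \<open>exp (- rate t)\<close>, distances are halved by \<open>\<Phi>\<close>: integrating
  \<open>(\<kappa> + L) exp (rate u)\<close> up to \<open>t\<close> gives at most \<open>exp (rate t) / 2\<close>. Convergence is thus geometric
  at every time, without a restriction to short time intervals.
\<close>

definition rate :: real where "rate = 2 * (\<kappa> + L)"

lemma \<Phi>_contraction:
  assumes p: "K_path p" and q: "K_path q" and t: "t \<ge> 0"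
    and D: "\<And>u j. u \<ge> 0 \<Longrightarrow> \<bar>p u j - q u j\<bar> \<le> D * exp (rate * u)"
  shows "\<bar>\<Phi> p t i - \<Phi> q t i\<bar> \<le> D / 2 * exp (rate * t)"
proof -
  have rate: "rate > 0" using \<kappa> L by (simp add: rate_def)
  have D0: "D \<ge> 0" using D[of 0 0] by simp
  let ?d = "\<lambda>u. exp (\<kappa> * u) * H (p u) i - exp (\<kappa> * u) * H (q u) i"
  have "norm (integral {0..t} ?d) \<le> integral {0..t} (\<lambda>u. exp (\<kappa> * t) * (exp (rate * u) * (rate * (D / 2))))"
  proof (rule integral_norm_bound_integral)
    show "?d integrable_on {0..t}"
      by (intro integrable_diff integrable_integrand p q)
    show "(\<lambda>u. exp (\<kappa> * t) * (exp (rate * u) * (rate * (D / 2)))) integrable_on {0..t}"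
      using has_integral_exp[OF rate t, of "D / 2"] by (intro integrable_on_mult_right) (rule has_integral_integrable)
    fix u assume u: "u \<in> {0..t}"
    have "\<bar>H (p u) i - H (q u) i\<bar> \<le> (\<kappa> + L) * (D * exp (rate * u))"
      by (rule H_lipschitz) (use u K_pathD(1)[OF p] K_pathD(1)[OF q] D in auto)
    also have "\<dots> = exp (rate * u) * (rate * (D / 2))" by (simp add: rate_def)
    finally have "exp (\<kappa> * u) * \<bar>H (p u) i - H (q u) i\<bar> \<le> exp (\<kappa> * t) * (exp (rate * u) * (rate * (D / 2)))"
      using u \<kappa> by (intro mult_mono) auto
    then show "norm (?d u) \<le> exp (\<kappa> * t) * (exp (rate * u) * (rate * (D / 2)))"
      by (simp add: abs_mult right_diff_distrib[symmetric])
  qed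
  also have "\<dots> = exp (\<kappa> * t) * (exp (rate * t) * (D / 2) - D / 2)"
    by (simp only: integral_mult_right integral_unique[OF has_integral_exp[OF rate t]])
  also have "\<dots> \<le> exp (\<kappa> * t) * (exp (rate * t) * (D / 2))"
    using D0 by (intro mult_left_mono) auto
  finally have I: "\<bar>integral {0..t} ?d\<bar> \<le> exp (\<kappa> * t) * (exp (rate * t) * (D / 2))" by simp
  have "\<Phi> p t i - \<Phi> q t i = exp (- \<kappa> * t) * integral {0..t} ?d"
    unfolding \<Phi>_def
    unfolding Henstock_Kurzweil_Integration.integral_diff[OF integrable_integrand[OF p] integrable_integrand[OF q]]
    by (simp add: right_diff_distrib[symmetric])
  then have "\<bar>\<Phi> p t i - \<Phi> q t i\<bar> = exp (- \<kappa> * t) * \<bar>integral {0..t} ?d\<bar>" by (simp add: abs_mult)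
  also have "\<dots> \<le> exp (- \<kappa> * t) * (exp (\<kappa> * t) * (exp (rate * t) * (D / 2)))"
    using I by (intro mult_left_mono) auto
  also have "\<dots> = D / 2 * exp (rate * t)" by (simp add: mult.assoc[symmetric] exp_add[symmetric])
  finally show ?thesis .
qed

definition iterate :: "nat \<Rightarrow> real \<Rightarrow> nat \<Rightarrow> real" where
  "iterate n = (\<Phi> ^^ n) (\<lambda>_. s0)"

lemma iterate_Suc: "iterate (Suc n) = \<Phi> (iterate n)"
  by (simp add: iterate_def)

lemma K_path_iterate: "K_path (iterate n)"
proof (induction n)
  case 0
  show ?case using s0 M_nonneg \<kappa> by (simp add: iterate_def K_path_def)
next
  case (Suc n)
  then show ?case unfolding iterate_Suc by (rule K_path_\<Phi>)
qed

lemma iterate_step: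
  assumes "t \<ge> 0"
  shows "\<bar>iterate (Suc n) t i - iterate n t i\<bar> \<le> M * (1/2) ^ n * exp (rate * t)"
  using assms
proof (induction n arbitrary: t i)
  case 0
  have "0 \<le> rate * t" using 0 \<kappa> L by (simp add: rate_def)
  then have "M * 1 \<le> M * exp (rate * t)" using M_nonneg by (intro mult_left_mono) auto
  moreover have "\<bar>iterate (Suc 0) t i - iterate 0 t i\<bar> \<le> M"
    using K_bounds[OF K_pathD(1)[OF K_path_iterate 0], of "Suc 0" i]
      K_bounds[OF K_pathD(1)[OF K_path_iterate 0], of 0 i] by (simp add: abs_le_iff)
  ultimately show ?case by simp
next
  case (Suc n)
  have "\<bar>\<Phi> (iterate (Suc n)) t i - \<Phi> (iterate n) t i\<bar> \<le> M * (1/2) ^ n / 2 * exp (rate * t)"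
    by (rule \<Phi>_contraction[OF K_path_iterate K_path_iterate]) (use Suc in auto)
  then show ?case by (simp add: iterate_Suc)
qed

lemma iterate_distance:
  assumes "t \<ge> 0"
  shows "\<bar>iterate (n + k) t i - iterate n t i\<bar> \<le> 2 * M * exp (rate * t) * ((1/2) ^ n - (1/2) ^ (n + k))"
proof (induction k)
  case (Suc k)
  have "\<bar>iterate (n + Suc k) t i - iterate n t i\<bar>
      \<le> \<bar>iterate (Suc (n + k)) t i - iterate (n + k) t i\<bar> + \<bar>iterate (n + k) t i - iterate n t i\<bar>" by simp
  also have "\<dots> \<le> M * (1/2) ^ (n + k) * exp (rate * t) + 2 * M * exp (rate * t) * ((1/2) ^ n - (1/2) ^ (n + k))"
    by (intro add_mono iterate_step[OF assms] Suc)
  also have "\<dots> = 2 * M * exp (rate * t) * ((1/2) ^ n - (1/2) ^ (n + Suc k))"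
    by (simp add: field_simps)
  finally show ?case .
qed simp

definition limit_path :: "real \<Rightarrow> nat \<Rightarrow> real" where
  "limit_path t i = lim (\<lambda>n. iterate n t i)"

lemma iterate_tendsto:
  assumes "t \<ge> 0"
  shows "(\<lambda>n. iterate n t i) \<longlonglongrightarrow> limit_path t i"
proof -
  have bound: "\<bar>iterate m t i - iterate n t i\<bar> \<le> 2 * M * exp (rate * t) * (1/2) ^ n" if "n \<le> m" for m n
  proof -
    have "\<bar>iterate m t i - iterate n t i\<bar> \<le> 2 * M * exp (rate * t) * ((1/2) ^ n - (1/2) ^ m)"
      using iterate_distance[OF assms, of n "m - n" i] that by simp
    also have "\<dots> \<le> 2 * M * exp (rate * t) * (1/2) ^ n"
      using M_nonneg by (intro mult_left_mono) auto
    finally show ?thesis .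
  qed
  have "(\<lambda>n. 2 * M * exp (rate * t) * (1/2::real) ^ n) \<longlonglongrightarrow> 2 * M * exp (rate * t) * 0"
    by (intro tendsto_mult tendsto_const LIMSEQ_power_zero) simp
  then have small: "(\<lambda>n. 2 * M * exp (rate * t) * (1/2::real) ^ n) \<longlonglongrightarrow> 0" by simp
  have "Cauchy (\<lambda>n. iterate n t i)"
  proof (rule CauchyI')
    fix e :: real assume "e > 0"
    obtain N where N: "\<And>n. n \<ge> N \<Longrightarrow> 2 * M * exp (rate * t) * (1/2) ^ n < e"
      using order_tendstoD(2)[OF small \<open>e > 0\<close>] unfolding eventually_sequentially by blast
    show "\<exists>N. \<forall>m\<ge>N. \<forall>n>m. dist (iterate m t i) (iterate n t i) < e"
    proof (intro exI allI impI)
      fix m n assume "N \<le> m" "m < n"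
      then show "dist (iterate m t i) (iterate n t i) < e"
        using bound[of m n] N[of m] by (simp add: dist_real_def abs_minus_commute)
    qed
  qed
  then show ?thesis unfolding limit_path_def by (metis Cauchy_convergent convergent_LIMSEQ_iff)
qed

lemma iterate_error:
  assumes "t \<ge> 0"
  shows "\<bar>limit_path t i - iterate n t i\<bar> \<le> 2 * M * (1/2) ^ n * exp (rate * t)"
proof (rule LIMSEQ_le_const2)
  show "(\<lambda>k. \<bar>iterate (k + n) t i - iterate n t i\<bar>) \<longlonglongrightarrow> \<bar>limit_path t i - iterate n t i\<bar>"
    by (intro tendsto_intros LIMSEQ_ignore_initial_segment iterate_tendsto[OF assms])
  have "\<bar>iterate (k + n) t i - iterate n t i\<bar> \<le> 2 * M * (1/2) ^ n * exp (rate * t)" for k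
  proof -
    have "\<bar>iterate (k + n) t i - iterate n t i\<bar> \<le> 2 * M * exp (rate * t) * ((1/2) ^ n - (1/2) ^ (n + k))"
      using iterate_distance[OF assms, of n k i] by (simp add: add.commute)
    also have "\<dots> \<le> 2 * M * exp (rate * t) * (1/2) ^ n"
      using M_nonneg by (intro mult_left_mono) auto
    finally show ?thesis by (simp add: mult_ac)
  qed
  then show "\<exists>N. \<forall>k\<ge>N. \<bar>iterate (k + n) t i - iterate n t i\<bar> \<le> 2 * M * (1/2) ^ n * exp (rate * t)"
    by blast
qed

lemma K_path_limit: "K_path limit_path"
  unfolding K_path_def decreasing_between_def mem_Collect_eq
proof (intro conjI allI impI)
  fix t :: real and i assume t: "t \<ge> 0"
  note lim = iterate_tendsto[OF t]
  have it: "a i \<le> iterate n t i" "iterate n t i \<le> b i" "iterate n t (Suc i) \<le> iterate n t i" for n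
    using K_pathD(1)[OF K_path_iterate t, of n] by (auto simp: decreasing_between_def)
  show "a i \<le> limit_path t i" by (rule LIMSEQ_le_const[OF lim]) (use it in blast)
  show "limit_path t i \<le> b i" by (rule LIMSEQ_le_const2[OF lim]) (use it in blast)
  show "limit_path t (Suc i) \<le> limit_path t i" by (rule LIMSEQ_le[OF lim lim]) (use it in blast)
next
  fix i and u v :: real assume uv: "0 \<le> u \<and> u \<le> v"
  show "\<bar>limit_path v i - limit_path u i\<bar> \<le> \<kappa> * M * (v - u)"
  proof (rule LIMSEQ_le_const2)
    show "(\<lambda>n. \<bar>iterate n v i - iterate n u i\<bar>) \<longlonglongrightarrow> \<bar>limit_path v i - limit_path u i\<bar>"
      using uv by (intro tendsto_intros iterate_tendsto) auto
  qed (use uv K_pathD(2)[OF K_path_iterate] in blast)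
qed

text \<open>
  The contraction also bounds the distance of \<open>\<Phi> limit_path\<close> to the next iterate, so both are the limit
  of the same sequence; no interchange of limit and integral is needed.
\<close>

lemma \<Phi>_limit_path:
  assumes t: "t \<ge> 0"
  shows "\<Phi> limit_path t i = limit_path t i"
proof -
  have err: "\<bar>\<Phi> limit_path t i - iterate (Suc n) t i\<bar> \<le> 2 * M * (1/2) ^ n / 2 * exp (rate * t)" for n
    unfolding iterate_Suc
    by (rule \<Phi>_contraction[OF K_path_limit K_path_iterate t iterate_error])
  have "(\<lambda>n. 2 * M * (1/2::real) ^ n / 2 * exp (rate * t)) \<longlonglongrightarrow> 2 * M * 0 / 2 * exp (rate * t)"
    by (intro tendsto_intros LIMSEQ_power_zero) auto
  then have "(\<lambda>n. 2 * M * (1/2::real) ^ n / 2 * exp (rate * t)) \<longlonglongrightarrow> 0" by simp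
  then have "(\<lambda>n. \<Phi> limit_path t i - iterate (Suc n) t i) \<longlonglongrightarrow> 0"
    by (rule Lim_null_comparison[rotated]) (use err in simp)
  then have "(\<lambda>n. \<Phi> limit_path t i - (\<Phi> limit_path t i - iterate (Suc n) t i)) \<longlonglongrightarrow> \<Phi> limit_path t i - 0"
    by (intro tendsto_intros)
  then have "(\<lambda>n. iterate (Suc n) t i) \<longlonglongrightarrow> \<Phi> limit_path t i" by simp
  moreover have "(\<lambda>n. iterate (Suc n) t i) \<longlonglongrightarrow> limit_path t i"
    by (rule LIMSEQ_Suc[OF iterate_tendsto[OF t]])
  ultimately show ?thesis by (rule LIMSEQ_unique)
qed

theorem solution_exists:
  "\<exists>s. s 0 = s0 \<and> (\<forall>t\<ge>0. s t \<in> K) \<and>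
     (\<forall>t\<ge>0. \<forall>i. ((\<lambda>u. s u i) has_real_derivative F (s t) i) (at t within {0..}))"
proof (intro exI[of _ limit_path] conjI allI impI)
  show "limit_path 0 = s0" using \<Phi>_limit_path[of 0] by (auto simp: \<Phi>_def)
  show "limit_path t \<in> K" if "t \<ge> 0" for t
    by (rule K_pathD(1)[OF K_path_limit that])
  fix t :: real and i assume t: "t \<ge> 0"
  have "((\<lambda>u. \<Phi> limit_path u i) has_real_derivative F (limit_path t) i) (at t within {0..})"
    using \<Phi>_derivative[OF K_path_limit t, of i] \<Phi>_limit_path[OF t, of i] by (simp add: H_def)
  then show "((\<lambda>u. limit_path u i) has_real_derivative F (limit_path t) i) (at t within {0..})"
    by (rule has_field_derivative_transform_within[OF _ zero_less_one]) (use t \<Phi>_limit_path in auto)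
qed

end

section \<open>Flows with a Lipschitz gate\<close>

text \<open>
  With \<open>\<kappa> \<ge> 2\<close> the sequence \<open>\<kappa> s + F s\<close> is again decreasing and nonnegative, because its entries
  and its differences from the second on are combinations of those of \<open>s\<close> with nonnegative coefficients
  and a nonnegative constant; for the second difference this uses \<open>\<gamma> s * b 1 \<le> lam\<close>. The bound on the first
  coordinate depends on how the gate behaves near saturation and is the hypothesis \<open>top\<close>. The upper
  bounds \<open>b\<close> are a parameter because with a closed gate the first coordinate may exceed 1;
  \<open>\<gamma>_b\<close> says that from the first coordinate on they are constant wherever the gate is open.
\<close>

lemma gated_flow_exists:
  fixes b :: "nat \<Rightarrow> real" and \<gamma> :: "(nat \<Rightarrow> real) \<Rightarrow> real"
  defines "K \<equiv> decreasing_between (\<lambda>i. if i = 0 then b 0 else 0) b"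
  assumes lam: "0 < lam" "lam < 1"
    and b: "\<And>i. b i \<le> 2" "\<And>i. b (Suc i) \<le> b i" "b 1 = b 0" "0 \<le> b 0"
    and \<gamma>: "\<And>s. s \<in> K \<Longrightarrow> 0 \<le> \<gamma> s \<and> \<gamma> s \<le> lam \<and> \<gamma> s * b 1 \<le> lam"
    and \<gamma>_b: "\<And>s i. s \<in> K \<Longrightarrow> i \<ge> 2 \<Longrightarrow> \<gamma> s * b (i - 1) = \<gamma> s * b i"
    and lip: "C \<ge> 0" "\<And>s q e. s \<in> K \<Longrightarrow> q \<in> K \<Longrightarrow> (\<And>j. \<bar>s j - q j\<bar> \<le> e) \<Longrightarrow> \<bar>\<gamma> s - \<gamma> q\<bar> \<le> C * e"
    and \<kappa>: "\<kappa> \<ge> 2"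
    and top: "\<And>s. s \<in> K \<Longrightarrow> \<kappa> * s 1 + gated_drift lam (\<gamma> s) s 1 \<le> \<kappa> * b 1"
    and s0: "s0 \<in> K"
  shows "\<exists>s. s 0 = s0 \<and> (\<forall>t\<ge>0. s t \<in> K) \<and>
     (\<forall>t\<ge>0. \<forall>i. ((\<lambda>u. s u i) has_real_derivative gated_drift lam (\<gamma> (s t)) (s t) i) (at t within {0..}))"
  unfolding K_def
proof (rule picard_iteration.solution_exists[where \<kappa> = \<kappa> and M = 2 and L = "2 * C + 4"], unfold_locales)
  have K_D: "0 \<le> s i" "s i \<le> b i" "s i \<le> 2" "s (Suc i) \<le> s i" "s 0 = b 0" if s: "s \<in> K" for s i
  proof -
    have s': "(if i = 0 then b 0 else 0) \<le> s i \<and> s i \<le> b i \<and> s (Suc i) \<le> s i" for i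
      using s by (simp add: K_def decreasing_between_def)
    show "0 \<le> s i" "s i \<le> b i" "s (Suc i) \<le> s i" using s'[of i] b(4) by (auto split: if_splits)
    then show "s i \<le> 2" using b(1)[of i] by linarith
    show "s 0 = b 0" using s'[of 0] by simp
  qed
  show "\<kappa> > 0" using \<kappa> by simp
  show "0 \<le> (if i = 0 then b 0 else 0)" for i :: nat using b(4) by simp
  show "b i \<le> 2" for i by (rule b(1))
  show "0 \<le> 2 * C + 4" using lip(1) by simp
  show "s0 \<in> decreasing_between (\<lambda>i. if i = 0 then b 0 else 0) b" using s0 by (simp add: K_def)
  show "(\<lambda>i. s i + gated_drift lam (\<gamma> s) s i / \<kappa>) \<in> decreasing_between (\<lambda>i. if i = 0 then b 0 else 0) b"
    if "s \<in> decreasing_between (\<lambda>i. if i = 0 then b 0 else 0) b" for s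
  proof -
    have s: "s \<in> K" using that by (simp add: K_def)
    define g where "g = \<gamma> s"
    have g: "0 \<le> g" "g \<le> lam" "g \<le> 1" using \<gamma>[OF s] lam by (auto simp: g_def)
    define h where "h i = \<kappa> * s i + gated_drift lam g s i" for i
    have h0: "h 0 = \<kappa> * b 0" using K_D(5)[OF s] by (simp add: h_def gated_drift_def)
    have h1: "h 1 = (\<kappa> - g - 1) * s 1 + lam + s 2"
      by (simp add: h_def gated_drift_def algebra_simps)
    have h2: "h i = (\<kappa> - g - 1) * s i + g * s (i - 1) + s (i + 1)" if "i \<ge> 2" for i
      using that by (simp add: h_def gated_drift_def algebra_simps)
    have pos: "0 \<le> \<kappa> - g - 1" using \<kappa> g by simp
    have h_upper: "h i \<le> \<kappa> * b i" for i
    proof -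
      consider "i = 0" | "i = 1" | "i \<ge> 2" by linarith
      then show ?thesis
      proof cases
        case 3
        have "h i \<le> (\<kappa> - g - 1) * b i + g * b (i - 1) + b (i + 1)"
          unfolding h2[OF 3] using pos g K_D(2)[OF s] by (intro add_mono mult_left_mono) auto
        also have "g * b (i - 1) = g * b i" unfolding g_def by (rule \<gamma>_b[OF s 3])
        also have "(\<kappa> - g - 1) * b i + g * b i + b (i + 1) \<le> \<kappa> * b i"
          using b(2)[of i] by (simp add: algebra_simps)
        finally show ?thesis .
      qed (use h0 top[OF s] in \<open>auto simp: h_def g_def\<close>)
    qed
    have h_lower: "\<kappa> * (if i = 0 then b 0 else 0) \<le> h i" for i
    proof -
      consider "i = 0" | "i = 1" | "i \<ge> 2" by linarith
      then show ?thesis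
      proof cases
        case 2
        then show ?thesis unfolding 2 h1 using pos K_D(1)[OF s] lam by (simp add: add_nonneg_nonneg)
      next
        case 3
        then show ?thesis unfolding h2[OF 3] using pos g K_D(1)[OF s] by (simp add: add_nonneg_nonneg)
      qed (use h0 in auto)
    qed
    have h_dec: "h (Suc i) \<le> h i" for i
    proof -
      define d where "d j = s j - s (Suc j)" for j
      have d: "0 \<le> d j" for j using K_D(4)[OF s] by (simp add: d_def)
      consider "i = 0" | "i = 1" | "i \<ge> 2" by linarith
      then show ?thesis
      proof cases
        case 1
        then show ?thesis using h_upper[of 1] h0 b(3) by simp
      next
        case 2
        have "h 1 - h 2 = (\<kappa> - g - 1) * d 1 + lam - g * s 1 + d 2"
          unfolding h1 h2[of 2, simplified] by (simp add: d_def algebra_simps numeral_eq_Suc)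
        moreover have "0 \<le> (\<kappa> - g - 1) * d 1" using pos d by simp
        moreover have "g * s 1 \<le> g * b 1" using g K_D(2)[OF s] by (intro mult_left_mono) auto
        moreover have "g * b 1 \<le> lam" using \<gamma>[OF s] by (simp add: g_def)
        moreover note d[of 2]
        ultimately have "h 2 \<le> h 1" by linarith
        then show ?thesis using 2 by (simp add: numeral_2_eq_2)
      next
        case 3
        have "h i - h (Suc i) = (\<kappa> - g - 1) * d i + g * d (i - 1) + d (Suc i)"
          unfolding h2[OF 3] h2[of "Suc i", simplified, OF order_trans[OF _ 3, of 1, simplified]]
          using 3 by (simp add: d_def algebra_simps)
        moreover have "0 \<le> (\<kappa> - g - 1) * d i + g * d (i - 1) + d (Suc i)"
          using pos g d by (intro add_nonneg_nonneg mult_nonneg_nonneg) auto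
        ultimately show ?thesis by simp
      qed
    qed
    have "s i + gated_drift lam (\<gamma> s) s i / \<kappa> = h i / \<kappa>" for i
      using \<kappa> by (simp add: h_def g_def field_simps)
    then show ?thesis
      unfolding decreasing_between_def using h_upper h_lower h_dec \<kappa>
      by (simp add: pos_le_divide_eq pos_divide_le_eq divide_right_mono mult.commute)
  qed
  fix s q :: "nat \<Rightarrow> real" and e :: real and i :: nat
  assume "s \<in> decreasing_between (\<lambda>i. if i = 0 then b 0 else 0) b"
    "q \<in> decreasing_between (\<lambda>i. if i = 0 then b 0 else 0) b" and e: "\<And>j. \<bar>s j - q j\<bar> \<le> e"
  then have s: "s \<in> K" and q: "q \<in> K" by (auto simp: K_def)
  have e0: "e \<ge> 0" using e[of 0] by linarith
  have \<gamma>e: "\<bar>\<gamma> s - \<gamma> q\<bar> \<le> C * e" by (rule lip(2)[OF s q e])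
  have g: "\<bar>\<gamma> q\<bar> \<le> 1" using \<gamma>[OF q] lam by simp
  have prod: "\<bar>\<gamma> s * x - \<gamma> q * y\<bar> \<le> 2 * (C * e) + d" if "0 \<le> x" "x \<le> 2" "\<bar>x - y\<bar> \<le> d" for x y d
  proof -
    have "\<gamma> s * x - \<gamma> q * y = (\<gamma> s - \<gamma> q) * x + \<gamma> q * (x - y)" by (simp add: algebra_simps)
    then have "\<bar>\<gamma> s * x - \<gamma> q * y\<bar> \<le> \<bar>\<gamma> s - \<gamma> q\<bar> * \<bar>x\<bar> + \<bar>\<gamma> q\<bar> * \<bar>x - y\<bar>"
      by (metis abs_mult abs_triangle_ineq)
    also have "\<dots> \<le> (C * e) * 2 + 1 * d"
      using that \<gamma>e g lip(1) e0 by (intro add_mono mult_mono) auto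
    finally show ?thesis by simp
  qed
  have goal: "(2 * C + 4) * e = 2 * (C * e) + 4 * e" by (simp add: algebra_simps)
  consider "i = 0" | "i = 1" | "i \<ge> 2" by linarith
  then show "\<bar>gated_drift lam (\<gamma> s) s i - gated_drift lam (\<gamma> q) q i\<bar> \<le> (2 * C + 4) * e"
  proof cases
    case 1
    then show ?thesis using e0 lip(1) by (simp add: gated_drift_def)
  next
    case 2
    have "\<bar>\<gamma> s * s 1 - \<gamma> q * q 1\<bar> \<le> 2 * (C * e) + e"
      by (rule prod) (use K_D[OF s] e in auto)
    then show ?thesis
      using e[of 1] e[of 2] e0 unfolding goal 2 by (simp add: gated_drift_def)
  next
    case 3
    have "s i \<le> s (i - 1)" using K_D(4)[OF s, of "i - 1"] 3 by simp
    then have "\<bar>\<gamma> s * (s (i - 1) - s i) - \<gamma> q * (q (i - 1) - q i)\<bar> \<le> 2 * (C * e) + 2 * e"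
      using K_D(3)[OF s, of "i - 1"] K_D(1)[OF s, of i] e[of i] e[of "i - 1"]
      by (intro prod) linarith+
    moreover have eq: "gated_drift lam (\<gamma> p) p i = \<gamma> p * (p (i - 1) - p i) - (p i - p (i + 1))" for p
      using 3 by (simp add: gated_drift_def)
    ultimately show ?thesis
      using e[of i] e[of "i + 1"] unfolding goal eq by linarith
  qed
qed

lemma S_eq_decreasing_between: "S = decreasing_between (\<lambda>i. if i = 0 then 1 else 0) (\<lambda>_. 1)"
proof (rule set_eqI)
  fix s :: "nat \<Rightarrow> real"
  have "s 0 = 1 \<and> (\<forall>i. 0 \<le> s i) \<longleftrightarrow> (\<forall>i. (if i = 0 then 1 else 0) \<le> s i)" if "\<forall>i. s i \<le> 1"
    using that[rule_format, of 0] by (metis antisym zero_le_one)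
  then show "s \<in> S \<longleftrightarrow> s \<in> decreasing_between (\<lambda>i. if i = 0 then 1 else 0) (\<lambda>_. 1)"
    unfolding S_def decreasing_between_def by (simp only: mem_Collect_eq atLeastAtMost_iff) blast
qed

lemma flow_in_S:
  assumes lam: "0 < lam" "lam < 1"
    and \<gamma>: "\<And>s. s \<in> S \<Longrightarrow> 0 \<le> \<gamma> s \<and> \<gamma> s \<le> lam"
    and lip: "C \<ge> 0" "\<And>s q e. s \<in> S \<Longrightarrow> q \<in> S \<Longrightarrow> (\<And>j. \<bar>s j - q j\<bar> \<le> e) \<Longrightarrow> \<bar>\<gamma> s - \<gamma> q\<bar> \<le> C * e"
    and \<kappa>: "\<kappa> \<ge> 2"
    and top: "\<And>s. s \<in> S \<Longrightarrow> \<kappa> * s 1 + gated_drift lam (\<gamma> s) s 1 \<le> \<kappa>"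
    and s0: "s0 \<in> S"
  shows "\<exists>s. s 0 = s0 \<and> (\<forall>t\<ge>0. s t \<in> S) \<and>
     (\<forall>t\<ge>0. \<forall>i. ((\<lambda>u. s u i) has_real_derivative gated_drift lam (\<gamma> (s t)) (s t) i) (at t within {0..}))"
  unfolding S_eq_decreasing_between
  by (rule gated_flow_exists[where b = "\<lambda>_. 1" and C = C and \<kappa> = \<kappa>])
    (unfold S_eq_decreasing_between[symmetric], use assms in simp_all)

text \<open>
  A flow with permanently closed gate. Nothing keeps its first coordinate below 1; it describes the High
  Message regime for as long as that coordinate does not exceed 1.
\<close>

definition free_flow :: "real \<Rightarrow> (real \<Rightarrow> nat \<Rightarrow> real) \<Rightarrow> bool" where
  "free_flow lam s \<longleftrightarrow> (\<forall>t\<ge>0. s t 0 = 1 \<and>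
     (\<forall>i\<ge>1. 0 \<le> s t i \<and> s t (Suc i) \<le> s t i) \<and>
     (\<forall>i. ((\<lambda>u. s u i) has_real_derivative gated_drift lam 0 (s t) i) (at t within {0..})))"

lemma free_flow_exists:
  assumes lam: "0 < lam" "lam < 1" and s0: "s0 \<in> S"
  obtains s where "s 0 = s0" "free_flow lam s"
proof -
  \<comment> \<open>As \<open>s\<^sub>2 \<le> 1\<close> gives \<open>s\<^sub>1' \<le> 2 - s\<^sub>1\<close>, the first coordinate never exceeds 2. To keep the sequence decreasing, coordinate 0 is set to 2 during the construction.\<close>
  define b :: "nat \<Rightarrow> real" where "b i = (if i \<le> 1 then 2 else 1)" for i
  define K where "K = decreasing_between (\<lambda>i. if i = 0 then b 0 else 0) b"
  have K: "0 \<le> s i" "s i \<le> b i" "s (Suc i) \<le> s i" if "s \<in> K" for s i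
  proof -
    have "(if i = 0 then b 0 else 0) \<le> s i \<and> s i \<le> b i \<and> s (Suc i) \<le> s i"
      using that by (simp add: K_def decreasing_between_def)
    then show "0 \<le> s i" "s i \<le> b i" "s (Suc i) \<le> s i" by (auto simp: b_def split: if_splits)
  qed
  have "(if i = 0 then b 0 else 0) \<le> (s0(0 := 2)) i \<and> (s0(0 := 2)) i \<le> b i \<and> (s0(0 := 2)) (Suc i) \<le> (s0(0 := 2)) i" for i
    using S_D(1,2,4)[OF s0, of i] S_D(2)[OF s0, of "Suc i"] by (auto simp: b_def)
  then have start: "s0(0 := 2) \<in> K" unfolding K_def decreasing_between_def by blast
  have "\<exists>p. p 0 = s0(0 := 2) \<and> (\<forall>t\<ge>0. p t \<in> K) \<and>
     (\<forall>t\<ge>0. \<forall>i. ((\<lambda>u. p u i) has_real_derivative gated_drift lam 0 (p t) i) (at t within {0..}))"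
    unfolding K_def
  proof (rule gated_flow_exists[where b = b and \<gamma> = "\<lambda>_. 0" and C = 0 and \<kappa> = 2, OF lam])
    fix s assume "s \<in> decreasing_between (\<lambda>i. if i = 0 then b 0 else 0) b"
    then have "s \<in> K" by (simp add: K_def)
    then have "s 1 \<le> 2" "s 2 \<le> 1" using K(2)[of s 1] K(2)[of s 2] by (auto simp: b_def)
    then show "2 * s 1 + gated_drift lam 0 s 1 \<le> 2 * b 1"
      using lam by (simp add: gated_drift_def b_def)
  qed (use start lam in \<open>auto simp: K_def b_def\<close>)
  then obtain p where p: "p 0 = s0(0 := 2)" "\<And>t. t \<ge> 0 \<Longrightarrow> p t \<in> K"
    "\<And>t i. t \<ge> 0 \<Longrightarrow> ((\<lambda>u. p u i) has_real_derivative gated_drift lam 0 (p t) i) (at t within {0..})"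
    by blast
  define s where "s t = (p t)(0 := 1)" for t
  show ?thesis
  proof (rule that[of s])
    show "s 0 = s0" using p(1) S_D(3)[OF s0] by (auto simp: s_def)
    show "free_flow lam s"
      unfolding free_flow_def
    proof (intro allI impI conjI)
      show "s t 0 = 1" for t by (simp add: s_def)
      show "0 \<le> s t i" "s t (Suc i) \<le> s t i" if "t \<ge> 0" "i \<ge> 1" for t i
        using K[OF p(2)[OF that(1)], of i] that(2) by (simp_all add: s_def)
      show "((\<lambda>u. s u i) has_real_derivative gated_drift lam 0 (s t) i) (at t within {0..})" if "t \<ge> 0" for t i
      proof (cases "i = 0")
        case False
        then have "(\<lambda>u. s u i) = (\<lambda>u. p u i)" "gated_drift lam 0 (s t) i = gated_drift lam 0 (p t) i"
          by (auto simp: s_def gated_drift_def)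
        then show ?thesis using p(3)[OF that, of i] by simp
      qed (simp add: s_def gated_drift_def)
    qed
  qed
qed

section \<open>From segments to fluid solutions\<close>

lemma nonincreasing_on_halfline:
  assumes der: "\<And>t. t \<ge> 0 \<Longrightarrow> (f has_real_derivative f' t) (at t within {0..})"
    and "0 \<le> a" "a \<le> b" and neg: "\<And>t. a < t \<Longrightarrow> t < b \<Longrightarrow> f' t \<le> 0"
  shows "f b \<le> f a"
proof (rule DERIV_nonpos_imp_decreasing_open[OF \<open>a \<le> b\<close>])
  fix t assume t: "a < t" "t < b"
  have "at t within {0..} = at t"
    using t \<open>0 \<le> a\<close> by (intro at_within_interior) (simp add: interior_real_atLeast)
  then show "\<exists>y. DERIV f t :> y \<and> y \<le> 0" using der[of t] neg[OF t] t \<open>0 \<le> a\<close> by auto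
next
  have "continuous_on {0..} f"
    unfolding continuous_on_eq_continuous_within using der DERIV_continuous by fastforce
  then show "continuous_on {a..b} f" by (rule continuous_on_subset) (use \<open>0 \<le> a\<close> in auto)
qed

text \<open>
  A piece of a fluid solution over the time set \<open>J\<close>, with exceptional times \<open>N\<close>. The derivative is
  required only in the interior of \<open>J\<close>, so that pieces can be joined at their end points. The Lipschitz
  bound implies the absolute continuity demanded of solutions and survives gluing.
\<close>

definition fluid_segment ::
    "regime \<Rightarrow> real \<Rightarrow> real set \<Rightarrow> real set \<Rightarrow> (real \<Rightarrow> nat \<Rightarrow> real) \<Rightarrow> bool" where
  "fluid_segment r lam N J s \<longleftrightarrow>
     (\<forall>t\<in>J. s t \<in> S) \<and>
     (\<forall>i. \<forall>u\<in>J. \<forall>v\<in>J. u \<le> v \<longrightarrow> \<bar>s v i - s u i\<bar> \<le> 2 * (v - u)) \<and>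
     (\<forall>t\<in>interior J - N. \<forall>i\<ge>1. ((\<lambda>u. s u i) has_real_derivative drift r lam (s t) i) (at t))"

lemma fluid_segmentI_gated_flow:
  assumes lam: "0 < lam" "lam < 1" and J: "J \<subseteq> {0..}" "convex J"
    and der: "\<And>t i. t \<ge> 0 \<Longrightarrow> ((\<lambda>u. s u i) has_real_derivative gated_drift lam (g t) (s t) i) (at t within {0..})"
    and S: "\<And>t. t \<in> J \<Longrightarrow> s t \<in> S" and g: "\<And>t. t \<in> J \<Longrightarrow> 0 \<le> g t \<and> g t \<le> lam"
    and gate: "\<And>t. t \<in> interior J \<Longrightarrow> g t = lam * P0 r lam (s t)"
  shows "fluid_segment r lam {} J s"
  unfolding fluid_segment_def
proof (intro conjI allI ballI impI)
  show "s t \<in> S" if "t \<in> J" for t by (rule S[OF that])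
  fix i u v assume uv: "u \<in> J" "v \<in> J" "u \<le> v"
  have "norm (s v i - s u i) \<le> 2 * norm (v - u)"
  proof (rule field_differentiable_bound[OF J(2), of "\<lambda>t. s t i"])
    fix t assume t: "t \<in> J"
    show "((\<lambda>u. s u i) has_field_derivative gated_drift lam (g t) (s t) i) (at t within J)"
      using t J(1) by (intro DERIV_subset[OF der J(1)]) auto
    show "norm (gated_drift lam (g t) (s t) i) \<le> 2"
      using gated_drift_bound[OF S[OF t]] g[OF t] lam by simp
  qed (use uv in auto)
  then show "\<bar>s v i - s u i\<bar> \<le> 2 * (v - u)" using uv by simp
next
  fix t and i :: nat assume t: "t \<in> interior J - {}" and i: "i \<ge> 1"
  then have "t \<in> interior {0..}" using interior_mono[OF J(1)] by blast
  then have "at t within {0..} = at t" "t \<ge> 0"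
    by (auto intro: at_within_interior simp: interior_real_atLeast)
  then show "((\<lambda>u. s u i) has_real_derivative drift r lam (s t) i) (at t)"
    using der[of t i] gate[of t] t unfolding drift_eq_gated_drift[OF i] by simp
qed

lemma fluid_segment_glue:
  assumes s: "fluid_segment r lam N {0..T} s" and T: "T \<ge> 0"
    and q: "fluid_segment r lam N' {0..} q" and join: "q 0 = s T"
  shows "fluid_segment r lam (N \<union> {T} \<union> (\<lambda>t. t + T) ` N') {0..} (\<lambda>t. if t \<le> T then s t else q (t - T))"
    (is "fluid_segment r lam ?N {0..} ?p")
  unfolding fluid_segment_def
proof (intro conjI allI ballI impI)
  have sD: "s t \<in> S" "u \<in> {0..T} \<Longrightarrow> v \<in> {0..T} \<Longrightarrow> u \<le> v \<Longrightarrow> \<bar>s v i - s u i\<bar> \<le> 2 * (v - u)"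
    if "t \<in> {0..T}" for t u v i
    using s that unfolding fluid_segment_def by auto
  have qD: "q t \<in> S" "u \<ge> 0 \<Longrightarrow> u \<le> v \<Longrightarrow> \<bar>q v i - q u i\<bar> \<le> 2 * (v - u)"
    if "t \<ge> 0" for t u v i
    using q that unfolding fluid_segment_def by auto
  show "?p t \<in> S" if "t \<in> {0..}" for t using that sD(1) qD(1) by auto
  show "\<bar>?p v i - ?p u i\<bar> \<le> 2 * (v - u)" if uv: "u \<in> {0..}" "v \<in> {0..}" "u \<le> v" for i u v
  proof -
    \<comment> \<open>Across the junction the two Lipschitz bounds add up, since both pieces agree there.\<close>
    consider "v \<le> T" | "u \<le> T" "T < v" | "T < u" using uv by linarith
    then show ?thesis
    proof cases
      case 1
      then show ?thesis using uv sD(2)[of u u v i] by auto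
    next
      case 2
      have "\<bar>s T i - s u i\<bar> \<le> 2 * (T - u)" using uv 2 sD(2)[of u u T i] by auto
      moreover have "\<bar>q (v - T) i - q 0 i\<bar> \<le> 2 * (v - T - 0)" using 2 qD(2)[of 0 0 "v - T" i] by auto
      ultimately show ?thesis using 2 join by auto
    next
      case 3
      then show ?thesis using uv T qD(2)[of 0 "u - T" "v - T" i] by auto
    qed
  qed
  fix t and i :: nat assume t: "t \<in> interior {0..} - ?N" and i: "i \<ge> 1"
  then have t0: "t > 0" "t \<notin> N" "t \<noteq> T" by (auto simp: interior_real_atLeast)
  show "((\<lambda>u. ?p u i) has_real_derivative drift r lam (?p t) i) (at t)"
  proof (cases "t < T")
    case True
    then have "((\<lambda>u. s u i) has_real_derivative drift r lam (s t) i) (at t)"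
      using s t0 i unfolding fluid_segment_def by simp
    then have "((\<lambda>u. ?p u i) has_real_derivative drift r lam (s t) i) (at t)"
      by (rule has_field_derivative_transform_within_open[of _ _ _ "{..<T}"]) (use True in auto)
    then show ?thesis using True by simp
  next
    case False
    then have tT: "t - T > 0" using t0 by simp
    have "t - T \<notin> N'" using t by (force simp: image_iff)
    then have "((\<lambda>u. q u i) has_real_derivative drift r lam (q (t - T)) i) (at (t - T))"
      using q tT i unfolding fluid_segment_def by (simp add: interior_real_atLeast)
    then have "((\<lambda>u. q (u + - T) i) has_real_derivative drift r lam (q (t - T)) i) (at t)"
      using DERIV_shift[of "\<lambda>u. q u i" _ t "- T"] by simp
    then have "((\<lambda>u. ?p u i) has_real_derivative drift r lam (q (t - T)) i) (at t)"
      by (rule has_field_derivative_transform_within_open[of _ _ _ "{T<..}"]) (use tT in auto)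
    then show ?thesis using tT by simp
  qed
qed

lemma fluid_segment_derivative:
  assumes "fluid_segment r lam N {0..} p" "t > 0" "t \<notin> N" "i \<ge> 1"
  shows "((\<lambda>u. p u i) has_real_derivative drift r lam (p t) i) (at t within {0..})"
proof (rule has_field_derivative_at_within)
  show "((\<lambda>u. p u i) has_real_derivative drift r lam (p t) i) (at t)"
    using assms unfolding fluid_segment_def by (simp add: interior_real_atLeast)
qed

lemma sum_drift_le:
  assumes s: "s \<in> S" and lam: "0 < lam" "lam < 1" "admissible r" and n: "n \<ge> 1"
  shows "(\<Sum>i=1..n. drift r lam s i) \<le> lam"
proof -
  define g where "g = lam * P0 r lam s"
  have "(\<Sum>i=1..n. drift r lam s i) = lam - s 1 - g * s n + s (Suc n)"
    using n
  proof (induction n rule: dec_induct)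
    case base
    show ?case using drift_one[of r lam s] by (simp add: g_def numeral_2_eq_2)
  next
    case (step n)
    then show ?case using drift_ge_two[of "Suc n" r lam s] by (simp add: g_def algebra_simps)
  qed
  moreover have "g \<ge> 0" using P0_bounds(1)[OF s lam(1,3)] lam by (simp add: g_def)
  then have "0 \<le> g * s n" using S_D(1)[OF s] by simp
  moreover have "s (Suc n) \<le> s 1"
    using lift_Suc_antimono_le[of s 1 "Suc n"] S_D(4)[OF s] by simp
  ultimately show ?thesis by linarith
qed

text \<open>The total of the coordinates grows at rate at most \<open>\<lambda>\<close>, the arrival rate (\<open>sum_drift_le\<close>).\<close>

lemma fluid_segment_summable:
  assumes p: "fluid_segment r lam N {0..} p" and N: "finite N" and r: "0 < lam" "lam < 1" "admissible r"
    and s0: "summable (p 0)" and T: "T \<ge> 0"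
  shows "summable (p T)"
proof -
  have pS: "p t \<in> S" if "t \<ge> 0" for t using p that by (simp add: fluid_segment_def)
  have bound: "(\<Sum>i=1..n. p T i) \<le> (\<Sum>i. p 0 i) + T" if n: "n \<ge> 1" for n
  proof -
    have ac: "abs_continuous_on {0..T} (\<lambda>t. p t i)" for i
      using p by (intro lipschitz_imp_abs_continuous_on[where C = 2]) (auto simp: fluid_segment_def)
    have "abs_continuous_on {0..T} (\<lambda>t. \<Sum>i=1..n. \<bar>p t i - 0\<bar>)"
      by (intro abs_continuous_on_sum_abs_difference[where q = "\<lambda>_ _. 0"] ac
          lipschitz_imp_abs_continuous_on[where C = 0]) auto
    then have ac_sum: "abs_continuous_on {0..T} (\<lambda>t. \<Sum>i=1..n. \<bar>p t i\<bar>)" by simp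
    have "(\<Sum>i=1..n. \<bar>p T i\<bar>) - (\<Sum>i=1..n. \<bar>p 0 i\<bar>) \<le> integral {0..T} (\<lambda>_. 1)"
    proof (rule slope_le_imp_increment_le_integral[OF ac_sum T])
      show "{0} \<union> N \<in> null_sets lebesgue"
        using N by (simp add: negligible_iff_null_sets[symmetric] negligible_finite)
      fix t assume t: "t \<in> {0..T} - ({0} \<union> N)"
      have "((\<lambda>u. \<Sum>i=1..n. p u i) has_real_derivative (\<Sum>i=1..n. drift r lam (p t) i)) (at t within {0..})"
        by (rule DERIV_sum, rule fluid_segment_derivative[OF p]) (use t in auto)
      then have "slope_le (\<lambda>u. \<Sum>i=1..n. p u i) t (\<Sum>i=1..n. drift r lam (p t) i)"
        by (rule slope_le_derivative) (use t in auto)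
      then have "slope_le (\<lambda>u. \<Sum>i=1..n. p u i) t 1"
        by (rule slope_le_mono) (use sum_drift_le[OF pS r n, of t] r t in auto)
      then show "slope_le (\<lambda>u. \<Sum>i=1..n. \<bar>p u i\<bar>) t 1"
        using S_D(1)[OF pS] unfolding slope_le_def by simp
    qed auto
    moreover have "(\<Sum>i=1..n. \<bar>p 0 i\<bar>) \<le> (\<Sum>i. p 0 i)"
      using S_D(1)[OF pS[of 0]] by (simp add: sum_le_suminf[OF s0])
    moreover have "(\<Sum>i=1..n. \<bar>p T i\<bar>) = (\<Sum>i=1..n. p T i)"
      using S_D(1)[OF pS[OF T]] by simp
    ultimately show ?thesis using T by simp
  qed
  show ?thesis
  proof (rule summableI_nonneg_bounded[where x = "1 + ((\<Sum>i. p 0 i) + T)"])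
    fix n
    have "(\<Sum>i<n. p T i) \<le> (\<Sum>i\<in>{0..Suc n}. p T i)"
      by (rule sum_mono2) (use S_D(1)[OF pS[OF T]] in auto)
    also have "\<dots> = p T 0 + (\<Sum>i=1..Suc n. p T i)" by (simp add: sum.atLeast_Suc_atMost)
    also have "\<dots> \<le> 1 + ((\<Sum>i. p 0 i) + T)"
      using bound[of "Suc n"] S_D(2)[OF pS[OF T], of 0] by simp
    finally show "(\<Sum>i<n. p T i) \<le> 1 + ((\<Sum>i. p 0 i) + T)" .
  qed (rule S_D(1)[OF pS[OF T]])
qed

theorem fluid_segment_imp_fluid_solution:
  assumes p: "fluid_segment r lam N {0..} p" and N: "finite N" and r: "0 < lam" "lam < 1" "admissible r"
    and s0: "p 0 \<in> S1"
  shows "fluid_solution r lam (p 0) p"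
proof -
  have pS: "p t \<in> S" if "t \<ge> 0" for t using p that by (simp add: fluid_segment_def)
  have lip: "\<bar>p v i - p u i\<bar> \<le> 2 * (v - u)" if "0 \<le> u" "u \<le> v" for u v i
    using p that by (simp add: fluid_segment_def)
  have S1: "p t \<in> S1" if "t \<ge> 0" for t
    using fluid_segment_summable[OF p N r S1_D(2)[OF s0] that] pS[OF that] by (simp add: S1_def)
  have wcont: "((\<lambda>u. wnorm (\<lambda>i. p u i - p t i)) \<longlongrightarrow> 0) (at t within {0..})" if t: "t \<ge> 0" for t
  proof (rule wnorm_tendsto_0)
    fix i
    have "continuous_on {0..} (\<lambda>u. p u i)" by (rule lipschitz_imp_continuous_on_halfline[OF lip])
    then have "((\<lambda>u. p u i) \<longlongrightarrow> p t i) (at t within {0..})"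
      using t by (simp add: continuous_on)
    then show "((\<lambda>u. p u i - p t i) \<longlongrightarrow> 0) (at t within {0..})" by (simp add: LIM_zero)
  next
    have "eventually (\<lambda>u. u \<in> {0..}) (at t within {0..})" by (simp add: eventually_at_filter)
    then show "eventually (\<lambda>u. \<forall>i. \<bar>p u i - p t i\<bar> \<le> 1) (at t within {0..})"
    proof eventually_elim
      case (elim u)
      have "\<bar>p u i - p t i\<bar> \<le> 1" for i
        using S_D(1,2)[OF pS, of u i] S_D(1,2)[OF pS, of t i] elim t by (simp add: abs_le_iff)
      then show ?case by blast
    qed
    have "at_right t \<le> at t within {0..}" by (rule at_le) (use t in auto)
    then show "at t within {0..} \<noteq> bot" using trivial_limit_at_right_real[of t] le_bot by fastforce
  qed
  have null: "{0} \<union> N \<in> null_sets lebesgue"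
    using N by (simp add: negligible_iff_null_sets[symmetric] negligible_finite)
  have der: "((\<lambda>u. p u i) has_real_derivative drift r lam (p t) i) (at t within {0..})"
    if "t \<in> {0..} - ({0} \<union> N)" "i \<ge> 1" for t i
    by (rule fluid_segment_derivative[OF p]) (use that in auto)
  show ?thesis
    unfolding fluid_solution_def
  proof (intro conjI allI impI)
    show "\<exists>N\<in>null_sets lebesgue. \<forall>t\<in>{0..} - N. \<forall>i\<ge>1.
        ((\<lambda>u. p u i) has_real_derivative drift r lam (p t) i) (at t within {0..})"
      using null der by (intro bexI[of _ "{0} \<union> N"]) auto
    show "abs_continuous_on {0..T} (\<lambda>t. p t i)" for T i
      by (rule lipschitz_imp_abs_continuous_on[where C = 2]) (use lip in auto)
  qed (use S1 wcont S_D(3)[OF pS] in auto)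
qed

section \<open>Existence of fluid solutions\<close>

text \<open>
  The first coordinate does not exceed 1 since \<open>P\<^sub>0 = 1\<close> at \<open>s\<^sub>1 = 1\<close>: the upward drift
  \<open>\<lambda> (1 - P\<^sub>0 s\<^sub>1)\<close> is then at most \<open>(L + 1) (1 - s\<^sub>1)\<close>.
\<close>

lemma fluid_solution_exists_Lipschitz_gate:
  assumes r: "0 < lam" "lam < 1" "admissible r" "r \<noteq> High_Message" and s0: "s0 \<in> S1"
  shows "\<exists>s. fluid_solution r lam s0 s"
proof -
  obtain L where L: "L \<ge> 0" "\<And>s q. s \<in> S \<Longrightarrow> q \<in> S \<Longrightarrow> \<bar>P0 r lam s - P0 r lam q\<bar> \<le> L * \<bar>s 1 - q 1\<bar>"
    using P0_lipschitz[OF r(1,3,4)] by blast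
  have one: "(\<lambda>i::nat. if i \<le> 1 then 1 else 0 :: real) \<in> S" (is "?e \<in> S") by (auto simp: S_def)
  have P0_one: "P0 r lam ?e = 1" using r(4) by (cases r) (auto simp: power_0_left)
  have gate: "0 \<le> lam * P0 r lam s \<and> lam * P0 r lam s \<le> lam" if "s \<in> S" for s
    using P0_bounds[OF that r(1,3)] r by (simp add: mult_left_le)
  have "\<exists>s. s 0 = s0 \<and> (\<forall>t\<ge>0. s t \<in> S) \<and>
     (\<forall>t\<ge>0. \<forall>i. ((\<lambda>u. s u i) has_real_derivative gated_drift lam (lam * P0 r lam (s t)) (s t) i) (at t within {0..}))"
  \<comment> \<open>The inequality \<open>\<kappa> s\<^sub>1 + (L + 1) (1 - s\<^sub>1) \<le> \<kappa>\<close> needs \<open>\<kappa> \<ge> L + 1\<close>, and the monotonicity of the field needs \<open>\<kappa> \<ge> 2\<close>.\<close>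
  proof (rule flow_in_S[OF r(1,2), where C = L and \<kappa> = "L + 2"])
    fix s q :: "nat \<Rightarrow> real" and e :: real
    assume s: "s \<in> S" and q: "q \<in> S" and e: "\<And>j. \<bar>s j - q j\<bar> \<le> e"
    have "\<bar>lam * P0 r lam s - lam * P0 r lam q\<bar> = lam * \<bar>P0 r lam s - P0 r lam q\<bar>"
      using r by (simp add: right_diff_distrib[symmetric] abs_mult)
    also have "\<dots> \<le> 1 * \<bar>P0 r lam s - P0 r lam q\<bar>" using r by (intro mult_right_mono) auto
    also have "\<dots> \<le> L * \<bar>s 1 - q 1\<bar>" using L(2)[OF s q] by simp
    also have "\<dots> \<le> L * e" using e[of 1] L(1) by (rule mult_left_mono)
    finally show "\<bar>lam * P0 r lam s - lam * P0 r lam q\<bar> \<le> L * e" .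
  next
    fix s :: "nat \<Rightarrow> real" assume s: "s \<in> S"
    have s1: "0 \<le> s 1" "s 1 \<le> 1" "s 2 \<le> s 1" using S_D(1,2)[OF s, of 1] S_D(4)[OF s, of 1] by (auto simp: numeral_2_eq_2)
    define P where "P = P0 r lam s"
    have P: "0 \<le> P" "P \<le> 1" using P0_bounds[OF s r(1,3)] by (auto simp: P_def)
    have "1 - P \<le> L * (1 - s 1)" using L(2)[OF one s] P0_one s1 by (simp add: P_def)
    moreover have "P * (1 - s 1) \<le> 1 * (1 - s 1)" using P s1 by (intro mult_right_mono) auto
    ultimately have "1 - P * s 1 \<le> L * (1 - s 1) + (1 - s 1)" by (simp add: algebra_simps)
    moreover have "lam * (1 - P * s 1) \<le> 1 * (1 - P * s 1)"
      using r P s1 by (intro mult_right_mono) (auto simp: mult_le_one)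
    ultimately have "lam * (1 - P * s 1) \<le> (L + 1) * (1 - s 1)" by (simp add: algebra_simps)
    then show "(L + 2) * s 1 + gated_drift lam (lam * P0 r lam s) s 1 \<le> L + 2"
      using s1 by (simp add: gated_drift_def P_def[symmetric] algebra_simps)
  qed (use L(1) gate S1_D(1)[OF s0] in auto)
  then obtain s where s: "s 0 = s0" "\<And>t. t \<ge> 0 \<Longrightarrow> s t \<in> S"
     "\<And>t i. t \<ge> 0 \<Longrightarrow> ((\<lambda>u. s u i) has_real_derivative gated_drift lam (lam * P0 r lam (s t)) (s t) i) (at t within {0..})"
    by blast
  have "fluid_segment r lam {} {0..} s"
    by (rule fluid_segmentI_gated_flow[OF r(1,2) _ _ s(3)]) (use s(2) gate in auto)
  from fluid_segment_imp_fluid_solution[OF this _ r(1-3)] s0 s(1) show ?thesis by auto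
qed

lemma first_exit_time:
  fixes f :: "real \<Rightarrow> real"
  assumes cont: "continuous_on {0..} f" and "f 0 \<le> c" and exits: "t1 \<ge> 0" "f t1 > c"
  obtains \<tau> where "\<tau> \<ge> 0" "f \<tau> = c" "\<And>t. 0 \<le> t \<Longrightarrow> t \<le> \<tau> \<Longrightarrow> f t \<le> c" "\<exists>t>\<tau>. f t > c"
proof -
  define A where "A = {t. t \<ge> 0 \<and> f t > c}"
  define \<tau> where "\<tau> = Inf A"
  have "A \<noteq> {}" "bdd_below A" using exits by (auto simp: A_def bdd_below_def)
  have \<tau>0: "\<tau> \<ge> 0" unfolding \<tau>_def by (rule cInf_greatest) (use \<open>A \<noteq> {}\<close> in \<open>auto simp: A_def\<close>)
  have below: "f t \<le> c" if "0 \<le> t" "t < \<tau>" for t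
    using that cInf_lower[OF _ \<open>bdd_below A\<close>, of t] unfolding \<tau>_def A_def by force
  have near: "\<exists>d>0. \<forall>t\<ge>0. \<bar>t - \<tau>\<bar> < d \<longrightarrow> \<bar>f t - f \<tau>\<bar> < e" if "e > 0" for e
    using cont \<tau>0 that unfolding continuous_on_iff dist_real_def by (metis atLeast_iff)
  have "\<not> f \<tau> > c"
  proof
    assume "f \<tau> > c"
    then obtain d where d: "d > 0" "\<And>t. t \<ge> 0 \<Longrightarrow> \<bar>t - \<tau>\<bar> < d \<Longrightarrow> \<bar>f t - f \<tau>\<bar> < f \<tau> - c"
      using near[of "f \<tau> - c"] by auto
    have "\<tau> \<noteq> 0" using \<open>f \<tau> > c\<close> \<open>f 0 \<le> c\<close> by auto
    define t where "t = max 0 (\<tau> - d / 2)"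
    have "t \<ge> 0" "\<bar>t - \<tau>\<bar> < d" "t < \<tau>" using d(1) \<tau>0 \<open>\<tau> \<noteq> 0\<close> by (auto simp: t_def max_def)
    then show False using d(2)[of t] below[of t] by linarith
  qed
  moreover have "\<not> f \<tau> < c"
  proof
    assume "f \<tau> < c"
    then obtain d where d: "d > 0" "\<And>t. t \<ge> 0 \<Longrightarrow> \<bar>t - \<tau>\<bar> < d \<Longrightarrow> \<bar>f t - f \<tau>\<bar> < c - f \<tau>"
      using near[of "c - f \<tau>"] by auto
    have "\<tau> + d \<le> t" if "t \<in> A" for t
    proof (rule ccontr)
      assume "\<not> \<tau> + d \<le> t"
      moreover have "\<tau> \<le> t" unfolding \<tau>_def by (rule cInf_lower[OF that \<open>bdd_below A\<close>])
      ultimately have "\<bar>f t - f \<tau>\<bar> < c - f \<tau>" using d(2)[of t] \<tau>0 by auto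
      then show False using that by (auto simp: A_def)
    qed
    then have "\<tau> + d \<le> \<tau>" unfolding \<tau>_def by (rule cInf_greatest[OF \<open>A \<noteq> {}\<close>])
    then show False using d(1) by simp
  qed
  ultimately have eq: "f \<tau> = c" by simp
  have "\<tau> \<le> t1" unfolding \<tau>_def by (rule cInf_lower[OF _ \<open>bdd_below A\<close>]) (use exits in \<open>auto simp: A_def\<close>)
  then have "t1 > \<tau>" using eq exits by (cases "t1 = \<tau>") auto
  have "f t \<le> c" if "0 \<le> t" "t \<le> \<tau>" for t
    using below[OF that(1)] that(2) eq by (cases "t = \<tau>") auto
  then show ?thesis using that[OF \<tau>0 eq] exits(2) \<open>t1 > \<tau>\<close> by blast
qed

lemma free_flowD:
  assumes "free_flow lam s" "t \<ge> 0"
  shows "s t 0 = 1" "i \<ge> 1 \<Longrightarrow> 0 \<le> s t i" "i \<ge> 1 \<Longrightarrow> s t (Suc i) \<le> s t i"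
    "((\<lambda>u. s u i) has_real_derivative gated_drift lam 0 (s t) i) (at t within {0..})"
  using assms unfolding free_flow_def by auto

lemma free_flow_in_S:
  assumes s: "free_flow lam s" and t: "t \<ge> 0" and le: "s t 1 \<le> 1"
  shows "s t \<in> S"
proof -
  have "s t i \<le> 1" for i
  proof (induction i)
    case (Suc i)
    then show ?case using le free_flowD(3)[OF s t, of i] by (cases "i = 0") auto
  qed (simp add: free_flowD(1)[OF s t])
  moreover have "0 \<le> s t i" for i
    using free_flowD(1)[OF s t] free_flowD(2)[OF s t, of i] by (cases "i = 0") auto
  moreover have "s t (Suc i) \<le> s t i" for i
    using free_flowD(1)[OF s t] free_flowD(3)[OF s t, of i] le by (cases "i = 0") auto
  ultimately show ?thesis using free_flowD(1)[OF s t] by (simp add: S_def)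
qed

text \<open>
  With a closed gate \<open>s\<^sub>2\<close> decreases. Once \<open>s\<^sub>2 \<le> 1 - \<lambda>\<close> the first equation gives \<open>s\<^sub>1' \<le> 1 - s\<^sub>1\<close>, that is,
  \<open>exp t * (s\<^sub>1 - 1)\<close> does not increase.
\<close>

lemma free_flow_stays_unsaturated:
  assumes s: "free_flow lam s" and a: "0 \<le> a" "s a 1 \<le> 1" "s a 2 \<le> 1 - lam" and t: "a \<le> t"
  shows "s t 1 \<le> 1"
proof -
  have s2: "s u 2 \<le> 1 - lam" if "a \<le> u" for u
  proof -
    have "s u 2 \<le> s a 2"
    proof (rule nonincreasing_on_halfline[OF _ a(1) that])
      show "((\<lambda>u. s u 2) has_real_derivative gated_drift lam 0 (s v) 2) (at v within {0..})" if "v \<ge> 0" for v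
        by (rule free_flowD(4)[OF s that])
      show "gated_drift lam 0 (s v) 2 \<le> 0" if "a < v" for v
        using free_flowD(3)[OF s, of v 2] that a(1) by (simp add: gated_drift_def eval_nat_numeral)
    qed
    then show ?thesis using a(3) by simp
  qed
  have "exp t * (s t 1 - 1) \<le> exp a * (s a 1 - 1)"
  proof (rule nonincreasing_on_halfline[OF _ a(1) t])
    show "((\<lambda>u. exp u * (s u 1 - 1)) has_real_derivative
        exp v * (s v 1 - 1) + exp v * gated_drift lam 0 (s v) 1) (at v within {0..})" if "v \<ge> 0" for v
      using free_flowD(4)[OF s that, of 1] by (auto intro!: derivative_eq_intros)
    show "exp v * (s v 1 - 1) + exp v * gated_drift lam 0 (s v) 1 \<le> 0" if "a < v" for v
    proof -
      have "s v 1 - 1 + gated_drift lam 0 (s v) 1 \<le> 0"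
        using s2[of v] that by (simp add: gated_drift_def)
      then show ?thesis
        by (metis distrib_left exp_ge_zero mult_nonneg_nonpos)
    qed
  qed
  also have "\<dots> \<le> 0" using a(2) by (simp add: mult_nonneg_nonpos)
  finally show ?thesis by (simp add: mult_le_0_iff)
qed

text \<open>
  The closed gate is the correct High Message gate also at an interior time at which \<open>s\<^sub>1\<close> touches 1: there \<open>s\<^sub>1\<close> has
  a local maximum, its derivative \<open>\<lambda> - 1 + s\<^sub>2\<close> vanishes, and so does \<open>P\<^sub>0\<close>.
\<close>

lemma fluid_segment_free_flow:
  assumes lam: "0 < lam" "lam < 1" and s: "free_flow lam s"
    and J: "J \<subseteq> {0..}" "convex J" and le: "\<And>t. t \<in> J \<Longrightarrow> s t 1 \<le> 1"
  shows "fluid_segment High_Message lam {} J s"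
proof (rule fluid_segmentI_gated_flow[OF lam J, where g = "\<lambda>_. 0"])
  show "((\<lambda>u. s u i) has_real_derivative gated_drift lam 0 (s t) i) (at t within {0..})" if "t \<ge> 0" for t i
    by (rule free_flowD(4)[OF s that])
  show "s t \<in> S" if "t \<in> J" for t
    using free_flow_in_S[OF s _ le[OF that]] J(1) that by auto
  show "0 \<le> (0::real) \<and> 0 \<le> lam" using lam by simp
  fix t assume t: "t \<in> interior J"
  show "0 = lam * P0 High_Message lam (s t)"
  proof (cases "s t 1 = 1")
    case True
    have "t \<in> interior {0..}" using t interior_mono[OF J(1)] by blast
    then have "at t within {0..} = at t" "t \<ge> 0"
      by (auto intro: at_within_interior simp: interior_real_atLeast)
    then have der: "((\<lambda>u. s u 1) has_real_derivative gated_drift lam 0 (s t) 1) (at t)"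
      using free_flowD(4)[OF s, of t 1] by simp
    obtain d where d: "d > 0" "ball t d \<subseteq> interior J"
      using t open_interior open_contains_ball by metis
    have "gated_drift lam 0 (s t) 1 = 0"
    proof (rule DERIV_local_max[OF der d(1)], intro allI impI)
      fix u assume "\<bar>t - u\<bar> < d"
      then have "u \<in> ball t d" by (simp add: dist_real_def)
      then have "u \<in> J" using d(2) interior_subset by blast
      then show "s u 1 \<le> s t 1" using le True by simp
    qed
    then have "1 - s t 2 = lam" using True by (simp add: gated_drift_def)
    then show ?thesis using lam by simp
  qed simp
qed

lemma fluid_segment_from_unsaturated_state:
  assumes lam: "0 < lam" "lam < 1" and s0: "s0 \<in> S" "s0 2 \<le> 1 - lam"
  obtains s where "s 0 = s0" "fluid_segment High_Message lam {} {0..} s"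
proof -
  obtain s where s: "s 0 = s0" "free_flow lam s" using free_flow_exists[OF lam s0(1)] by blast
  have "s t 1 \<le> 1" if "t \<ge> 0" for t
    using free_flow_stays_unsaturated[OF s(2) _ _ _ that] s(1) s0 S_D(2)[OF s0(1)] by simp
  then have "fluid_segment High_Message lam {} {0..} s"
    by (intro fluid_segment_free_flow[OF lam s(2)]) auto
  then show ?thesis using that s(1) by blast
qed

text \<open>
  With the gate \<open>g = \<lambda> - 1 + s\<^sub>2\<close> the first equation reads \<open>s\<^sub>1' = (\<lambda> + s\<^sub>2) (1 - s\<^sub>1)\<close>, so that \<open>s\<^sub>1\<close> stays at 1,
  where this \<open>g\<close> is exactly \<open>\<lambda> P\<^sub>0\<close>.
\<close>

lemma fluid_segment_saturated_flow:
  assumes lam: "0 < lam" "lam < 1" and J: "J = {0..} \<or> J = {0..T}"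
    and der: "\<And>t i. t \<ge> 0 \<Longrightarrow>
      ((\<lambda>u. s u i) has_real_derivative gated_drift lam (max 0 (lam - 1 + s t 2)) (s t) i) (at t within {0..})"
    and S: "\<And>t. t \<ge> 0 \<Longrightarrow> s t \<in> S" and start: "s 0 1 = 1"
    and sat: "\<And>t. t \<in> J \<Longrightarrow> s t 2 \<ge> 1 - lam"
  shows "fluid_segment High_Message lam {} J s" and "t \<in> J \<Longrightarrow> s t 1 = 1"
proof -
  have J0: "J \<subseteq> {0..}" "convex J" using J by auto
  have s1: "s t 1 = 1" if t: "t \<in> J" for t
  proof -
    have t0: "t \<ge> 0" using t J0 by auto
    have "- s t 1 \<le> - s 0 1"
    proof (rule nonincreasing_on_halfline[OF _ order_refl t0])
      show "((\<lambda>u. - s u 1) has_real_derivative - gated_drift lam (max 0 (lam - 1 + s v 2)) (s v) 1) (at v within {0..})"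
        if "v \<ge> 0" for v
        by (intro DERIV_minus der that)
      fix v assume v: "0 < v" "v < t"
      then have "v \<in> J" using J t by auto
      then have "gated_drift lam (max 0 (lam - 1 + s v 2)) (s v) 1 = (lam + s v 2) * (1 - s v 1)"
        using sat[of v] by (simp add: gated_drift_def algebra_simps)
      moreover have "0 \<le> (lam + s v 2) * (1 - s v 1)"
        using v lam S_D(1)[OF S[of v], of 2] S_D(2)[OF S[of v], of 1] by (intro mult_nonneg_nonneg) auto
      ultimately show "- gated_drift lam (max 0 (lam - 1 + s v 2)) (s v) 1 \<le> 0" by simp
    qed
    then show ?thesis using start S_D(2)[OF S[OF t0], of 1] by simp
  qed
  then show "t \<in> J \<Longrightarrow> s t 1 = 1" by blast
  show "fluid_segment High_Message lam {} J s"
  proof (rule fluid_segmentI_gated_flow[OF lam J0 der])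
    show "s t \<in> S" if "t \<in> J" for t using S J0 that by auto
    show "0 \<le> max 0 (lam - 1 + s t 2) \<and> max 0 (lam - 1 + s t 2) \<le> lam" if "t \<in> J" for t
      using S_D(2)[OF S[of t], of 2] J0 that lam by auto
    fix t assume "t \<in> interior J"
    then have t: "t \<in> J" using interior_subset by blast
    have "lam * (1 - (1 - s t 2) / lam) = lam - 1 + s t 2" using lam by (simp add: field_simps)
    moreover have "1 - (1 - s t 2) / lam \<ge> 0" using sat[OF t] lam by (simp add: field_simps)
    ultimately show "max 0 (lam - 1 + s t 2) = lam * P0 High_Message lam (s t)"
      using s1[OF t] sat[OF t] by simp
  qed auto
qed

text \<open>
  The saturated flow is followed until \<open>s\<^sub>2\<close> first falls to \<open>1 - \<lambda>\<close>, if ever; from then on the closed-gate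
  flow is a solution for all times.
\<close>

lemma fluid_segment_from_saturated_state:
  assumes lam: "0 < lam" "lam < 1" and s0: "s0 \<in> S" "s0 1 = 1" "s0 2 \<ge> 1 - lam"
  obtains N s where "finite N" "s 0 = s0" "fluid_segment High_Message lam N {0..} s"
proof -
  have "\<exists>s. s 0 = s0 \<and> (\<forall>t\<ge>0. s t \<in> S) \<and> (\<forall>t\<ge>0. \<forall>i. ((\<lambda>u. s u i) has_real_derivative
      gated_drift lam (max 0 (lam - 1 + s t 2)) (s t) i) (at t within {0..}))"
  proof (rule flow_in_S[OF lam, where C = 1 and \<kappa> = 2])
    fix s :: "nat \<Rightarrow> real" assume s: "s \<in> S"
    show "0 \<le> max 0 (lam - 1 + s 2) \<and> max 0 (lam - 1 + s 2) \<le> lam" using S_D(2)[OF s, of 2] lam by auto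
    define g where "g = max 0 (lam - 1 + s 2)"
    have s1: "0 \<le> s 1" "s 1 \<le> 1" "s 2 \<le> 1" using S_D(1,2)[OF s] by auto
    have "(lam - 1 + s 2) * s 1 \<le> g * s 1" using s1 by (intro mult_right_mono) (auto simp: g_def)
    moreover have "(lam + s 2) * (1 - s 1) \<le> 2 * (1 - s 1)" using s1 lam by (intro mult_right_mono) auto
    ultimately show "2 * s 1 + gated_drift lam (max 0 (lam - 1 + s 2)) s 1 \<le> 2"
      unfolding g_def[symmetric] by (simp add: gated_drift_def algebra_simps)
  next
    fix s q :: "nat \<Rightarrow> real" and e :: real assume "\<And>j. \<bar>s j - q j\<bar> \<le> e"
    from this[of 2] show "\<bar>max 0 (lam - 1 + s 2) - max 0 (lam - 1 + q 2)\<bar> \<le> 1 * e" by auto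
  qed (use s0 in auto)
  then obtain s where s: "s 0 = s0" "\<And>t. t \<ge> 0 \<Longrightarrow> s t \<in> S"
    "\<And>t i. t \<ge> 0 \<Longrightarrow> ((\<lambda>u. s u i) has_real_derivative
      gated_drift lam (max 0 (lam - 1 + s t 2)) (s t) i) (at t within {0..})"
    by blast
  show ?thesis
  proof (cases "\<forall>t\<ge>0. s t 2 \<ge> 1 - lam")
    case True
    have "fluid_segment High_Message lam {} {0..} s"
      by (rule fluid_segment_saturated_flow(1)[OF lam _ s(3,2)]) (use True s0 s(1) in auto)
    then show ?thesis using that[of "{}" s] s(1) by simp
  next
    case False
    then obtain t1 where t1: "t1 \<ge> 0" "- s t1 2 > lam - 1" by force
    have "continuous_on {0..} (\<lambda>u. s u 2)"
      unfolding continuous_on_eq_continuous_within using s(3) DERIV_continuous by fastforce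
    then have "continuous_on {0..} (\<lambda>u. - s u 2)" by (rule continuous_on_minus)
    moreover have "- s 0 2 \<le> lam - 1" using s0(3) s(1) by simp
    ultimately obtain \<tau> where \<tau>: "\<tau> \<ge> 0" "- s \<tau> 2 = lam - 1"
      "\<And>t. 0 \<le> t \<Longrightarrow> t \<le> \<tau> \<Longrightarrow> - s t 2 \<le> lam - 1" "\<exists>t>\<tau>. - s t 2 > lam - 1"
      by (rule first_exit_time[where f = "\<lambda>u. - s u 2" and c = "lam - 1", OF _ _ t1]) blast
    have "s t 2 \<ge> 1 - lam" if "t \<in> {0..\<tau>}" for t using \<tau>(3)[of t] that by simp
    then have seg: "fluid_segment High_Message lam {} {0..\<tau>} s"
      by (intro fluid_segment_saturated_flow(1)[OF lam _ s(3,2)]) (use s0 s(1) in auto)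
    obtain q where q: "q 0 = s \<tau>" "fluid_segment High_Message lam {} {0..} q"
      using fluid_segment_from_unsaturated_state[OF lam s(2)[OF \<tau>(1)]] \<tau>(2) by auto
    from fluid_segment_glue[OF seg \<tau>(1) q(2,1)]
    have "fluid_segment High_Message lam {\<tau>} {0..} (\<lambda>t. if t \<le> \<tau> then s t else q (t - \<tau>))" by simp
    then show ?thesis
      by (rule that[rotated 2]) (use \<tau>(1) s(1) in auto)
  qed
qed

text \<open>
  The closed-gate flow is followed until \<open>s\<^sub>1\<close> is about to exceed 1. At that time \<open>s\<^sub>2 \<ge> 1 - \<lambda>\<close>, for otherwise
  \<open>s\<^sub>1\<close> would never exceed 1 by \<open>free_flow_stays_unsaturated\<close>; so the saturated phase can take over.
\<close>

lemma fluid_solution_exists_High_Message: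
  assumes lam: "0 < lam" "lam < 1" and s0: "s0 \<in> S1"
  shows "\<exists>s. fluid_solution High_Message lam s0 s"
proof -
  have "\<exists>N s. finite N \<and> s 0 = s0 \<and> fluid_segment High_Message lam N {0..} s"
  proof -
    obtain s where s: "s 0 = s0" "free_flow lam s" using free_flow_exists[OF lam S1_D(1)[OF s0]] by blast
    have start: "s 0 1 \<le> 1" using S_D(2)[OF S1_D(1)[OF s0]] s(1) by simp
    show ?thesis
    proof (cases "\<forall>t\<ge>0. s t 1 \<le> 1")
      case True
      then have "fluid_segment High_Message lam {} {0..} s"
        by (intro fluid_segment_free_flow[OF lam s(2)]) auto
      then show ?thesis using s(1) by blast
    next
      case False
      then obtain t1 where t1: "t1 \<ge> 0" "s t1 1 > 1" by force
      have "continuous_on {0..} (\<lambda>u. s u 1)"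
        unfolding continuous_on_eq_continuous_within using free_flowD(4)[OF s(2)] DERIV_continuous by fastforce
      then obtain \<tau> where \<tau>: "\<tau> \<ge> 0" "s \<tau> 1 = 1" "\<And>t. 0 \<le> t \<Longrightarrow> t \<le> \<tau> \<Longrightarrow> s t 1 \<le> 1" "\<exists>t>\<tau>. s t 1 > 1"
        using start by (rule first_exit_time[where f = "\<lambda>u. s u 1" and c = 1, OF _ _ t1]) blast
      have seg: "fluid_segment High_Message lam {} {0..\<tau>} s"
        by (rule fluid_segment_free_flow[OF lam s(2)]) (use \<tau>(3) in auto)
      have "s \<tau> 2 \<ge> 1 - lam"
      proof (rule ccontr)
        assume "\<not> s \<tau> 2 \<ge> 1 - lam"
        then have "s t 1 \<le> 1" if "t > \<tau>" for t
          using free_flow_stays_unsaturated[OF s(2) \<tau>(1), of t] \<tau>(2) that by simp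
        then show False using \<tau>(4) by force
      qed
      then obtain N q where q: "finite N" "q 0 = s \<tau>" "fluid_segment High_Message lam N {0..} q"
        using fluid_segment_from_saturated_state[OF lam free_flow_in_S[OF s(2) \<tau>(1)]] \<tau>(2) by auto
      from fluid_segment_glue[OF seg \<tau>(1) q(3,2)]
      show ?thesis using q(1) s(1) \<tau>(1)
        by (intro exI[of _ "{} \<union> {\<tau>} \<union> (\<lambda>t. t + \<tau>) ` N"]
            exI[of _ "\<lambda>t. if t \<le> \<tau> then s t else q (t - \<tau>)"]) auto
    qed
  qed
  then obtain N s where "finite N" "s 0 = s0" "fluid_segment High_Message lam N {0..} s" by blast
  then show ?thesis using fluid_segment_imp_fluid_solution[of High_Message lam N s] lam s0 by auto
qed

section \<open>Existence, uniqueness and global stability\<close>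

theorem theorem3p1:
  fixes r :: regime and lam :: real
  assumes "0 < lam" and "lam < 1" and "admissible r"
  shows "(\<forall>s0\<in>S1. \<exists>s. fluid_solution r lam s0 s \<and>
            (\<forall>s'. fluid_solution r lam s0 s' \<longrightarrow> (\<forall>t\<ge>0. s' t = s t))) \<and>
         (\<exists>ss. equilibrium r lam ss \<and>
            (\<forall>s'. equilibrium r lam s' \<longrightarrow> s' = ss) \<and>
            ss 0 = 1 \<and>
            (\<forall>i\<ge>1. ss i = lam * (lam * P0 r lam ss) ^ (i - 1)) \<and>
            P0 r lam ss = P0_star r lam \<and>
            (\<forall>s0\<in>S1. \<forall>s. fluid_solution r lam s0 s \<longrightarrow>
               ((\<lambda>t. wnorm (\<lambda>i. s t i - ss i)) \<longlongrightarrow> 0) at_top))"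
proof (intro conjI ballI)
  fix s0 assume s0: "s0 \<in> S1"
  have "\<exists>s. fluid_solution r lam s0 s"
  proof (cases "r = High_Message")
    case True
    show ?thesis unfolding True by (rule fluid_solution_exists_High_Message[OF assms(1,2) s0])
  qed (rule fluid_solution_exists_Lipschitz_gate[OF assms _ s0])
  then obtain s where s: "fluid_solution r lam s0 s" ..
  show "\<exists>s. fluid_solution r lam s0 s \<and>
            (\<forall>s'. fluid_solution r lam s0 s' \<longrightarrow> (\<forall>t\<ge>0. s' t = s t))"
  proof (intro exI[of _ s] conjI s allI impI)
    show "s' t = s t" if "fluid_solution r lam s0 s'" "t \<ge> 0" for s' t
      by (rule fluid_solution_unique[OF s that(1) assms that(2)])
  qed
next
  let ?e = "geometric_equilibrium r lam"
  have e1: "?e 1 = lam" by (simp add: geometric_equilibrium_def)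
  have P: "P0 r lam ?e = P0_star r lam" using P0_eq_P0_star[of lam ?e r] assms(2) e1 by simp
  note eq = equilibrium_geometric[OF assms]
  show "\<exists>ss. equilibrium r lam ss \<and>
            (\<forall>s'. equilibrium r lam s' \<longrightarrow> s' = ss) \<and>
            ss 0 = 1 \<and>
            (\<forall>i\<ge>1. ss i = lam * (lam * P0 r lam ss) ^ (i - 1)) \<and>
            P0 r lam ss = P0_star r lam \<and>
            (\<forall>s0\<in>S1. \<forall>s. fluid_solution r lam s0 s \<longrightarrow>
               ((\<lambda>t. wnorm (\<lambda>i. s t i - ss i)) \<longlongrightarrow> 0) at_top)"
  proof (intro exI[of _ ?e] conjI allI ballI impI)
    show "s' = ?e" if "equilibrium r lam s'" for s' by (rule equilibrium_unique[OF that assms])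
    show "?e i = lam * (lam * P0 r lam ?e) ^ (i - 1)" if "i \<ge> 1" for i
      unfolding P using that by (simp add: geometric_equilibrium_def)
    show "((\<lambda>t. wnorm (\<lambda>i. s t i - ?e i)) \<longlongrightarrow> 0) at_top" if "fluid_solution r lam s0 s" for s0 s
      by (rule fluid_solution_converges[OF that eq e1 assms])
  qed (use eq P in \<open>auto simp: geometric_equilibrium_def\<close>)
qed

end
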